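(* Let $G$ be a finite connected simple graph. Then the following conditions are equivalent: (i) $I_{A_G}=\langle C_{A_G}^{\mathrm{sfsf}}\rangle$; (ii) any circuit in $C_{A_G}\setminus C_{A_G}^{\mathrm{sfsf}}$ is redundant; (iii) any circuit in $C_{A_G}\setminus C_{A_G}^{\mathrm{sfsf}}$ is not indispensable; (iv) any circuit in $C_{A_G}\setminus C_{A_G}^{\mathrm{sfsf}}$ is not fundamental; (v) there exists no induced subgraph of $G$ consisting of two odd cycles $C_1,C_2$ having no common vertex and a path of length $\ge1$ which connects a vertex of $C_1$ and a vertex of $C_2$ (the path meeting $C_1$ and $C_2$ only in its two end vertices).
   Context: Let $G$ have vertex set $[d]=\{1,\dots,d\}$ and edge set $E(G)=\{e_1,\dots,e_n\}$. For an edge $e=\{i,j\}$ put $\rho(e)=\mathbf{e}_i+\mathbf{e}_j\in\mathbb{R}^d$, where $\mathbf{e}_1,\dots,\mathbf{e}_d$ are the unit coordinate vectors. $A_G\in\mathbb{Z}^{d\times n}$ is the matrix with columns $\rho(e_1),\dots,\rho(e_n)$ (the vertex-edge incidence matrix). Cycles have length at least 3 and do not repeat vertices; paths do not repeat vertices; the length is the number of edges. Let $K$ be a field. For an integer matrix $A\in\mathbb{Z}^{d\times n}$ with columns $\mathbf{a}_1,\dots,\mathbf{a}_n$, the toric ideal $I_A$ is the kernel of the $K$-algebra map $\pi:K[x_1,\dots,x_n]\to K[t_1^{\pm1},\dots,t_d^{\pm1}]$, $x_j\mapsto T^{\mathbf{a}_j}=t_1^{a_{1j}}\cdots t_d^{a_{dj}}$.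 A binomial is a difference $u-v$ of two distinct monomials. The support of a monomial $u$ is $\mathrm{supp}(u)=\{x_i : x_i \mid u\}$, and $\mathrm{supp}(u-v)=\mathrm{supp}(u)\cup\mathrm{supp}(v)$. An irreducible binomial $f\in I_A$ is a circuit of $I_A$ if there is no binomial $g\in I_A$ with $\mathrm{supp}(g)\subsetneq\mathrm{supp}(f)$. $C_A$ is the set of circuits of $I_A$, and $C_A^{\mathrm{sfsf}}$ is the set of circuits $u-v\in C_A$ such that both $u$ and $v$ are squarefree. For a binomial $f=u-v\in I_A$, let $T_f$ be the set of variables $t_i$ dividing $\pi(u)=\pi(v)$, let $K[T_f]=K[\{t_i : t_i\in T_f\}]$, and let $A_f$ be the matrix whose columns are those $\mathbf{a}_i$ with $T^{\mathbf{a}_i}\in K[T_f]$; its toric ideal is identified with $I_{A_f}=I_A\cap K[\{x_i : \pi(x_i)\in K[T_f]\}]$. The binomial $f$ is fundamental if $I_{A_f}$ is generated by $f$. It is indispensable if for every system $F$ of binomial generators of $I_A$, either $f\in F$ or $-f\in F$. It is not redundant if it belongs to some minimal (with respect to inclusion) system of binomial generators of $I_A$, and redundant otherwise. *)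

theory Defs
  imports "HOL-Algebra.Ring_Divisibility" "HOL-Library.Poly_Mapping"
begin

section \<open>Polynomial rings\<close>

text \<open>
  A polynomial is a finitely supported map from exponent vectors to coefficients.  Laurent
  polynomials are the same with integer exponents.  The type \<open>'j\<close> of indices may be infinite;
  the ring in the variables \<open>x\<^sub>j\<close> with \<open>j \<in> J\<close> is cut out by its carrier.
\<close>

type_synonym ('j, 'k) mpoly = "('j \<Rightarrow>\<^sub>0 nat) \<Rightarrow>\<^sub>0 'k"
type_synonym ('i, 'k) laurent = "('i \<Rightarrow>\<^sub>0 int) \<Rightarrow>\<^sub>0 'k"

abbreviation monomial :: "('a \<Rightarrow>\<^sub>0 'n) \<Rightarrow> ('a \<Rightarrow>\<^sub>0 'n::zero) \<Rightarrow>\<^sub>0 'k::zero_neq_one" where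
  "monomial m \<equiv> Poly_Mapping.single m 1"

definition poly_ring :: "'j set \<Rightarrow> ('j, 'k::field) mpoly ring" where
  "poly_ring J = \<lparr>carrier = {p. \<forall>m\<in>Poly_Mapping.keys p. Poly_Mapping.keys m \<subseteq> J},
                  monoid.mult = (*), one = 1, zero = 0, add = (+)\<rparr>"


section \<open>Toric ideals\<close>

text \<open>
  An integer matrix is given by its set \<open>J\<close> of column indices and its columns
  \<open>a j\<close>, which are finitely supported integer vectors.  Deleting columns amounts to
  shrinking \<open>J\<close>.
\<close>

text \<open>The \<open>K\<close>-algebra map sending \<open>x\<^sub>j\<close> to the Laurent monomial with exponent \<open>a j\<close>.\<close>

definition toric_map :: "('j \<Rightarrow> ('i \<Rightarrow>\<^sub>0 int)) \<Rightarrow> ('j, 'k::field) mpoly \<Rightarrow> ('i, 'k) laurent" where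
  "toric_map a p =
     (\<Sum>m\<in>Poly_Mapping.keys p. Poly_Mapping.single 0 (Poly_Mapping.lookup p m) * (\<Prod>j\<in>Poly_Mapping.keys m. monomial (a j) ^ Poly_Mapping.lookup m j))"

definition toric_ideal :: "('j \<Rightarrow> ('i \<Rightarrow>\<^sub>0 int)) \<Rightarrow> 'j set \<Rightarrow> ('j, 'k::field) mpoly set" where
  "toric_ideal a J = {p \<in> carrier (poly_ring J). toric_map a p = 0}"

definition is_binomial :: "('j, 'k::field) mpoly \<Rightarrow> bool" where
  "is_binomial f \<longleftrightarrow> (\<exists>u v. u \<noteq> v \<and> f = monomial u - monomial v)"

text \<open>For a binomial \<open>u - v\<close> the set \<open>keys f\<close> is \<open>{u, v}\<close>, see \<open>keys_binomial\<close> and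
  \<open>poly_supp_binomial\<close> below.\<close>

definition poly_supp :: "('j, 'k::field) mpoly \<Rightarrow> 'j set" where
  "poly_supp f = (\<Union>m\<in>Poly_Mapping.keys f. Poly_Mapping.keys m)"

definition circuits :: "('j \<Rightarrow> ('i \<Rightarrow>\<^sub>0 int)) \<Rightarrow> 'j set \<Rightarrow> ('j, 'k::field) mpoly set" where
  "circuits a J = {f \<in> toric_ideal a J. is_binomial f \<and> ring_irreducible\<^bsub>poly_ring J\<^esub> f \<and>
     \<not> (\<exists>g \<in> toric_ideal a J. is_binomial (g :: ('j, 'k) mpoly) \<and> poly_supp g \<subset> poly_supp f)}"

definition squarefree_exponent :: "('j \<Rightarrow>\<^sub>0 nat) \<Rightarrow> bool" where
  "squarefree_exponent u \<longleftrightarrow> (\<forall>j. Poly_Mapping.lookup u j \<le> 1)"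

definition sfsf_circuits :: "('j \<Rightarrow> ('i \<Rightarrow>\<^sub>0 int)) \<Rightarrow> 'j set \<Rightarrow> ('j, 'k::field) mpoly set" where
  "sfsf_circuits a J = {f \<in> circuits a J.
     \<exists>u v. f = monomial u - monomial v \<and> squarefree_exponent u \<and> squarefree_exponent v}"

definition binomial_generators ::
    "('j \<Rightarrow> ('i \<Rightarrow>\<^sub>0 int)) \<Rightarrow> 'j set \<Rightarrow> ('j, 'k::field) mpoly set \<Rightarrow> bool" where
  "binomial_generators a J F \<longleftrightarrow>
     F \<subseteq> toric_ideal a J \<and> (\<forall>f\<in>F. is_binomial f) \<and> toric_ideal a J = Idl\<^bsub>poly_ring J\<^esub> F"

definition indispensable ::
    "('j \<Rightarrow> ('i \<Rightarrow>\<^sub>0 int)) \<Rightarrow> 'j set \<Rightarrow> ('j, 'k::field) mpoly \<Rightarrow> bool" where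
  "indispensable a J f \<longleftrightarrow> (\<forall>F. binomial_generators a J F \<longrightarrow> f \<in> F \<or> - f \<in> F)"

definition redundant ::
    "('j \<Rightarrow> ('i \<Rightarrow>\<^sub>0 int)) \<Rightarrow> 'j set \<Rightarrow> ('j, 'k::field) mpoly \<Rightarrow> bool" where
  "redundant a J f \<longleftrightarrow>
     \<not> (\<exists>F. binomial_generators a J F \<and> (\<forall>F'. F' \<subset> F \<longrightarrow> \<not> binomial_generators a J F') \<and> f \<in> F)"

text \<open>
  \<open>t_vars a f\<close> is the set of (indices of) variables \<open>t\<^sub>i\<close> dividing the image of a monomial
  of \<open>f\<close>; that image is a single Laurent monomial, and for \<open>f = u - v\<close> in the toric ideal
  it is the same for \<open>u\<close> and \<open>v\<close>.
\<close>

definition t_vars :: "('j \<Rightarrow> ('i \<Rightarrow>\<^sub>0 int)) \<Rightarrow> ('j, 'k::field) mpoly \<Rightarrow> 'i set" where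
  "t_vars a f =
     {i. \<exists>m\<in>Poly_Mapping.keys f. \<exists>b\<in>Poly_Mapping.keys (toric_map a (monomial m) :: ('i, 'k) laurent). 0 < Poly_Mapping.lookup b i}"

text \<open>The polynomial ring \<open>K[t\<^sub>i : i \<in> T]\<close> inside the Laurent polynomial ring.\<close>

definition t_polys :: "'i set \<Rightarrow> ('i, 'k::field) laurent set" where
  "t_polys T = {p. \<forall>b\<in>Poly_Mapping.keys p. Poly_Mapping.keys b \<subseteq> T \<and> (\<forall>i. 0 \<le> Poly_Mapping.lookup b i)}"

text \<open>The column indices of the submatrix attached to the binomial \<open>f\<close>.\<close>

definition sub_columns ::
    "('j \<Rightarrow> ('i \<Rightarrow>\<^sub>0 int)) \<Rightarrow> 'j set \<Rightarrow> ('j, 'k::field) mpoly \<Rightarrow> 'j set" where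
  "sub_columns a J f = {j\<in>J. (monomial (a j) :: ('i, 'k) laurent) \<in> t_polys (t_vars a f)}"

definition fundamental ::
    "('j \<Rightarrow> ('i \<Rightarrow>\<^sub>0 int)) \<Rightarrow> 'j set \<Rightarrow> ('j, 'k::field) mpoly \<Rightarrow> bool" where
  "fundamental a J f \<longleftrightarrow>
     toric_ideal a (sub_columns a J f) = Idl\<^bsub>poly_ring (sub_columns a J f)\<^esub> {f}"


section \<open>Graphs\<close>

definition simple_graph :: "'v set \<Rightarrow> 'v set set \<Rightarrow> bool" where
  "simple_graph V E \<longleftrightarrow> (\<forall>e\<in>E. e \<subseteq> V \<and> card e = 2)"

text \<open>Paths and cycles are lists of distinct vertices; a cycle is closed up by an edge from
  the last vertex of the list to the first.\<close>

definition path_edges :: "'v list \<Rightarrow> 'v set set" where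
  "path_edges p = {{p ! i, p ! Suc i} | i. Suc i < length p}"

definition is_path :: "'v set \<Rightarrow> 'v set set \<Rightarrow> 'v list \<Rightarrow> bool" where
  "is_path V E p \<longleftrightarrow> p \<noteq> [] \<and> distinct p \<and> set p \<subseteq> V \<and> path_edges p \<subseteq> E"

definition cycle_edges :: "'v list \<Rightarrow> 'v set set" where
  "cycle_edges c = {{c ! i, c ! (Suc i mod length c)} | i. i < length c}"

definition is_cycle :: "'v set \<Rightarrow> 'v set set \<Rightarrow> 'v list \<Rightarrow> bool" where
  "is_cycle V E c \<longleftrightarrow> 3 \<le> length c \<and> distinct c \<and> set c \<subseteq> V \<and> cycle_edges c \<subseteq> E"

definition connected_graph :: "'v set \<Rightarrow> 'v set set \<Rightarrow> bool" where
  "connected_graph V E \<longleftrightarrow> (\<forall>u\<in>V. \<forall>v\<in>V. \<exists>p. is_path V E p \<and> hd p = u \<and> last p = v)"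

definition induced_edges :: "'v set set \<Rightarrow> 'v set \<Rightarrow> 'v set set" where
  "induced_edges E W = {e\<in>E. e \<subseteq> W}"

text \<open>
  The subgraph induced on \<open>W\<close> consists of two vertex-disjoint odd cycles and a path of
  length at least one (that is, with at least two vertices) joining them.
\<close>

definition induces_joined_odd_cycles :: "'v set \<Rightarrow> 'v set set \<Rightarrow> 'v set \<Rightarrow> bool" where
  "induces_joined_odd_cycles V E W \<longleftrightarrow>
     (\<exists>c1 c2 p. is_cycle V E c1 \<and> odd (length c1) \<and> is_cycle V E c2 \<and> odd (length c2) \<and>
        set c1 \<inter> set c2 = {} \<and>
        is_path V E p \<and> 2 \<le> length p \<and>
        set p \<inter> set c1 = {hd p} \<and> set p \<inter> set c2 = {last p} \<and>
        W = set c1 \<union> set c2 \<union> set p \<and>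
        induced_edges E W = cycle_edges c1 \<union> cycle_edges c2 \<union> path_edges p)"

text \<open>The columns of the vertex-edge incidence matrix, whose columns are indexed by the
  edges themselves.\<close>

definition edge_vec :: "'v set \<Rightarrow> ('v \<Rightarrow>\<^sub>0 int)" where
  "edge_vec e = (\<Sum>i\<in>e. Poly_Mapping.single i 1)"


section \<open>Basic facts\<close>

lemma keys_binomial:
  fixes u v :: "'j \<Rightarrow>\<^sub>0 nat"
  assumes "u \<noteq> v"
  shows "Poly_Mapping.keys (monomial u - monomial v :: ('j, 'k::field) mpoly) = {u, v}"
  using assms by (auto simp: in_keys_iff lookup_minus lookup_single when_def split: if_splits)

lemma poly_supp_binomial:
  assumes "u \<noteq> v"
  shows "poly_supp (monomial u - monomial v :: ('j, 'k::field) mpoly) = Poly_Mapping.keys u \<union> Poly_Mapping.keys v"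
  using assms by (simp add: poly_supp_def keys_binomial)

lemma poly_mapping_add_induct [case_names zero single add]:
  fixes p :: "'a \<Rightarrow>\<^sub>0 'b::comm_monoid_add"
  assumes "P 0" and "\<And>m c. P (Poly_Mapping.single m c)" and "\<And>p q. P p \<Longrightarrow> P q \<Longrightarrow> P (p + q)"
  shows "P p"
proof (induction p rule: update_induct)
  case const
  show ?case by (rule assms(1))
next
  case (update f a b)
  have "Poly_Mapping.update a b f = f + Poly_Mapping.single a b"
    using update(1)
    by (intro poly_mapping_eqI) (auto simp: lookup_update lookup_add lookup_single in_keys_iff when_def)
  then show ?case
    using assms(2,3) update by metis
qed

lemma toric_map_superset:
  assumes "finite M" "Poly_Mapping.keys p \<subseteq> M"
  shows "toric_map a p =
    (\<Sum>m\<in>M. Poly_Mapping.single 0 (Poly_Mapping.lookup p m) * (\<Prod>j\<in>Poly_Mapping.keys m. monomial (a j) ^ Poly_Mapping.lookup m j))"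
  unfolding toric_map_def
  by (rule sum.mono_neutral_left) (use assms in \<open>auto simp: in_keys_iff\<close>)

lemma toric_map_add: "toric_map a (p + q) = toric_map a p + toric_map a q"
proof -
  let ?M = "Poly_Mapping.keys p \<union> Poly_Mapping.keys q"
  show ?thesis
    by (subst (1 2 3) toric_map_superset[of ?M])
       (use keys_add[of p q] in \<open>auto simp: lookup_add single_add distrib_right sum.distrib\<close>)
qed

lemma toric_map_single:
  "toric_map a (Poly_Mapping.single m c) =
     Poly_Mapping.single 0 c * (\<Prod>j\<in>Poly_Mapping.keys m. monomial (a j) ^ Poly_Mapping.lookup m j)"
  by (subst toric_map_superset[of "{m}"]) auto

lemma toric_map_var: "toric_map a (monomial (Poly_Mapping.single j 1)) = monomial (a j)"
  by (simp add: toric_map_single)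

lemma toric_map_const: "toric_map a (Poly_Mapping.single 0 c) = Poly_Mapping.single 0 c"
  by (simp add: toric_map_single)

lemma toric_map_mult:
  fixes a :: "'j \<Rightarrow> ('i \<Rightarrow>\<^sub>0 int)" and p q :: "('j, 'k::field) mpoly"
  shows "toric_map a (p * q) = toric_map a p * toric_map a q"
proof -
  let ?X = "\<lambda>j k. (monomial (a j) :: ('i, 'k) laurent) ^ k"
  have superset: "(\<Prod>j\<in>Poly_Mapping.keys m. ?X j (Poly_Mapping.lookup m j)) =
      (\<Prod>j\<in>S. ?X j (Poly_Mapping.lookup m j))"
    if "finite S" "Poly_Mapping.keys m \<subseteq> S" for m :: "'j \<Rightarrow>\<^sub>0 nat" and S
    by (rule prod.mono_neutral_left) (use that in \<open>auto simp: in_keys_iff\<close>)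
  have single: "toric_map a (Poly_Mapping.single (m + n) (c * d)) =
      toric_map a (Poly_Mapping.single m c) * toric_map a (Poly_Mapping.single n d)"
    for m n :: "'j \<Rightarrow>\<^sub>0 nat" and c d :: 'k
  proof -
    let ?S = "Poly_Mapping.keys m \<union> Poly_Mapping.keys n"
    have eqs:
      "(\<Prod>j\<in>Poly_Mapping.keys (m + n). ?X j (Poly_Mapping.lookup (m + n) j)) =
       (\<Prod>j\<in>?S. ?X j (Poly_Mapping.lookup (m + n) j))"
      "(\<Prod>j\<in>Poly_Mapping.keys m. ?X j (Poly_Mapping.lookup m j)) =
       (\<Prod>j\<in>?S. ?X j (Poly_Mapping.lookup m j))"
      "(\<Prod>j\<in>Poly_Mapping.keys n. ?X j (Poly_Mapping.lookup n j)) =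
       (\<Prod>j\<in>?S. ?X j (Poly_Mapping.lookup n j))"
      by (rule superset; use keys_add[of m n] in force)+
    have const: "(Poly_Mapping.single 0 (c * d) :: ('i, 'k) laurent) =
        Poly_Mapping.single 0 c * Poly_Mapping.single 0 d"
      by (simp add: mult_single)
    show ?thesis
      unfolding toric_map_single eqs const
      by (simp add: lookup_add power_add prod.distrib mult_ac)
  qed
  have zero: "toric_map a (0 :: ('j, 'k) mpoly) = 0"
    by (simp add: toric_map_def)
  have half: "toric_map a (Poly_Mapping.single m c * q) =
      toric_map a (Poly_Mapping.single m c) * toric_map a q" for m c
    by (induction q rule: poly_mapping_add_induct)
       (simp_all add: zero single mult_single toric_map_add distrib_left)
  show ?thesis
    by (induction p rule: poly_mapping_add_induct)
       (simp_all add: zero half toric_map_add distrib_right)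
qed

lemma poly_ring_sel:
  "carrier (poly_ring J) = {p. \<forall>m\<in>Poly_Mapping.keys p. Poly_Mapping.keys m \<subseteq> J}"
  "mult (poly_ring J) = (*)" "one (poly_ring J) = 1" "zero (poly_ring J) = 0"
  "add (poly_ring J) = (+)"
  by (simp_all add: poly_ring_def)

lemma cring_poly_ring: "cring (poly_ring J :: ('j, 'k::field) mpoly ring)"
proof -
  let ?P = "{p :: ('j, 'k) mpoly. \<forall>m\<in>Poly_Mapping.keys p. Poly_Mapping.keys m \<subseteq> J}"
  have add: "p + q \<in> ?P" if "p \<in> ?P" "q \<in> ?P" for p q
    using that keys_add[of p q] by blast
  have mult: "p * q \<in> ?P" if "p \<in> ?P" "q \<in> ?P" for p q
  proof -
    have "Poly_Mapping.keys m \<subseteq> J" if m: "m \<in> Poly_Mapping.keys (p * q)" for m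
    proof -
      obtain r s where "m = r + s" "r \<in> Poly_Mapping.keys p" "s \<in> Poly_Mapping.keys q"
        using m keys_mult[of p q] by blast
      then show ?thesis
        using keys_add[of r s] \<open>p \<in> ?P\<close> \<open>q \<in> ?P\<close> by blast
    qed
    then show ?thesis by blast
  qed
  have neg: "\<exists>q\<in>?P. q + p = 0" if "p \<in> ?P" for p
    using that by (intro bexI[of _ "- p"]) (simp_all add: in_keys_iff)
  show ?thesis
  proof (rule cringI)
    show "abelian_group (poly_ring J :: ('j, 'k) mpoly ring)"
    proof (rule abelian_groupI)
      show "\<exists>y\<in>carrier (poly_ring J). y \<oplus>\<^bsub>poly_ring J\<^esub> x = \<zero>\<^bsub>poly_ring J\<^esub>"
        if "x \<in> carrier (poly_ring J)" for x :: "('j, 'k) mpoly"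
        using neg[of x] that unfolding poly_ring_sel by blast
      show "x \<oplus>\<^bsub>poly_ring J\<^esub> y \<in> carrier (poly_ring J)"
        if "x \<in> carrier (poly_ring J)" "y \<in> carrier (poly_ring J)" for x y :: "('j, 'k) mpoly"
        using add[of x y] that unfolding poly_ring_sel by blast
    qed (unfold poly_ring_sel, auto intro: add.assoc add.commute)
    show "Group.comm_monoid (poly_ring J :: ('j, 'k) mpoly ring)"
    proof (rule comm_monoidI)
      show "x \<otimes>\<^bsub>poly_ring J\<^esub> y \<in> carrier (poly_ring J)"
        if "x \<in> carrier (poly_ring J)" "y \<in> carrier (poly_ring J)" for x y :: "('j, 'k) mpoly"
        using mult[of x y] that unfolding poly_ring_sel by blast
    qed (unfold poly_ring_sel, auto intro: mult.assoc mult.commute)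
  qed (unfold poly_ring_sel, rule distrib_right)
qed

end

theory Submission
  imports Defs
begin

text \<open>A binomial \<open>u - v\<close> lies in the ideal generated by a set \<open>F\<close> of binomials iff \<open>u\<close> can be turned
  into \<open>v\<close> by moves from \<open>F\<close>.  If \<open>u\<close> and \<open>v\<close> are not connected by moves of smaller degree, they are
  the halves of one alternating closed walk in which a repeated vertex always cuts off two odd
  parts.  An edge between vertices at odd distance, even after reversing such a part, would connect
  \<open>u\<close> to \<open>v\<close>.  So repeated vertices are cut vertices, and the walk is an even cycle, a pair of odd
  cycles with one common vertex, or has two disjoint odd ends; then a shortest path between the ends
  and shortest odd closed walks inside them yield an induced pair of joined odd cycles.

  Conversely the kernel of the incidence matrix of such an induced subgraph is one-dimensional, so
  its circuit is fundamental.  A circuit that is not squarefree has degree at least two at both ends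
  of some edge, a squarefree one at no more than one vertex; so they never share a degree.\<close>

text \<open>An even closed part of a walk would split its binomial into two of smaller degree; hence
  the odd parts. Reversing an odd part permutes the edges inside each monomial, so one binomial has
  many walks, and contradictions arise by comparing parities on two of them. The combinatorics is
  therefore stated for a family of walks closed under rotation and such reversals. The odd cycles
  cut off by repeated vertices may have chords, and a chordless odd cycle inside need not pass
  through the cut vertex; what is found instead is an odd cycle with a tail, and the tail becomes
  part of the path. Ideals are left behind early: generation means that moves connect any two
  monomials with the same vertex degrees. Moves preserve these degrees, so a generator of larger
  degree can never take part. One statement about kernels of incidence matrices,
  \<open>rigid\<close>, serves twice: it makes even cycles, pairs of odd cycles with a common vertex
  and joined pairs circuits, and it makes induced joined pairs fundamental. Irreducibility, demanded
  of a circuit, comes from an edge of exponent one.\<close>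

abbreviation lookup where "lookup \<equiv> Poly_Mapping.lookup"
abbreviation keys where "keys \<equiv> Poly_Mapping.keys"

section \<open>Binomial ideals and congruences\<close>

text \<open>A chain is extended at its end only; symmetry and compatibility with addition are
  derived. For exponent vectors this is the congruence of being equal modulo a binomial
  ideal.\<close>

inductive conn :: "('a::comm_monoid_add \<times> 'a) set \<Rightarrow> 'a \<Rightarrow> 'a \<Rightarrow> bool" for M where
  refl: "conn M u u"
| step: "conn M u (w + p) \<Longrightarrow> (p, q) \<in> M \<union> M\<inverse> \<Longrightarrow> conn M u (w + q)"

lemma conn_trans: "conn M v w \<Longrightarrow> conn M u v \<Longrightarrow> conn M u w"
  by (induction rule: conn.induct) (auto intro: conn.step)

lemma conn_move: "(p, q) \<in> M \<union> M\<inverse> \<Longrightarrow> conn M (w + p) (w + q)"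
  using conn.step[OF conn.refl] .

lemma conn_sym: "conn M u v \<Longrightarrow> conn M v u"
proof (induction rule: conn.induct)
  case (step u w p q)
  have "conn M (w + q) (w + p)" using step by (intro conn_move) auto
  then show ?case using step.IH conn_trans by blast
qed (rule conn.refl)

lemma conn_add_left: "conn M u v \<Longrightarrow> conn M (w + u) (w + v)"
proof (induction rule: conn.induct)
  case (step u x p q)
  then show ?case using conn.step[of M "w + u" "w + x" p q] by (simp add: add.assoc)
qed (rule conn.refl)

lemma conn_add:
  assumes "conn M u v" "conn M u' v'"
  shows "conn M (u + u') (v + v')"
  using conn_add_left[OF assms(1), of u'] conn_add_left[OF assms(2), of v]
  by (metis add.commute conn_trans)

text \<open>Replaces every move of a chain by a chain of moves from \<open>N\<close>. The premise
  records that both ends of the translated move stay in the class of \<open>u\<close>; this is what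
  bounds the degrees of \<open>p\<close> and \<open>q\<close> in the applications.\<close>

lemma conn_subst:
  assumes "conn M u v"
    and "\<And>w p q. (p, q) \<in> M \<Longrightarrow> conn M u (w + p) \<Longrightarrow> conn M u (w + q) \<Longrightarrow> conn N p q"
  shows "conn N u v"
  using assms
proof (induction rule: conn.induct)
  case (step u w p q)
  have uq: "conn M u (w + q)" using step.hyps conn.step by blast
  have "conn N p q"
    using step.hyps(2) step.prems[of p q w] step.prems[of q p w] step.hyps(1) uq conn_sym by blast
  then show ?case using step conn_add_left conn_trans by blast
qed (rule conn.refl)

lemma conn_mono:
  assumes "conn M u v" "M \<subseteq> N"
  shows "conn N u v"
proof (rule conn_subst[OF assms(1)])
  fix w p q assume "(p, q) \<in> M"
  then show "conn N p q" using conn_move[of p q N 0] assms(2) by auto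
qed

text \<open>A chain may end with idle moves \<open>p = q\<close>. Dropping them leaves a last move
  that really changes the monomial, which identifies a generator.\<close>

lemma conn_last_step:
  assumes "conn M u v" "u \<noteq> v"
  obtains w p q where "v = w + q" "(p, q) \<in> M \<union> M\<inverse>" "p \<noteq> q" "conn M u (w + p)"
proof -
  have "\<exists>w p q. v = w + q \<and> (p, q) \<in> M \<union> M\<inverse> \<and> p \<noteq> q \<and> conn M u (w + p)"
    using assms
  proof (induction rule: conn.induct)
    case (step u w p q)
    then show ?case by (cases "p = q") blast+
  qed simp
  then show ?thesis using that by blast
qed

section \<open>Membership of binomials in ideals generated by binomials\<close>

definition moves :: "('j, 'k::field) mpoly set \<Rightarrow> (('j \<Rightarrow>\<^sub>0 nat) \<times> ('j \<Rightarrow>\<^sub>0 nat)) set" where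
  "moves F = {(u, v). u \<noteq> v \<and> monomial u - monomial v \<in> F}"

lemma poly_mapping_sum_single:
  "(\<Sum>m\<in>keys p. Poly_Mapping.single m (lookup p m)) = (p :: 'a \<Rightarrow>\<^sub>0 'b::comm_monoid_add)"
  by (rule poly_mapping_eqI) (simp add: lookup_sum lookup_single when_def sum.delta in_keys_iff)

lemma lookup_single_mult:
  fixes p :: "('a::cancel_comm_monoid_add) \<Rightarrow>\<^sub>0 'k::comm_semiring_1"
  shows "lookup (Poly_Mapping.single m c * p) (m + n) = c * lookup p n"
    and "keys (Poly_Mapping.single m c * p) \<subseteq> (+) m ` keys p"
proof -
  have eq: "Poly_Mapping.single m c * p =
      (\<Sum>n\<in>keys p. Poly_Mapping.single (m + n) (c * lookup p n))"
    by (subst poly_mapping_sum_single[of p, symmetric])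
      (simp add: sum_distrib_left mult_single)
  show "lookup (Poly_Mapping.single m c * p) (m + n) = c * lookup p n"
    unfolding eq by (simp add: lookup_sum lookup_single when_def sum.delta in_keys_iff)
  show "keys (Poly_Mapping.single m c * p) \<subseteq> (+) m ` keys p"
  proof
    fix k assume "k \<in> keys (Poly_Mapping.single m c * p)"
    then have "(\<Sum>n\<in>keys p. lookup (Poly_Mapping.single (m + n) (c * lookup p n)) k) \<noteq> 0"
      unfolding eq by (simp add: in_keys_iff lookup_sum)
    then obtain n where "n \<in> keys p" "lookup (Poly_Mapping.single (m + n) (c * lookup p n)) k \<noteq> 0"
      by (rule sum.not_neutral_contains_not_neutral)
    then show "k \<in> (+) m ` keys p" by (auto simp: lookup_single when_def split: if_splits)
  qed
qed

definition coeff_sum :: "'a set \<Rightarrow> ('a \<Rightarrow>\<^sub>0 'k::comm_monoid_add) \<Rightarrow> 'k" where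
  "coeff_sum K p = (\<Sum>m\<in>keys p \<inter> K. lookup p m)"

lemma coeff_sum_superset:
  assumes "finite S" "keys p \<subseteq> S"
  shows "coeff_sum K p = (\<Sum>m\<in>S \<inter> K. lookup p m)"
  unfolding coeff_sum_def
  by (rule sum.mono_neutral_left) (use assms in \<open>auto simp: in_keys_iff\<close>)

lemma coeff_sum_add: "coeff_sum K (p + q) = coeff_sum K p + coeff_sum K q"
proof -
  let ?S = "keys p \<union> keys q"
  show ?thesis
    by (subst (1 2 3) coeff_sum_superset[of ?S])
       (use keys_add[of p q] in \<open>auto simp: lookup_add sum.distrib\<close>)
qed

lemma coeff_sum_single: "coeff_sum K (Poly_Mapping.single m c) = (if m \<in> K then c else 0)"
  by (subst coeff_sum_superset[of "{m}"]) auto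

lemma coeff_sum_single_mult:
  fixes p :: "('a::cancel_comm_monoid_add) \<Rightarrow>\<^sub>0 'k::comm_semiring_1"
  shows "coeff_sum K (Poly_Mapping.single m c * p) = c * coeff_sum {n. m + n \<in> K} p"
proof -
  have "coeff_sum K (Poly_Mapping.single m c * p) =
      (\<Sum>n\<in>(+) m ` keys p \<inter> K. lookup (Poly_Mapping.single m c * p) n)"
    by (rule coeff_sum_superset[OF finite_imageI[OF finite_keys] lookup_single_mult(2)])
  also have "(+) m ` keys p \<inter> K = (+) m ` (keys p \<inter> {n. m + n \<in> K})" by auto
  also have "(\<Sum>n\<in>\<dots>. lookup (Poly_Mapping.single m c * p) n) =
      (\<Sum>n\<in>keys p \<inter> {n. m + n \<in> K}. c * lookup p n)"
    by (subst sum.reindex) (auto simp: lookup_single_mult(1))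
  finally show ?thesis by (simp add: coeff_sum_def sum_distrib_left)
qed

text \<open>Summing the coefficients over a union of congruence classes kills the ideal generated
  by the moves; this separates monomials that are not congruent.\<close>

lemma coeff_sum_genideal:
  fixes F :: "('j, 'k::field) mpoly set"
  assumes F: "F \<subseteq> carrier (poly_ring J)" and bin: "\<forall>f\<in>F. is_binomial f"
    and p: "p \<in> Idl\<^bsub>poly_ring J\<^esub> F"
    and K: "\<And>w u v. (u, v) \<in> moves F \<Longrightarrow> w + u \<in> K \<longleftrightarrow> w + v \<in> K"
  shows "coeff_sum K p = 0"
proof -
  interpret R: cring "poly_ring J :: ('j, 'k) mpoly ring" by (rule cring_poly_ring)
  \<comment> \<open>A single set \<open>K\<close> would not do: multiplication by a monomial turns
    the sum over \<open>K\<close> into the sum over a translated set. Requiring the sums to vanish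
    for all saturated sets at once makes \<open>N\<close> an ideal.\<close>
  define sat where "sat = (\<lambda>K. \<forall>w u v. (u, v) \<in> moves F \<longrightarrow> (w + u \<in> K \<longleftrightarrow> w + v \<in> K))"
  define N :: "('j, 'k) mpoly set" where "N = {p \<in> carrier (poly_ring J). \<forall>K. sat K \<longrightarrow> coeff_sum K p = 0}"
  have sat_shift: "sat {n. m + n \<in> K}" if "sat K" for m K
    using that unfolding sat_def by (simp add: add.assoc[symmetric])
  have zero: "coeff_sum K 0 = 0" for K :: "('j \<Rightarrow>\<^sub>0 nat) set" by (simp add: coeff_sum_def)
  have mult: "coeff_sum K (r * p) = 0" if "p \<in> N" "sat K" for r p :: "('j, 'k) mpoly" and K
    by (induction r rule: poly_mapping_add_induct)
      (use that sat_shift in \<open>auto simp: N_def coeff_sum_single_mult distrib_right coeff_sum_add zero\<close>)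
  have car_minus: "- p \<in> carrier (poly_ring J)" if "p \<in> carrier (poly_ring J)" for p :: "('j, 'k) mpoly"
    using that by (auto simp: poly_ring_sel)
  have "ideal N (poly_ring J)"
  proof (rule idealI)
    show "subgroup N (add_monoid (poly_ring J))"
    proof (rule R.add.subgroupI)
      show "N \<subseteq> carrier (poly_ring J)" unfolding N_def by auto
      have "0 \<in> N" using R.zero_closed by (auto simp: N_def poly_ring_sel coeff_sum_def)
      then show "N \<noteq> {}" by auto
    next
      fix a :: "('j, 'k) mpoly" assume a: "a \<in> N"
      then have ac: "a \<in> carrier (poly_ring J)" by (auto simp: N_def)
      have "\<ominus>\<^bsub>poly_ring J\<^esub> a = - a"
        using ac car_minus[OF ac] R.minus_equality[of "-a" a] by (simp add: poly_ring_sel)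
      moreover have "coeff_sum K (- a) = 0" if "sat K" for K
        using mult[OF a that, of "- 1"] by simp
      ultimately show "\<ominus>\<^bsub>poly_ring J\<^esub> a \<in> N" using car_minus[OF ac] by (simp add: N_def)
    next
      fix a b :: "('j, 'k) mpoly" assume "a \<in> N" "b \<in> N"
      then show "a \<oplus>\<^bsub>poly_ring J\<^esub> b \<in> N"
        using R.add.m_closed[of a b] by (auto simp: N_def coeff_sum_add poly_ring_sel(5))
    qed
  next
    fix a x :: "('j, 'k) mpoly" assume "a \<in> N" "x \<in> carrier (poly_ring J)"
    then show "x \<otimes>\<^bsub>poly_ring J\<^esub> a \<in> N" "a \<otimes>\<^bsub>poly_ring J\<^esub> x \<in> N"
      using mult[of a _ x] R.m_closed[of x a]
      by (auto simp: N_def poly_ring_sel(2) mult.commute)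
  qed (rule R.ring_axioms)
  moreover have "F \<subseteq> N"
  proof
    fix f assume f: "f \<in> F"
    then obtain u v where uv: "u \<noteq> v" "f = monomial u - monomial v"
      using bin is_binomial_def by metis
    have "coeff_sum K f = 0" if "sat K" for K
    proof -
      have "u \<in> K \<longleftrightarrow> v \<in> K"
        using that[unfolded sat_def, rule_format, of u v 0] uv f by (simp add: moves_def)
      then show ?thesis
        using uv coeff_sum_add[of K "f" "monomial v"] by (auto simp: coeff_sum_single)
    qed
    then show "f \<in> N" using f F by (auto simp: N_def)
  qed
  ultimately have "p \<in> N" using p R.genideal_minimal by blast
  then show ?thesis using K by (simp add: N_def sat_def)
qed

lemma binomial_in_poly_ring:
  "u \<noteq> v \<Longrightarrow> (monomial u - monomial v :: ('j, 'k::field) mpoly) \<in> carrier (poly_ring J) \<longleftrightarrow> keys u \<subseteq> J \<and> keys v \<subseteq> J"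
  by (simp add: poly_ring_sel keys_binomial)

text \<open>Telescoping along the chain. The support of the current monomial is carried along
  because the multiplier of the next move has to lie in the ring with variables
  \<open>J\<close>.\<close>

lemma conn_imp_genideal:
  fixes F :: "('j, 'k::field) mpoly set"
  assumes F: "F \<subseteq> carrier (poly_ring J)"
    and "conn (moves F) u v" "keys u \<subseteq> J"
  shows "monomial u - monomial v \<in> Idl\<^bsub>poly_ring J\<^esub> F \<and> keys v \<subseteq> J"
  using assms(2,3)
proof (induction rule: conn.induct)
  interpret R: cring "poly_ring J :: ('j, 'k) mpoly ring" by (rule cring_poly_ring)
  interpret I: ideal "Idl\<^bsub>poly_ring J\<^esub> F" "poly_ring J" by (rule R.genideal_ideal[OF F])
  {
    case (refl u)
    show ?case using I.zero_closed refl by (simp add: poly_ring_sel)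
  next
    case (step u w p q)
    define g :: "('j, 'k) mpoly" where "g = monomial p - monomial q"
    have pq: "p \<noteq> q" "g \<in> F \<or> - g \<in> F"
      using step.hyps(2) by (auto simp: moves_def g_def)
    have kp: "keys (w + p) \<subseteq> J" using step by auto
    have "keys w \<subseteq> keys (w + p)" by (auto simp: in_keys_iff lookup_add)
    then have w: "keys w \<subseteq> J" using kp by auto
    have "keys q \<subseteq> J"
      using pq F binomial_in_poly_ring[of p q J] binomial_in_poly_ring[of q p J] by (auto simp: g_def)
    then have kq: "keys (w + q) \<subseteq> J" using w keys_add[of w q] by auto
    have uminus: "- x \<in> Idl\<^bsub>poly_ring J\<^esub> F" if "x \<in> Idl\<^bsub>poly_ring J\<^esub> F" for x
      using I.I_l_closed[OF that, of "- 1"] by (simp add: poly_ring_sel)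
    have "g \<in> Idl\<^bsub>poly_ring J\<^esub> F"
      using pq(2) uminus[of "- g"] R.genideal_self[OF F] by auto
    then have "monomial w * g \<in> Idl\<^bsub>poly_ring J\<^esub> F"
      using I.I_l_closed[of g "monomial w"] w by (simp add: poly_ring_sel)
    then have "(monomial u - monomial (w + p)) + monomial w * g \<in> Idl\<^bsub>poly_ring J\<^esub> F"
      using step I.a_closed by (simp add: poly_ring_sel)
    then show ?case using kq by (simp add: g_def algebra_simps mult_single)
  }
qed

text \<open>Take coefficient sums over the class of \<open>u\<close>: if \<open>v\<close> were
  outside it, the binomial would have the sum 1 instead of 0.\<close>

lemma binomial_in_genideal_iff:
  fixes F :: "('j, 'k::field) mpoly set"
  assumes F: "F \<subseteq> carrier (poly_ring J)" "\<forall>f\<in>F. is_binomial f" and u: "keys u \<subseteq> J"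
  shows "(monomial u - monomial v \<in> Idl\<^bsub>poly_ring J\<^esub> F) \<longleftrightarrow> conn (moves F) u v"
proof
  assume in_idl: "monomial u - monomial v \<in> Idl\<^bsub>poly_ring J\<^esub> F"
  let ?K = "{w. conn (moves F) u w}"
  have "coeff_sum ?K (monomial u - monomial v :: ('j, 'k) mpoly) = 0"
  proof (rule coeff_sum_genideal[OF F in_idl])
    fix w p q assume "(p, q) \<in> moves F"
    then show "w + p \<in> ?K \<longleftrightarrow> w + q \<in> ?K"
      using conn.step[of "moves F" u w p q] conn.step[of "moves F" u w q p] by auto
  qed
  then show "conn (moves F) u v"
    using coeff_sum_add[of ?K "monomial u - monomial v" "monomial v :: ('j, 'k) mpoly"]
    by (auto simp: coeff_sum_single conn.refl split: if_splits)
qed (use conn_imp_genideal[OF F(1)] u in blast)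

section \<open>Toric ideals\<close>

text \<open>The matrix times the exponent vector \<open>m\<close>, that is, the exponent of the
  image of this monomial; the inner sum is a natural multiple of a column.\<close>

definition texp :: "('j \<Rightarrow> ('i \<Rightarrow>\<^sub>0 int)) \<Rightarrow> ('j \<Rightarrow>\<^sub>0 nat) \<Rightarrow> ('i \<Rightarrow>\<^sub>0 int)" where
  "texp a m = (\<Sum>j\<in>keys m. \<Sum>i<lookup m j. a j)"

lemma lookup_texp: "lookup (texp a m) i = (\<Sum>j\<in>keys m. int (lookup m j) * lookup (a j) i)"
  by (simp add: texp_def lookup_sum)

lemma toric_map_single_eq:
  "toric_map a (Poly_Mapping.single m c :: ('j, 'k::field) mpoly) = Poly_Mapping.single (texp a m) c"
proof -
  have pow: "(monomial b :: ('i, 'k) laurent) ^ n = monomial (\<Sum>i<n. b)" for b :: "'i \<Rightarrow>\<^sub>0 int" and n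
    by (induction n) (simp_all add: mult_single add.commute)
  have prod: "(\<Prod>j\<in>S. (monomial (f j) :: ('i, 'k) laurent)) = monomial (\<Sum>j\<in>S. f j)"
    if "finite S" for S and f :: "'j \<Rightarrow> 'i \<Rightarrow>\<^sub>0 int"
    using that by (induction rule: finite_induct) (simp_all add: mult_single)
  show ?thesis
    unfolding toric_map_single pow texp_def by (subst prod) (simp_all add: mult_single)
qed

lemma toric_map_eq_sum:
  "toric_map a (p :: ('j, 'k::field) mpoly) = (\<Sum>m\<in>keys p. Poly_Mapping.single (texp a m) (lookup p m))"
  unfolding toric_map_def[of a p] toric_map_single_eq[symmetric] toric_map_single ..

lemma toric_map_diff:
  "toric_map a (p - q :: ('j, 'k::field) mpoly) = toric_map a p - toric_map a q"
  using toric_map_add[of a "p - q" q] by simp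

lemma binomial_in_toric_ideal_iff:
  fixes a :: "'j \<Rightarrow> ('i \<Rightarrow>\<^sub>0 int)"
  assumes "u \<noteq> v"
  shows "(monomial u - monomial v :: ('j, 'k::field) mpoly) \<in> toric_ideal a J \<longleftrightarrow>
    keys u \<subseteq> J \<and> keys v \<subseteq> J \<and> texp a u = texp a v"
proof -
  have "toric_map a (monomial u - monomial v :: ('j, 'k) mpoly) = 0 \<longleftrightarrow>
      (monomial (texp a u) :: ('i, 'k) laurent) = monomial (texp a v)"
    by (simp add: toric_map_diff toric_map_single_eq)
  also have "\<dots> \<longleftrightarrow> texp a u = texp a v"
    by (metis keys_single singleton_insert_inj_eq zero_neq_one)
  finally show ?thesis
    unfolding toric_ideal_def using binomial_in_poly_ring[OF assms, where 'k = 'k] by simp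
qed

lemma toric_ideal_is_ideal: "ideal (toric_ideal a J :: ('j, 'k::field) mpoly set) (poly_ring J)"
proof -
  interpret R: cring "poly_ring J :: ('j, 'k) mpoly ring" by (rule cring_poly_ring)
  show ?thesis
  proof (rule idealI)
    show "subgroup (toric_ideal a J) (add_monoid (poly_ring J :: ('j, 'k) mpoly ring))"
    proof (rule R.add.subgroupI)
      show "toric_ideal a J \<subseteq> carrier (poly_ring J :: ('j, 'k) mpoly ring)"
        unfolding toric_ideal_def by auto
      have "0 \<in> (toric_ideal a J :: ('j, 'k) mpoly set)"
        by (simp add: toric_ideal_def poly_ring_sel toric_map_def)
      then show "(toric_ideal a J :: ('j, 'k) mpoly set) \<noteq> {}" by auto
    next
      fix x :: "('j, 'k) mpoly" assume x: "x \<in> toric_ideal a J"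
      then have xc: "x \<in> carrier (poly_ring J)" "- x \<in> carrier (poly_ring J)"
        by (auto simp: toric_ideal_def poly_ring_sel)
      then have "\<ominus>\<^bsub>poly_ring J\<^esub> x = - x"
        using R.minus_equality[of "-x" x] by (simp add: poly_ring_sel)
      moreover have "toric_map a (- x) = 0"
        using toric_map_diff[of a 0 x] x by (simp add: toric_ideal_def toric_map_def[of a 0])
      ultimately show "\<ominus>\<^bsub>poly_ring J\<^esub> x \<in> toric_ideal a J" using xc by (simp add: toric_ideal_def)
    next
      fix x y :: "('j, 'k) mpoly" assume "x \<in> toric_ideal a J" "y \<in> toric_ideal a J"
      then show "x \<oplus>\<^bsub>poly_ring J\<^esub> y \<in> toric_ideal a J"
        using R.add.m_closed[of x y] by (auto simp: toric_ideal_def toric_map_add poly_ring_sel(5))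
    qed
  next
    fix x y :: "('j, 'k) mpoly" assume "x \<in> toric_ideal a J" "y \<in> carrier (poly_ring J)"
    then show "y \<otimes>\<^bsub>poly_ring J\<^esub> x \<in> toric_ideal a J" "x \<otimes>\<^bsub>poly_ring J\<^esub> y \<in> toric_ideal a J"
      using R.m_closed[of x y] R.m_closed[of y x]
      by (auto simp: toric_ideal_def toric_map_mult poly_ring_sel(2))
  qed (rule R.ring_axioms)
qed

text \<open>Toric ideals are spanned by binomials. Since the image of \<open>p\<close> vanishes, a
  term \<open>u\<close> must be accompanied by another term \<open>v\<close> with the same image;
  subtracting a multiple of their difference removes \<open>u\<close> and brings in no new
  term.\<close>

lemma toric_ideal_subset_binomial_ideal:
  fixes N :: "('j, 'k::field) mpoly set"
  assumes N: "ideal N (poly_ring J)"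
    and bin: "\<And>u v. u \<noteq> v \<Longrightarrow> keys u \<subseteq> J \<Longrightarrow> keys v \<subseteq> J \<Longrightarrow> texp a u = texp a v \<Longrightarrow> monomial u - monomial v \<in> N"
  shows "toric_ideal a J \<subseteq> N"
proof
  interpret N: ideal N "poly_ring J" by (rule N)
  fix p :: "('j, 'k) mpoly" assume "p \<in> toric_ideal a J"
  then show "p \<in> N"
  proof (induction "card (keys p)" arbitrary: p rule: less_induct)
    case less
    show ?case
    proof (cases "p = 0")
      case True
      then show ?thesis using additive_subgroup.zero_closed[OF ideal.axioms(1)[OF N]] by (simp add: poly_ring_sel)
    next
      case False
      then obtain u where u: "u \<in> keys p" by (metis all_not_in_conv keys_eq_empty)
      have p: "p \<in> carrier (poly_ring J)" "toric_map a p = 0" using less by (auto simp: toric_ideal_def)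
      have "lookup (toric_map a p) (texp a u) = (\<Sum>m\<in>keys p. if texp a m = texp a u then lookup p m else 0)"
        unfolding toric_map_eq_sum by (simp add: lookup_sum lookup_single when_def)
      also have "\<dots> = lookup p u + (\<Sum>m\<in>keys p - {u}. if texp a m = texp a u then lookup p m else 0)"
        using u by (subst sum.remove[of _ u]) auto
      finally have "lookup p u + (\<Sum>m\<in>keys p - {u}. if texp a m = texp a u then lookup p m else 0) = 0"
        using p by simp
      then have "(\<Sum>m\<in>keys p - {u}. if texp a m = texp a u then lookup p m else 0) \<noteq> 0"
        using u by (auto simp: in_keys_iff)
      then obtain v where v: "v \<in> keys p" "v \<noteq> u" "texp a v = texp a u"
        by (rule sum.not_neutral_contains_not_neutral) (auto split: if_splits)
      define c where "c = lookup p u"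
      define b :: "('j, 'k) mpoly" where "b = monomial u - monomial v"
      have kuv: "keys u \<subseteq> J" "keys v \<subseteq> J" using p u v by (auto simp: poly_ring_sel)
      have "b \<in> N" using bin[of u v] v kuv by (simp add: b_def)
      then have cb: "Poly_Mapping.single 0 c * b \<in> N"
        using N.I_l_closed[of b "Poly_Mapping.single 0 c"] by (simp add: poly_ring_sel)
      define q where "q = p - Poly_Mapping.single 0 c * b"
      have lb: "Poly_Mapping.single 0 c * b = Poly_Mapping.single u c - Poly_Mapping.single v c"
        by (simp add: b_def right_diff_distrib mult_single)
      have "keys q \<subseteq> keys p - {u}"
        using u v unfolding q_def lb
        by (auto simp: in_keys_iff lookup_minus lookup_single when_def c_def split: if_splits)
      then have card: "card (keys q) < card (keys p)"
        using u by (metis card_Diff1_less card_mono finite_Diff finite_keys order.strict_trans1)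
      have "toric_map a (Poly_Mapping.single 0 c * b) = 0"
        using v by (simp add: lb toric_map_diff toric_map_single_eq)
      then have "q \<in> toric_ideal a J"
        using p \<open>keys q \<subseteq> keys p - {u}\<close> toric_map_diff[of a p "Poly_Mapping.single 0 c * b"]
        by (auto simp: toric_ideal_def q_def poly_ring_sel(1))
      then have "q \<in> N" using less.hyps[OF card] by simp
      then have "q + Poly_Mapping.single 0 c * b \<in> N"
        using additive_subgroup.a_closed[OF ideal.axioms(1)[OF N] _ cb] by (simp add: poly_ring_sel)
      then show ?thesis by (simp add: q_def)
    qed
  qed
qed

text \<open>The bridge from ideals to combinatorics: afterwards, generation is only tested on fibres
  of the matrix.\<close>

lemma toric_ideal_eq_genideal_iff:
  fixes F :: "('j, 'k::field) mpoly set"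
  assumes F: "F \<subseteq> toric_ideal a J" "\<forall>f\<in>F. is_binomial f"
  shows "toric_ideal a J = Idl\<^bsub>poly_ring J\<^esub> F \<longleftrightarrow>
    (\<forall>u v. keys u \<subseteq> J \<longrightarrow> keys v \<subseteq> J \<longrightarrow> texp a u = texp a v \<longrightarrow> conn (moves F) u v)"
proof -
  interpret R: cring "poly_ring J :: ('j, 'k) mpoly ring" by (rule cring_poly_ring)
  have Fc: "F \<subseteq> carrier (poly_ring J)" using F by (auto simp: toric_ideal_def)
  note iff = binomial_in_genideal_iff[OF Fc F(2)]
  have sub: "Idl\<^bsub>poly_ring J\<^esub> F \<subseteq> toric_ideal a J"
    by (rule R.genideal_minimal[OF toric_ideal_is_ideal F(1)])
  show ?thesis
  proof (intro iffI allI impI)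
    fix u v :: "'j \<Rightarrow>\<^sub>0 nat"
    assume *: "toric_ideal a J = Idl\<^bsub>poly_ring J\<^esub> F" "keys u \<subseteq> J" "keys v \<subseteq> J" "texp a u = texp a v"
    show "conn (moves F) u v"
    proof (cases "u = v")
      case False
      then have "(monomial u - monomial v :: ('j, 'k) mpoly) \<in> Idl\<^bsub>poly_ring J\<^esub> F"
        using *(2-4) unfolding *(1)[symmetric] by (simp add: binomial_in_toric_ideal_iff)
      then show ?thesis using iff[OF *(2)] by blast
    qed (simp add: conn.refl)
  next
    assume *: "\<forall>u v. keys u \<subseteq> J \<longrightarrow> keys v \<subseteq> J \<longrightarrow> texp a u = texp a v \<longrightarrow> conn (moves F) u v"
    have "toric_ideal a J \<subseteq> Idl\<^bsub>poly_ring J\<^esub> F"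
    proof (rule toric_ideal_subset_binomial_ideal[OF R.genideal_ideal[OF Fc]])
      fix u v :: "'j \<Rightarrow>\<^sub>0 nat" assume "keys u \<subseteq> J" "keys v \<subseteq> J" "texp a u = texp a v"
      then show "monomial u - monomial v \<in> Idl\<^bsub>poly_ring J\<^esub> F" using * iff by blast
    qed
    with sub show "toric_ideal a J = Idl\<^bsub>poly_ring J\<^esub> F" by blast
  qed
qed

lemma moves_toric:
  assumes "F \<subseteq> (toric_ideal a J :: ('j, 'k::field) mpoly set)" "(p, q) \<in> moves F \<union> (moves F)\<inverse>"
  shows "keys p \<subseteq> J \<and> keys q \<subseteq> J \<and> texp a p = texp a q \<and> p \<noteq> q"
proof -
  have *: "keys p \<subseteq> J \<and> keys q \<subseteq> J \<and> texp a p = texp a q \<and> p \<noteq> q" if "(p, q) \<in> moves F" for p q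
  proof -
    have "(monomial p - monomial q :: ('j, 'k) mpoly) \<in> toric_ideal a J" "p \<noteq> q"
      using that assms(1) by (auto simp: moves_def)
    then show ?thesis using binomial_in_toric_ideal_iff by blast
  qed
  show ?thesis using assms(2) *[of p q] *[of q p] by auto
qed

section \<open>Irreducible binomials\<close>

lemma ex_maximizer:
  fixes L :: "'a \<Rightarrow> 'b::linorder"
  assumes "finite A" "A \<noteq> {}"
  shows "\<exists>a\<in>A. \<forall>a'\<in>A. L a' \<le> L a"
proof -
  have "Max (L ` A) \<in> L ` A" using assms by simp
  then obtain a where "a \<in> A" "L a = Max (L ` A)" by auto
  then show ?thesis using assms by (metis Max_ge finite_imageI imageI)
qed

text \<open>Lexicographically largest elements have this property. The induction restricts both sets
  to their maxima in one coordinate at a time.\<close>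

lemma unique_sum_on:
  fixes A B :: "('j \<Rightarrow>\<^sub>0 nat) set"
  assumes "finite S" "finite A" "A \<noteq> {}" "finite B" "B \<noteq> {}"
  shows "\<exists>a\<in>A. \<exists>b\<in>B. \<forall>a'\<in>A. \<forall>b'\<in>B. a' + b' = a + b \<longrightarrow>
    (\<forall>j\<in>S. lookup a' j = lookup a j \<and> lookup b' j = lookup b j)"
  using assms
proof (induction S arbitrary: A B rule: finite_induct)
  case (insert j S)
  define top where "top = (\<lambda>A :: ('j \<Rightarrow>\<^sub>0 nat) set. {a\<in>A. \<forall>a'\<in>A. lookup a' j \<le> lookup a j})"
  have top: "finite (top A)" "top A \<noteq> {}" if "finite A" "A \<noteq> {}" for A :: "('j \<Rightarrow>\<^sub>0 nat) set"
  proof -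
    show "finite (top A)" using that(1) by (simp add: top_def)
    show "top A \<noteq> {}" using ex_maximizer[OF that, of "\<lambda>a. lookup a j"] unfolding top_def by blast
  qed
  obtain a b where ab: "a \<in> top A" "b \<in> top B" and
    *: "\<And>a' b'. a' \<in> top A \<Longrightarrow> b' \<in> top B \<Longrightarrow> a' + b' = a + b \<Longrightarrow>
        \<forall>j\<in>S. lookup a' j = lookup a j \<and> lookup b' j = lookup b j"
    using insert.IH[OF top[OF insert.prems(1,2)] top[OF insert.prems(3,4)]] by blast
  have "\<forall>j\<in>insert j S. lookup a' j = lookup a j \<and> lookup b' j = lookup b j"
    if "a' \<in> A" "b' \<in> B" "a' + b' = a + b" for a' b'
  proof -
    have "lookup a' j + lookup b' j = lookup a j + lookup b j"
      using arg_cong[OF that(3), of "\<lambda>m. lookup m j"] by (simp add: lookup_add)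
    moreover have "lookup a' j \<le> lookup a j" "lookup b' j \<le> lookup b j"
      using that ab by (auto simp: top_def)
    ultimately have eq: "lookup a' j = lookup a j" "lookup b' j = lookup b j" by auto
    then have "a' \<in> top A" "b' \<in> top B" using that ab by (auto simp: top_def)
    then show ?thesis using *[of a' b'] that eq by auto
  qed
  moreover have "a \<in> A" "b \<in> B" using ab by (simp_all add: top_def)
  ultimately show ?case by blast
qed auto

text \<open>The Newton polytope of a product is the Minkowski sum of the Newton polytopes: in every
  direction \<open>L\<close> some product of extremal terms survives.\<close>

lemma extremal_keys_mult:
  fixes p q :: "('j, 'k::field) mpoly" and L :: "('j \<Rightarrow>\<^sub>0 nat) \<Rightarrow> int"
  assumes "p \<noteq> 0" "q \<noteq> 0" and L: "\<And>m n. L (m + n) = L m + L n"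
  obtains a b where "a \<in> keys p" "b \<in> keys q" "a + b \<in> keys (p * q)"
    "\<forall>a'\<in>keys p. L a' \<le> L a" "\<forall>b'\<in>keys q. L b' \<le> L b"
proof -
  define A where "A = {a\<in>keys p. \<forall>a'\<in>keys p. L a' \<le> L a}"
  define B where "B = {a\<in>keys q. \<forall>a'\<in>keys q. L a' \<le> L a}"
  define S where "S = \<Union>(keys ` (A \<union> B))"
  have "finite A" "finite B" by (auto simp: A_def B_def)
  moreover have "A \<noteq> {}" "B \<noteq> {}"
    using ex_maximizer[of "keys p" L] ex_maximizer[of "keys q" L] assms(1,2)
    by (auto simp: A_def B_def)
  moreover have "finite S" using calculation by (auto simp: S_def)
  ultimately obtain a b where ab: "a \<in> A" "b \<in> B" and
    *: "\<And>a' b'. a' \<in> A \<Longrightarrow> b' \<in> B \<Longrightarrow> a' + b' = a + b \<Longrightarrow>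
        \<forall>j\<in>S. lookup a' j = lookup a j \<and> lookup b' j = lookup b j"
    using unique_sum_on[of S A B] by blast
  have unique: "a' = a" if "a' \<in> keys p" "b' \<in> keys q" "a' + b' = a + b" for a' b'
  proof (rule poly_mapping_eqI)
    fix j
    have "L a' + L b' = L a + L b" using that(3) L by metis
    moreover have "L a' \<le> L a" "L b' \<le> L b" using that ab by (auto simp: A_def B_def)
    ultimately have "L a' = L a" "L b' = L b" by auto
    then have mem: "a' \<in> A" "b' \<in> B" using that ab by (auto simp: A_def B_def)
    show "lookup a' j = lookup a j"
    proof (cases "j \<in> S")
      case False
      then have "j \<notin> keys a'" "j \<notin> keys a" using mem ab by (auto simp: S_def)
      then show ?thesis by (simp add: in_keys_iff)
    qed (use *[OF mem that(3)] in auto)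
  qed
  have "p * q = (\<Sum>a'\<in>keys p. Poly_Mapping.single a' (lookup p a') * q)"
    using arg_cong[OF poly_mapping_sum_single[of p, symmetric], of "\<lambda>r. r * q"]
    by (simp only: sum_distrib_right)
  then have "lookup (p * q) (a + b) =
      (\<Sum>a'\<in>keys p. lookup (Poly_Mapping.single a' (lookup p a') * q) (a + b))"
    by (simp add: lookup_sum)
  also have "\<dots> = (\<Sum>a'\<in>keys p. if a' = a then lookup p a * lookup q b else 0)"
  proof (rule sum.cong)
    fix a' assume a': "a' \<in> keys p"
    show "lookup (Poly_Mapping.single a' (lookup p a') * q) (a + b) =
        (if a' = a then lookup p a * lookup q b else 0)"
    proof (cases "a' = a")
      case False
      have "a + b \<notin> keys (Poly_Mapping.single a' (lookup p a') * q)"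
        using unique[OF a'] False lookup_single_mult(2)[of a' "lookup p a'" q]
        by (metis (no_types, lifting) imageE subsetD)
      then show ?thesis using False by (simp add: in_keys_iff)
    qed (simp add: lookup_single_mult(1))
  qed simp
  also have "\<dots> \<noteq> 0" using ab by (simp add: A_def B_def in_keys_iff)
  finally have "a + b \<in> keys (p * q)" by (simp add: in_keys_iff)
  then show ?thesis using ab that by (auto simp: A_def B_def)
qed

lemma monomial_diff_ne_zero:
  "u \<noteq> v \<Longrightarrow> (monomial u - monomial v :: ('j, 'k::field) mpoly) \<noteq> 0"
  using keys_binomial[of u v, where 'k = 'k] by auto

text \<open>The Newton polytope of the product is the segment from \<open>u\<close> to
  \<open>v\<close>, and all of the change in coordinate \<open>j\<close> is due to \<open>g\<close>.
  A nonzero exponent in \<open>h\<close> would push an end point beyond this segment in a direction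
  \<open>L\<close> that mixes \<open>j\<close> with another coordinate \<open>i\<close>.\<close>

lemma const_factor_of_binomial:
  fixes g h :: "('j, 'k::field) mpoly"
  assumes gh: "g * h = monomial u - monomial v" and disj: "keys u \<inter> keys v = {}"
    and j: "lookup u j = 1" and h: "\<And>b. b \<in> keys h \<Longrightarrow> lookup b j = 0"
  shows "keys h = {0}"
proof -
  have jv: "lookup v j = 0" using disj j by (metis disjoint_iff in_keys_iff one_neq_zero)
  have uv: "u \<noteq> v" using j jv by auto
  have keys_gh: "keys (g * h) = {u, v}" unfolding gh using uv by (rule keys_binomial)
  have nz: "g \<noteq> 0" "h \<noteq> 0" using keys_gh by auto
  obtain a1 b1 where 1: "a1 \<in> keys g" "b1 \<in> keys h" "u = a1 + b1"
    using keys_mult[of g h] keys_gh by blast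
  obtain a0 b0 where 0: "a0 \<in> keys g" "b0 \<in> keys h" "v = a0 + b0"
    using keys_mult[of g h] keys_gh by blast
  have a1j: "lookup a1 j = 1" and a0j: "lookup a0 j = 0"
    using 0 1 j jv h by (auto simp: lookup_add)
  have "b = 0" if b: "b \<in> keys h" for b
  proof (rule ccontr)
    assume "b \<noteq> 0"
    then obtain i where i: "lookup b i > 0" by (metis lookup_zero not_gr_zero poly_mapping_eqI)
    then have ij: "i \<noteq> j" using h b by auto
    consider "lookup u i = 0" | "lookup v i = 0" using disj by (metis disjoint_iff in_keys_iff)
    then show False
    proof cases
      case u0: 1
      \<comment> \<open>The weight of \<open>j\<close> is such that \<open>u\<close> has the value
        \<open>lookup v i + 1\<close> and \<open>v\<close> the value \<open>lookup v i\<close>. An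
        exponent of \<open>g\<close> with \<open>j\<close>-coordinate 1 already reaches this
        maximum, so \<open>h\<close> cannot add a positive value.\<close>
      define L where "L = (\<lambda>m. int (lookup m i) + (int (lookup v i) + 1) * int (lookup m j))"
      obtain a b' where ab: "a \<in> keys g" "b' \<in> keys h" "a + b' \<in> keys (g * h)"
        "\<forall>a'\<in>keys g. L a' \<le> L a" "\<forall>b''\<in>keys h. L b'' \<le> L b'"
        by (rule extremal_keys_mult[OF nz, of L]) (simp add: L_def lookup_add algebra_simps)
      have "L a \<ge> int (lookup v i) + 1"
        using bspec[OF ab(4) \<open>a1 \<in> keys g\<close>] a1j by (simp add: L_def)
      moreover have "L b' > 0" using bspec[OF ab(5) b] h[OF b] i by (simp add: L_def)
      ultimately have "L (a + b') > int (lookup v i) + 1" by (simp add: L_def lookup_add algebra_simps)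
      moreover have "a + b' = u \<or> a + b' = v" using ab(3) keys_gh by auto
      ultimately show False using u0 j jv by (auto simp: L_def)
    next
      case v0: 2
      \<comment> \<open>Now \<open>u\<close> has the value -1 and \<open>v\<close> the value 0,
        while the exponent \<open>a0\<close> of \<open>g\<close> is already nonnegative.\<close>
      define L where "L = (\<lambda>m. int (lookup m i) - (int (lookup u i) + 1) * int (lookup m j))"
      obtain a b' where ab: "a \<in> keys g" "b' \<in> keys h" "a + b' \<in> keys (g * h)"
        "\<forall>a'\<in>keys g. L a' \<le> L a" "\<forall>b''\<in>keys h. L b'' \<le> L b'"
        by (rule extremal_keys_mult[OF nz, of L]) (simp add: L_def lookup_add algebra_simps)
      have "L a \<ge> 0" using bspec[OF ab(4) \<open>a0 \<in> keys g\<close>] a0j by (simp add: L_def)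
      moreover have "L b' > 0" using bspec[OF ab(5) b] h[OF b] i by (simp add: L_def)
      ultimately have "L (a + b') > 0" by (simp add: L_def lookup_add algebra_simps)
      moreover have "a + b' = u \<or> a + b' = v" using ab(3) keys_gh by auto
      ultimately show False using v0 j jv by (auto simp: L_def)
    qed
  qed
  then show ?thesis using nz by (metis keys_eq_empty subset_singletonD subsetI singletonI)
qed

lemma const_in_Units:
  fixes h :: "('j, 'k::field) mpoly"
  assumes "keys h = {0}"
  shows "h \<in> Units (poly_ring J)"
proof -
  define c where "c = lookup h 0"
  have "0 \<in> keys h" using assms by simp
  then have "c \<noteq> 0" unfolding c_def in_keys_iff .
  have h: "h = Poly_Mapping.single 0 c"
  proof (rule poly_mapping_eqI)
    fix k
    have "lookup h k = 0" if "k \<noteq> 0"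
      using that assms by (simp flip: not_in_keys_iff_lookup_eq_zero)
    then show "lookup h k = lookup (Poly_Mapping.single 0 c) k"
      by (cases "k = 0") (simp_all add: c_def lookup_single)
  qed
  have "Poly_Mapping.single 0 (inverse c) * h = 1" "h * Poly_Mapping.single 0 (inverse c) = 1"
    using \<open>c \<noteq> 0\<close> by (simp_all add: h mult_single)
  moreover have "h \<in> carrier (poly_ring J)"
    "(Poly_Mapping.single 0 (inverse c) :: ('j, 'k) mpoly) \<in> carrier (poly_ring J)"
    using assms keys_single[of "0 :: 'j \<Rightarrow>\<^sub>0 nat" "inverse c"] by (simp_all add: poly_ring_sel(1))
  ultimately show ?thesis
    unfolding Units_def mem_Collect_eq poly_ring_sel(2,3) by blast
qed

text \<open>The binomial is linear in the variable \<open>j\<close>, so one of two factors is free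
  of \<open>j\<close> and hence constant. This is why every circuit below is exhibited together with
  an edge of exponent one.\<close>

lemma binomial_irreducible:
  fixes u v :: "'j \<Rightarrow>\<^sub>0 nat"
  assumes disj: "keys u \<inter> keys v = {}" and j: "lookup u j = 1"
    and kJ: "keys u \<subseteq> J" "keys v \<subseteq> J"
  shows "ring_irreducible\<^bsub>poly_ring J\<^esub> (monomial u - monomial v :: ('j, 'k::field) mpoly)"
proof -
  let ?f = "monomial u - monomial v :: ('j, 'k) mpoly"
  let ?L = "\<lambda>m :: 'j \<Rightarrow>\<^sub>0 nat. int (lookup m j)"
  have L: "?L (m + n) = ?L m + ?L n" for m n by (simp add: lookup_add)
  interpret R: cring "poly_ring J :: ('j, 'k) mpoly ring" by (rule cring_poly_ring)
  have jv: "lookup v j = 0" using disj j by (metis disjoint_iff in_keys_iff one_neq_zero)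
  have uv: "u \<noteq> v" using j jv by auto
  have f0: "?f \<noteq> 0" using uv by (rule monomial_diff_ne_zero)
  have kf: "keys ?f = {u, v}" using uv by (rule keys_binomial)
  have unit: "g \<in> Units (poly_ring J) \<or> h \<in> Units (poly_ring J)" if gh: "g * h = ?f" for g h :: "('j, 'k) mpoly"
  proof -
    have nz: "g \<noteq> 0" "h \<noteq> 0" using gh f0 by auto
    obtain a b where "a \<in> keys g" "b \<in> keys h" and ab: "a + b \<in> keys (g * h)"
      "\<forall>a'\<in>keys g. ?L a' \<le> ?L a" "\<forall>b'\<in>keys h. ?L b' \<le> ?L b"
      by (rule extremal_keys_mult[OF nz, of ?L, OF L])
    have "lookup a j + lookup b j \<le> 1"
      using ab(1) j jv unfolding gh kf by (auto simp flip: lookup_add)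
    then consider "lookup a j = 0" | "lookup b j = 0" by linarith
    then show ?thesis
    proof cases
      case 1
      have "keys g = {0}"
        by (rule const_factor_of_binomial[of h g, OF _ disj j]) (use gh ab 1 in \<open>auto simp: mult.commute\<close>)
      then show ?thesis by (simp add: const_in_Units)
    next
      case 2
      have "keys h = {0}"
        by (rule const_factor_of_binomial[OF gh disj j]) (use ab 2 in auto)
      then show ?thesis by (simp add: const_in_Units)
    qed
  qed
  have "?f \<notin> Units (poly_ring J)"
  proof
    assume "?f \<in> Units (poly_ring J)"
    then obtain g where g: "?f * g = 1"
      unfolding Units_def mem_Collect_eq poly_ring_sel(2,3) by blast
    then have "g \<noteq> 0" by auto
    obtain a b where "a \<in> keys ?f" "b \<in> keys g" and
      ab: "a + b \<in> keys (?f * g)" "\<forall>a'\<in>keys ?f. ?L a' \<le> ?L a" and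
      "\<forall>b'\<in>keys g. ?L b' \<le> ?L b"
      by (rule extremal_keys_mult[OF f0 \<open>g \<noteq> 0\<close>, of ?L, OF L])
    have "lookup a j \<ge> 1" using bspec[OF ab(2), of u] j kf by simp
    moreover have "a + b = 0" using ab(1) g by simp
    ultimately show False by (metis add_is_0 lookup_add lookup_zero not_one_le_zero)
  qed
  moreover have "b \<in> Units (poly_ring J)"
    if b: "b \<in> carrier (poly_ring J)" "properfactor (poly_ring J) b ?f" for b
  proof (rule ccontr)
    assume nb: "b \<notin> Units (poly_ring J)"
    obtain c where c: "c \<in> carrier (poly_ring J)" "?f = b * c"
      using b(2) unfolding properfactor_def factor_def poly_ring_sel(2) by blast
    then have "c \<in> Units (poly_ring J)" using unit[of b c] nb by simp
    then obtain d where d: "d \<in> carrier (poly_ring J)" "c * d = 1"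
      unfolding Units_def mem_Collect_eq poly_ring_sel(2,3) by blast
    have "b = ?f * d" by (simp add: c(2) mult.assoc d(2))
    then have "?f divides\<^bsub>poly_ring J\<^esub> b" using d(1) unfolding factor_def poly_ring_sel(2) by blast
    then show False using b(2) by (simp add: properfactor_def)
  qed
  ultimately show ?thesis
    using f0 unfolding ring_irreducible_def irreducible_def by (simp add: poly_ring_sel(4))
qed

section \<open>Walks and incidence vectors\<close>

lemma path_edges_simps [simp]:
  "path_edges [] = {}" "path_edges [a] = {}"
  "path_edges (a # b # xs) = insert {a, b} (path_edges (b # xs))"
proof -
  show "path_edges (a # b # xs) = insert {a, b} (path_edges (b # xs))" (is "?L = ?R")
  proof
    show "?L \<subseteq> ?R"
    proof
      fix e assume "e \<in> ?L"
      then obtain i where i: "Suc i < length (a # b # xs)" "e = {(a # b # xs) ! i, (a # b # xs) ! Suc i}"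
        unfolding path_edges_def by blast
      show "e \<in> ?R"
      proof (cases i)
        case (Suc k)
        then have "Suc k < length (b # xs)" "e = {(b # xs) ! k, (b # xs) ! Suc k}" using i by auto
        then show ?thesis unfolding path_edges_def by blast
      qed (use i in simp)
    qed
    show "?R \<subseteq> ?L"
    proof
      fix e assume "e \<in> ?R"
      then consider "e = {a, b}" | i where "Suc i < length (b # xs)" "e = {(b # xs) ! i, (b # xs) ! Suc i}"
        unfolding path_edges_def by blast
      then show "e \<in> ?L"
      proof cases
        case 1
        then have "Suc 0 < length (a # b # xs)" "e = {(a # b # xs) ! 0, (a # b # xs) ! Suc 0}" by auto
        then show ?thesis unfolding path_edges_def by blast
      next
        case (2 i)
        then have "Suc (Suc i) < length (a # b # xs)"
          "e = {(a # b # xs) ! Suc i, (a # b # xs) ! Suc (Suc i)}" by auto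
        then show ?thesis unfolding path_edges_def by blast
      qed
    qed
  qed
qed (auto simp: path_edges_def)

lemma path_edges_Cons: "xs \<noteq> [] \<Longrightarrow> path_edges (a # xs) = insert {a, hd xs} (path_edges xs)"
  by (cases xs) auto

lemma path_edges_append:
  "path_edges (xs @ a # ys) = path_edges (xs @ [a]) \<union> path_edges (a # ys)"
proof (induction xs)
  case (Cons x xs)
  then show ?case by (cases xs) auto
qed simp

lemma path_edges_rev [simp]: "path_edges (rev xs) = path_edges xs"
proof (induction xs)
  case (Cons x xs)
  then show ?case
    by (cases xs) (auto simp: path_edges_append[of _ _ "[x]"] insert_commute)
qed simp

lemma path_edges_subset_set: "e \<in> path_edges xs \<Longrightarrow> e \<subseteq> set xs"
  by (auto simp: path_edges_def)

lemma cycle_edges_eq: "c \<noteq> [] \<Longrightarrow> cycle_edges c = path_edges (c @ [hd c])"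
proof -
  assume c: "c \<noteq> []"
  have nth: "(c @ [hd c]) ! Suc i = c ! (Suc i mod length c)" if "i < length c" for i
    using that c by (cases "Suc i = length c") (auto simp: nth_append hd_conv_nth)
  have nth': "(c @ [hd c]) ! i = c ! i" if "i < length c" for i
    using that by (simp add: nth_append)
  have "path_edges (c @ [hd c]) = (\<lambda>i. {(c @ [hd c]) ! i, (c @ [hd c]) ! Suc i}) ` {i. i < length c}"
    unfolding path_edges_def setcompr_eq_image by simp
  also have "\<dots> = (\<lambda>i. {c ! i, c ! (Suc i mod length c)}) ` {i. i < length c}"
    by (rule image_cong) (simp_all add: nth nth')
  finally show ?thesis unfolding cycle_edges_def setcompr_eq_image by simp
qed

text \<open>A closed walk \<open>xs\<close> of even length gives the binomial with exponents \<open>pairs xs\<close> and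
  \<open>pairs (rotate1 xs)\<close>.\<close>

fun pairs :: "'v list \<Rightarrow> ('v set \<Rightarrow>\<^sub>0 nat)" where
  "pairs (a # b # xs) = Poly_Mapping.single {a, b} 1 + pairs xs"
| "pairs _ = 0"

text \<open>The edges with multiplicity, which the set \<open>path_edges\<close> forgets.\<close>

fun edge_list :: "'v list \<Rightarrow> 'v set list" where
  "edge_list (a # b # xs) = {a, b} # edge_list (b # xs)"
| "edge_list _ = []"

lemma set_edge_list: "set (edge_list xs) = path_edges xs"
  by (induction xs rule: edge_list.induct) auto

lemma edge_list_append: "edge_list (xs @ a # ys) = edge_list (xs @ [a]) @ edge_list (a # ys)"
proof (induction xs)
  case (Cons x xs)
  then show ?case by (cases xs) auto
qed simp

lemma pairs_append: "even (length xs) \<Longrightarrow> pairs (xs @ ys) = pairs xs + pairs ys"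
  by (induction xs rule: pairs.induct) (auto simp: add.assoc)

lemma pairs_snoc [simp]: "even (length xs) \<Longrightarrow> pairs (xs @ [a]) = pairs xs"
  using pairs_append[of xs "[a]"] by simp

lemma pairs_rev: "even (length xs) \<Longrightarrow> pairs (rev xs) = pairs xs"
  by (induction xs rule: pairs.induct) (auto simp: pairs_append insert_commute add.commute)

lemma keys_add_nat: "keys (u + v :: 'a \<Rightarrow>\<^sub>0 nat) = keys u \<union> keys v"
  by (auto simp: in_keys_iff lookup_add)

text \<open>\<open>pairs xs\<close> takes the steps that begin at even positions and
  \<open>pairs (tl xs)\<close> those at odd positions, so together they meet each step once.\<close>

lemma path_edges_eq_keys: "path_edges xs = keys (pairs xs) \<union> keys (pairs (tl xs))"
proof (induction xs rule: edge_list.induct)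
  case (1 a b xs)
  then show ?case by (auto simp: keys_add_nat)
qed auto

lemma keys_pairs: "keys (pairs xs) \<subseteq> path_edges xs"
  using path_edges_eq_keys by blast

lemma lookup_pairs_add:
  "lookup (pairs xs) e + lookup (pairs (tl xs)) e = count_list (edge_list xs) e"
  by (induction xs rule: edge_list.induct) (auto simp: lookup_add lookup_single when_def)

text \<open>A closed walk is given by the list of its vertices, without repeating the first one at
  the end.\<close>

definition closed_walk :: "'v set set \<Rightarrow> 'v list \<Rightarrow> bool" where
  "closed_walk E xs \<longleftrightarrow> xs \<noteq> [] \<and> even (length xs) \<and> path_edges (xs @ [hd xs]) \<subseteq> E"

section \<open>Vertex degrees of monomials and alternating closed walks\<close>

locale fin_graph =
  fixes E :: "'v set set"
  assumes fin: "finite E" and card2: "e \<in> E \<Longrightarrow> card e = 2"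
begin

lemma edge_ne: "{a, b} \<in> E \<Longrightarrow> a \<noteq> b"
  using card2 by fastforce

lemma edgeE:
  assumes "e \<in> E" "a \<in> e"
  obtains b where "e = {a, b}" "a \<noteq> b"
  using card2[OF assms(1)] assms(2) by (auto simp: card_2_iff doubleton_eq_iff)

definition vdeg :: "('v set \<Rightarrow>\<^sub>0 nat) \<Rightarrow> 'v \<Rightarrow> nat" where
  "vdeg m x = (\<Sum>e\<in>{e\<in>E. x \<in> e}. lookup m e)"

definition size :: "('v set \<Rightarrow>\<^sub>0 nat) \<Rightarrow> nat" where
  "size m = (\<Sum>e\<in>E. lookup m e)"

lemma vdeg_add: "vdeg (u + v) = (\<lambda>x. vdeg u x + vdeg v x)"
  by (simp add: vdeg_def lookup_add sum.distrib fun_eq_iff)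

lemma vdeg_zero [simp]: "vdeg 0 = (\<lambda>x. 0)"
  by (simp add: vdeg_def fun_eq_iff)

lemma vdeg_single: "e \<in> E \<Longrightarrow> vdeg (Poly_Mapping.single e 1) x = (if x \<in> e then 1 else 0)"
  using fin by (auto simp: vdeg_def lookup_single when_def sum.delta')

lemma size_add: "size (u + v) = size u + size v"
  by (simp add: size_def lookup_add sum.distrib)

lemma size_single: "e \<in> E \<Longrightarrow> size (Poly_Mapping.single e 1) = 1"
  using fin by (auto simp: size_def lookup_single when_def sum.delta')

lemma size_zero [simp]: "size 0 = 0"
  by (simp add: size_def)

lemma size_eq_0: "keys m \<subseteq> E \<Longrightarrow> size m = 0 \<Longrightarrow> m = 0"
proof (rule poly_mapping_eqI)
  fix e assume m: "keys m \<subseteq> E" "size m = 0"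
  show "lookup m e = lookup 0 e"
  proof (cases "e \<in> E")
    case True
    then show ?thesis using m fin by (auto simp: size_def)
  next
    case False
    then have "e \<notin> keys m" using m by auto
    then show ?thesis by (simp add: in_keys_iff)
  qed
qed

lemma lookup_le_vdeg: "e \<in> E \<Longrightarrow> x \<in> e \<Longrightarrow> lookup m e \<le> vdeg m x"
  unfolding vdeg_def using fin by (intro member_le_sum) auto

lemma lookup_le_size: "e \<in> E \<Longrightarrow> lookup m e \<le> size m"
  unfolding size_def using fin by (intro member_le_sum) auto

text \<open>Double counting of incidences. It makes \<open>size\<close> a function of the vertex
  degrees, so that moves preserve it.\<close>

lemma sum_vdeg: "(\<Sum>x\<in>\<Union>E. vdeg m x) = 2 * size m"
proof -
  have finV: "finite (\<Union>E)" using fin card2 by (metis card.infinite finite_Union zero_neq_numeral)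
  have "(\<Sum>x\<in>\<Union>E. vdeg m x) = (\<Sum>x\<in>\<Union>E. \<Sum>e\<in>E. if x \<in> e then lookup m e else 0)"
    using fin by (intro sum.cong) (auto simp: vdeg_def sum.inter_filter)
  also have "\<dots> = (\<Sum>e\<in>E. \<Sum>x\<in>\<Union>E. if x \<in> e then lookup m e else 0)"
    by (rule sum.swap)
  also have "\<dots> = (\<Sum>e\<in>E. 2 * lookup m e)"
  proof (rule sum.cong)
    fix e assume e: "e \<in> E"
    have "(\<Sum>x\<in>\<Union>E. if x \<in> e then lookup m e else 0) = (\<Sum>x\<in>{x\<in>\<Union>E. x \<in> e}. lookup m e)"
      by (rule sum.inter_filter[OF finV, symmetric])
    also have "{x\<in>\<Union>E. x \<in> e} = e" using e by auto
    finally show "(\<Sum>x\<in>\<Union>E. if x \<in> e then lookup m e else 0) = 2 * lookup m e"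
      using card2[OF e] by simp
  qed simp
  finally show ?thesis by (simp add: size_def sum_distrib_left)
qed

lemma vdeg_eq_imp_size_eq: "vdeg u = vdeg v \<Longrightarrow> size u = size v"
  using sum_vdeg[of u] sum_vdeg[of v] by simp

lemma lookup_texp_edge_vec:
  assumes "keys m \<subseteq> E"
  shows "lookup (texp edge_vec m) x = int (vdeg m x)"
proof -
  have ev: "lookup (edge_vec e) x = (if x \<in> e then 1 else 0)" if "e \<in> E" for e
  proof -
    have "finite e" using card2[OF that] by (metis card.infinite zero_neq_numeral)
    then show ?thesis by (simp add: edge_vec_def lookup_sum lookup_single when_def)
  qed
  have "lookup (texp edge_vec m) x = (\<Sum>e\<in>keys m. int (lookup m e) * lookup (edge_vec e) x)"
    by (rule lookup_texp)
  also have "\<dots> = (\<Sum>e\<in>E. int (lookup m e) * lookup (edge_vec e) x)"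
    using assms fin by (intro sum.mono_neutral_left) (auto simp: in_keys_iff)
  also have "\<dots> = (\<Sum>e\<in>E. if x \<in> e then int (lookup m e) else 0)"
    by (rule sum.cong) (simp_all add: ev)
  also have "\<dots> = (\<Sum>e\<in>{e\<in>E. x \<in> e}. int (lookup m e))"
    using fin by (simp add: sum.inter_filter)
  finally show ?thesis by (simp add: vdeg_def)
qed

lemma texp_eq_iff:
  assumes "keys u \<subseteq> E" "keys v \<subseteq> E"
  shows "texp edge_vec u = texp edge_vec v \<longleftrightarrow> vdeg u = vdeg v"
  using assms by (simp add: poly_mapping_eq_iff fun_eq_iff lookup_texp_edge_vec)

lemma binomial_in_toric_iff:
  assumes "u \<noteq> v"
  shows "(monomial u - monomial v :: ('v set, 'k::field) mpoly) \<in> toric_ideal edge_vec E \<longleftrightarrow>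
    keys u \<subseteq> E \<and> keys v \<subseteq> E \<and> vdeg u = vdeg v"
  using texp_eq_iff[of u v] unfolding binomial_in_toric_ideal_iff[OF assms] by blast

lemma keys_pairs_subset: "path_edges xs \<subseteq> E \<Longrightarrow> keys (pairs xs) \<subseteq> E"
  using keys_pairs by blast

lemma vdeg_pairs:
  "path_edges xs \<subseteq> E \<Longrightarrow> even (length xs) \<Longrightarrow> vdeg (pairs xs) x = count_list xs x"
proof (induction xs rule: pairs.induct)
  case (1 a b xs)
  then have ab: "{a, b} \<in> E" "a \<noteq> b" using edge_ne by auto
  have "path_edges xs \<subseteq> E" using 1(2) by (cases xs) auto
  then have "vdeg (pairs xs) x = count_list xs x" using 1 by simp
  then show ?case using ab vdeg_single[of "{a, b}" x] by (auto simp: vdeg_add)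
qed auto

lemma size_pairs: "path_edges xs \<subseteq> E \<Longrightarrow> size (pairs xs) = length xs div 2"
proof (induction xs rule: pairs.induct)
  case (1 a b xs)
  then have "path_edges xs \<subseteq> E" by (cases xs) auto
  then show ?case using 1 by (simp add: size_add size_single del: One_nat_def)
qed auto

lemma closed_walk_pairs:
  assumes "closed_walk E xs"
  shows "keys (pairs xs) \<subseteq> E" "keys (pairs (rotate1 xs)) \<subseteq> E"
    "vdeg (pairs xs) = count_list xs" "vdeg (pairs (rotate1 xs)) = count_list xs"
    "size (pairs xs) = length xs div 2"
proof -
  obtain a ys where xs: "xs = a # ys" using assms by (cases xs) (auto simp: closed_walk_def)
  have e: "even (length (a # ys))" "path_edges (a # ys @ [a]) \<subseteq> E"
    using assms by (auto simp: closed_walk_def xs)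
  have "path_edges ((a # ys) @ [a]) = path_edges (a # ys) \<union> path_edges (last (a # ys) # [a])"
    using path_edges_append[of "butlast (a # ys)" "last (a # ys)" "[a]"]
    by (metis append_butlast_last_id append.assoc append_Cons append_Nil list.distinct(1))
  then have 1: "path_edges (a # ys) \<subseteq> E" using e by auto
  have 2: "path_edges (ys @ [a]) \<subseteq> E" using e(2) by (cases ys) auto
  show "keys (pairs xs) \<subseteq> E" "keys (pairs (rotate1 xs)) \<subseteq> E"
    using keys_pairs_subset[OF 1] keys_pairs_subset[OF 2] by (simp_all add: xs)
  show "vdeg (pairs xs) = count_list xs" "vdeg (pairs (rotate1 xs)) = count_list xs"
    using vdeg_pairs[OF 1] vdeg_pairs[OF 2] e(1) by (auto simp: xs fun_eq_iff)
  show "size (pairs xs) = length xs div 2" using size_pairs[OF 1] by (simp add: xs)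
qed

lemma ex_edge_of_vdeg:
  assumes "keys m \<subseteq> E" "vdeg m x > 0"
  obtains e y m' where "e = {x, y}" "x \<noteq> y" "e \<in> E" "m = Poly_Mapping.single e 1 + m'" "keys m' \<subseteq> E"
proof -
  obtain e where e: "e \<in> E" "x \<in> e" "lookup m e \<noteq> 0"
    using assms(2) sum.not_neutral_contains_not_neutral[of "lookup m" "{e\<in>E. x \<in> e}"]
    by (auto simp: vdeg_def)
  obtain y where y: "e = {x, y}" "x \<noteq> y" using edgeE[OF e(1,2)] .
  define m' where "m' = m - Poly_Mapping.single e 1"
  have m: "m = Poly_Mapping.single e 1 + m'"
    by (rule poly_mapping_eqI) (use e in \<open>auto simp: m'_def lookup_add lookup_minus lookup_single when_def\<close>)
  have "keys m' \<subseteq> keys m" using arg_cong[OF m, of keys] by (auto simp: keys_add_nat)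
  then show ?thesis using that y e m assms(1) by blast
qed

text \<open>An Eulerian argument: walk from \<open>c\<close> along edges taken in turn from
  \<open>u\<close> and \<open>v\<close>, and remove them. By the third premise, what is left is
  balanced except that \<open>u\<close> has one edge more at the current vertex \<open>c\<close> and
  \<open>v\<close> one more at the target \<open>s\<close>. So the walk cannot get stuck before an
  edge of \<open>v\<close> leads to \<open>s\<close>. It starts with \<open>c = s\<close>, where the
  premise says that all degrees agree.\<close>

lemma alternating_walk:
  assumes "keys u \<subseteq> E" "keys v \<subseteq> E"
    and "\<And>x. vdeg v x + (if x = c then 1 else 0) = vdeg u x + (if x = s then 1 else 0)"
    and "vdeg u c > 0"
  shows "\<exists>ys u' v'. ys \<noteq> [] \<and> even (length ys) \<and> hd ys = c \<and> path_edges (ys @ [s]) \<subseteq> E \<and>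
    u = pairs ys + u' \<and> v = pairs (tl ys @ [s]) + v'"
  using assms
proof (induction "size u" arbitrary: u v c rule: less_induct)
  case less
  obtain e d u1 where e: "e = {c, d}" "c \<noteq> d" "e \<in> E" "u = Poly_Mapping.single e 1 + u1" "keys u1 \<subseteq> E"
    using ex_edge_of_vdeg[OF less.prems(1,4)] .
  have u: "vdeg u x = (if x \<in> e then 1 else 0) + vdeg u1 x" for x
    using vdeg_single[OF e(3)] by (simp add: e(4) vdeg_add)
  have "vdeg v d > 0" using less.prems(3)[of d] u[of d] e(1,2) by (auto split: if_splits)
  then obtain e' c' v1 where e': "e' = {d, c'}" "d \<noteq> c'" "e' \<in> E" "v = Poly_Mapping.single e' 1 + v1" "keys v1 \<subseteq> E"
    using ex_edge_of_vdeg[OF less.prems(2)] by metis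
  have v: "vdeg v x = (if x \<in> e' then 1 else 0) + vdeg v1 x" for x
    using vdeg_single[OF e'(3)] by (simp add: e'(4) vdeg_add)
  show ?case
  proof (cases "c' = s")
    case True
    have "u = pairs [c, d] + u1" "v = pairs (tl [c, d] @ [s]) + v1" using e e' True by simp_all
    moreover have "path_edges ([c, d] @ [s]) \<subseteq> E" using e e' True by simp
    ultimately show ?thesis by (intro exI[of _ "[c, d]"]) auto
  next
    case False
    have bal: "vdeg v1 x + (if x = c' then 1 else 0) = vdeg u1 x + (if x = s then 1 else 0)" for x
      using less.prems(3)[of x] u[of x] v[of x] e(1,2) e'(1,2) by (auto split: if_splits)
    have pos: "vdeg u1 c' > 0" using bal[of c'] False by auto
    have "size u1 < size u" using size_single[OF e(3)] by (simp add: e(4) size_add)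
    then obtain ys u' v' where ys: "ys \<noteq> []" "even (length ys)" "hd ys = c'" "path_edges (ys @ [s]) \<subseteq> E"
      "u1 = pairs ys + u'" "v1 = pairs (tl ys @ [s]) + v'"
      using less.hyps[OF _ e(5) e'(5) bal pos] by blast
    have *: "ys = c' # tl ys" using ys(1,3) by (cases ys) auto
    have "path_edges ((c # d # ys) @ [s]) \<subseteq> E" using ys(4) e(1,3) e'(1,3)
      by (subst *, subst (asm) *) simp
    moreover have "u = pairs (c # d # ys) + u'" using e ys by (simp add: add.assoc)
    moreover have "v = pairs (tl (c # d # ys) @ [s]) + v'"
      using e' ys(6) by (subst *) (simp add: add.assoc)
    ultimately show ?thesis using ys(2) by (intro exI[of _ "c # d # ys"]) auto
  qed
qed

lemma ex_closed_walk:
  assumes "keys u \<subseteq> E" "keys v \<subseteq> E" "vdeg u = vdeg v" "u \<noteq> 0"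
  obtains xs u' v' where "closed_walk E xs" "u = pairs xs + u'" "v = pairs (rotate1 xs) + v'"
proof -
  have "size u > 0" using size_eq_0 assms(1,4) by blast
  then have "(\<Sum>x\<in>\<Union>E. vdeg u x) \<noteq> 0" using sum_vdeg[of u] by simp
  then obtain s where s: "vdeg u s \<noteq> 0" by (rule sum.not_neutral_contains_not_neutral)
  obtain ys u' v' where ys: "ys \<noteq> []" "even (length ys)" "hd ys = s" "path_edges (ys @ [s]) \<subseteq> E"
      "u = pairs ys + u'" "v = pairs (tl ys @ [s]) + v'"
    using alternating_walk[OF assms(1,2), of s s] assms(3) s by auto
  have "tl ys @ [s] = rotate1 ys" using ys(1,3) by (cases ys) auto
  then show ?thesis using that[of ys u' v'] ys by (simp add: closed_walk_def)
qed

end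

section \<open>Circuits of even cycles and of joined odd cycles\<close>

lemma path_edges_snoc: "l \<noteq> [] \<Longrightarrow> path_edges (l @ [w]) = insert {last l, w} (path_edges l)"
proof (induction l)
  case (Cons a l)
  then show ?case by (cases l) (auto simp: insert_commute)
qed simp

lemma path_edges_at:
  assumes "w \<notin> set l" "w \<notin> set r" "l \<noteq> []" "r \<noteq> []"
  shows "{e\<in>path_edges (l @ w # r). w \<in> e} = {{last l, w}, {w, hd r}}"
proof -
  have "path_edges (l @ [w]) = path_edges l \<union> {{last l, w}}"
    using path_edges_snoc[OF assms(3)] by simp
  moreover have "path_edges (w # r) = insert {w, hd r} (path_edges r)"
    using assms(4) by (rule path_edges_Cons)
  moreover have "w \<notin> e" if "e \<in> path_edges l \<or> e \<in> path_edges r" for e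
    using that path_edges_subset_set[of e l] path_edges_subset_set[of e r] assms(1,2) by auto
  ultimately show ?thesis unfolding path_edges_append[of l w r] by auto
qed

lemma path_edges_loop:
  "p \<noteq> [] \<Longrightarrow> path_edges (x # p @ [y]) = insert {x, hd p} (insert {last p, y} (path_edges p))"
  using path_edges_snoc[of p y] path_edges_Cons[of "p @ [y]" x] by simp

lemma path_edges_loop_meets:
  assumes "p \<noteq> []" "e \<in> path_edges (x # p @ [y])"
  shows "e \<inter> set p \<noteq> {}"
proof -
  have "e \<subseteq> set p" "e \<noteq> {}" if "e \<in> path_edges p"
    using that path_edges_subset_set[OF that] by (auto simp: path_edges_def)
  then show ?thesis using assms(2) hd_in_set[OF assms(1)] last_in_set[OF assms(1)]
    unfolding path_edges_loop[OF assms(1)] by auto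
qed

lemma distinct_edge_list_path: "distinct ys \<Longrightarrow> distinct (edge_list ys)"
proof (induction ys rule: edge_list.induct)
  case (1 a b xs)
  then have "{a, b} \<notin> path_edges (b # xs)" using path_edges_subset_set[of "{a, b}" "b # xs"] by auto
  then show ?case using 1 by (simp add: set_edge_list)
qed auto

lemma distinct_edge_list_loop:
  assumes "distinct (x # p)" "length p \<noteq> 1"
  shows "distinct (edge_list (x # p @ [x]))"
proof (cases p)
  case (Cons b q)
  then have q: "q \<noteq> []" using assms(2) by auto
  have "distinct (edge_list (p @ [x]))" using assms(1) by (intro distinct_edge_list_path) auto
  moreover have "{x, b} \<notin> path_edges (b # q @ [x])"
  proof
    assume "{x, b} \<in> path_edges (b # q @ [x])"
    then have "{x, b} \<in> insert {b, hd q} (insert {last q, x} (path_edges q))"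
      using path_edges_loop[OF q] by metis
    moreover have "hd q \<in> set q" "last q \<in> set q" using q by auto
    ultimately show False
      using assms(1) path_edges_subset_set[of "{x, b}" q] by (auto simp: Cons doubleton_eq_iff)
  qed
  ultimately show ?thesis by (simp add: Cons set_edge_list)
qed simp

lemma count_list_distinct: "distinct ys \<Longrightarrow> count_list ys y = (if y \<in> set ys then 1 else 0)"
  by (induction ys) auto

text \<open>The stretch \<open>T\<close> is walked out and back, so its pairs come twice in the same
  monomial. For odd length the pairing straddles the end of \<open>T\<close>, and the last vertex of
  \<open>T\<close> is paired with both ends of \<open>q\<close>.\<close>

lemma pairs_out_back:
  assumes "even (length q)"
  shows "pairs (T @ q @ rev T) = pairs T + pairs T +
    (if even (length T) then pairs q else pairs (last T # q @ [last T]))"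
proof (cases "even (length T)")
  case True
  then show ?thesis using assms by (simp add: pairs_append pairs_rev add_ac)
next
  case False
  then have ne: "T \<noteq> []" by auto
  have even: "even (length (butlast T))" using False by auto
  have T: "T = butlast T @ [last T]" using ne by simp
  have "T @ q @ rev T = butlast T @ (last T # q @ [last T]) @ rev (butlast T)"
    by (subst (1 2) T) simp
  then have "pairs (T @ q @ rev T) =
      pairs (butlast T) + (pairs (last T # q @ [last T]) + pairs (butlast T))"
    using even assms
    by (simp add: pairs_append pairs_rev add.assoc del: append_assoc append.simps add: append_assoc[symmetric])
  moreover have "pairs T = pairs (butlast T)" using pairs_snoc[OF even, of "last T"] T by simp
  ultimately show ?thesis using False by (simp add: add_ac)
qed

section \<open>Subgraphs whose incidence matrix has a kernel of dimension at most one\<close>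

context fin_graph
begin

definition vsum :: "('v set \<Rightarrow> int) \<Rightarrow> 'v \<Rightarrow> int" where
  "vsum z x = (\<Sum>e\<in>{e\<in>E. x \<in> e}. z e)"

text \<open>The kernel of the incidence matrix of the graph with edges \<open>D\<close> has dimension at most
  one, and \<open>e0\<close> is a coordinate that detects it.\<close>

definition rigid :: "'v set set \<Rightarrow> 'v set \<Rightarrow> bool" where
  "rigid D e0 \<longleftrightarrow> D \<subseteq> E \<and>
    (\<forall>z. (\<forall>e. e \<notin> D \<longrightarrow> z e = 0) \<longrightarrow> (\<forall>x. vsum z x = 0) \<longrightarrow> z e0 = 0 \<longrightarrow> (\<forall>e. z e = 0))"

lemma vsum_restrict:
  assumes "D \<subseteq> E" "\<And>e. e \<notin> S \<Longrightarrow> e \<in> D \<Longrightarrow> x \<in> e \<Longrightarrow> z e = 0" "\<And>e. e \<notin> D \<Longrightarrow> z e = 0"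
    "S \<subseteq> {e\<in>E. x \<in> e}"
  shows "vsum z x = (\<Sum>e\<in>S. z e)"
  unfolding vsum_def using assms fin by (intro sum.mono_neutral_right) auto

lemma vsum_diff_vdeg: "vsum (\<lambda>e. int (lookup u e) - int (lookup v e)) x = int (vdeg u x) - int (vdeg v x)"
  by (simp add: vsum_def vdeg_def sum_subtractf)

text \<open>Subtracting the right multiple of \<open>u0 - v0\<close> from \<open>u - v\<close> makes
  the coordinate \<open>e0\<close> vanish.\<close>

lemma rigid_multiple:
  assumes rigid: "rigid (keys u0 \<union> keys v0) e0" and deg0: "vdeg u0 = vdeg v0"
    and e0: "lookup u0 e0 = 1" "lookup v0 e0 = 0"
    and k: "keys u \<subseteq> keys u0 \<union> keys v0" "keys v \<subseteq> keys u0 \<union> keys v0" and deg: "vdeg u = vdeg v"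
  shows "int (lookup u e) - int (lookup v e) =
    (int (lookup u e0) - int (lookup v e0)) * (int (lookup u0 e) - int (lookup v0 e))"
proof -
  define c where "c = int (lookup u e0) - int (lookup v e0)"
  define z where "z = (\<lambda>e. (int (lookup u e) - int (lookup v e)) - c * (int (lookup u0 e) - int (lookup v0 e)))"
  have "z e = 0" if "e \<notin> keys u0 \<union> keys v0" for e
  proof -
    have "e \<notin> keys u0" "e \<notin> keys v0" "e \<notin> keys u" "e \<notin> keys v" using that k by auto
    then show ?thesis by (simp add: z_def in_keys_iff)
  qed
  moreover have "vsum z x = 0" for x
  proof -
    have "vsum z x = vsum (\<lambda>e. int (lookup u e) - int (lookup v e)) x -
        c * vsum (\<lambda>e. int (lookup u0 e) - int (lookup v0 e)) x"
      by (simp add: vsum_def z_def sum_subtractf flip: sum_distrib_left)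
    then show ?thesis using deg deg0 by (simp add: vsum_diff_vdeg)
  qed
  moreover have "z e0 = 0" using e0 by (simp add: z_def c_def)
  ultimately have "z e = 0" using rigid unfolding rigid_def by blast
  then show ?thesis by (simp add: z_def c_def)
qed

text \<open>A binomial supported inside has an exponent difference that is a nonzero multiple of
  \<open>u0 - v0\<close>; as \<open>u0\<close> and \<open>v0\<close> have disjoint supports, nothing
  cancels and its support is everything.\<close>

lemma rigid_circuit:
  assumes rigid: "rigid (keys u0 \<union> keys v0) e0" and deg0: "vdeg u0 = vdeg v0"
    and disj: "keys u0 \<inter> keys v0 = {}" and e0: "lookup u0 e0 = 1"
  shows "(monomial u0 - monomial v0 :: ('v set, 'k::field) mpoly) \<in> circuits edge_vec E"
proof -
  let ?f = "monomial u0 - monomial v0 :: ('v set, 'k) mpoly"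
  have e0v: "lookup v0 e0 = 0" using disj e0 by (metis disjoint_iff in_keys_iff one_neq_zero)
  have ne: "u0 \<noteq> v0" using e0 e0v by auto
  have kE: "keys u0 \<subseteq> E" "keys v0 \<subseteq> E" using rigid by (auto simp: rigid_def)
  have "?f \<in> toric_ideal edge_vec E" using binomial_in_toric_iff[OF ne] kE deg0 by blast
  moreover have "is_binomial ?f" using ne unfolding is_binomial_def by blast
  moreover have "ring_irreducible\<^bsub>poly_ring E\<^esub> ?f" using binomial_irreducible[OF disj e0 kE] .
  moreover have "\<not> poly_supp g \<subset> poly_supp ?f"
    if g: "g \<in> toric_ideal edge_vec E" "is_binomial g" for g :: "('v set, 'k) mpoly"
  proof
    assume sub: "poly_supp g \<subset> poly_supp ?f"
    obtain u v where uv: "u \<noteq> v" "g = monomial u - monomial v" using g(2) unfolding is_binomial_def by blast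
    have deg: "vdeg u = vdeg v" using g(1) binomial_in_toric_iff[OF uv(1)] unfolding uv(2) by blast
    have sub': "keys u \<union> keys v \<subset> keys u0 \<union> keys v0"
      using sub unfolding uv(2) poly_supp_binomial[OF uv(1)] poly_supp_binomial[OF ne] .
    define c where "c = int (lookup u e0) - int (lookup v e0)"
    have *: "int (lookup u e) - int (lookup v e) = c * (int (lookup u0 e) - int (lookup v0 e))" for e
      unfolding c_def by (rule rigid_multiple[OF rigid deg0 e0 e0v _ _ deg]) (use sub' in auto)
    have "c \<noteq> 0"
    proof
      assume "c = 0"
      then have "u = v" using * by (intro poly_mapping_eqI) simp
      then show False using uv(1) by simp
    qed
    have "e \<in> keys u \<union> keys v" if "e \<in> keys u0 \<union> keys v0" for e
    proof -
      have "lookup u0 e \<noteq> lookup v0 e"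
        using that disj by (metis UnE disjoint_iff in_keys_iff)
      then have "int (lookup u e) - int (lookup v e) \<noteq> 0" unfolding * using \<open>c \<noteq> 0\<close> by simp
      then show ?thesis by (auto simp: in_keys_iff)
    qed
    then show False using sub' by blast
  qed
  ultimately show ?thesis unfolding circuits_def by blast
qed

text \<open>\<open>u\<close> and \<open>v\<close> differ by a multiple of \<open>u0 - v0\<close>.
  The multiplier is read off at \<open>e0\<close> and is the number of moves needed.\<close>

lemma rigid_conn:
  assumes rigid: "rigid (keys u0 \<union> keys v0) e0" and deg0: "vdeg u0 = vdeg v0"
    and disj: "keys u0 \<inter> keys v0 = {}" and e0: "lookup u0 e0 = 1"
    and k: "keys u \<subseteq> keys u0 \<union> keys v0" "keys v \<subseteq> keys u0 \<union> keys v0" and deg: "vdeg u = vdeg v"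
  shows "conn {(u0, v0)} u v"
proof -
  have e0v: "lookup v0 e0 = 0" using disj e0 by (metis disjoint_iff in_keys_iff one_neq_zero)
  have main: "conn {(u0, v0)} u v"
    if "keys u \<subseteq> keys u0 \<union> keys v0" "keys v \<subseteq> keys u0 \<union> keys v0" "vdeg u = vdeg v"
      "lookup u e0 = lookup v e0 + n" for u v n
    using that
  proof (induction n arbitrary: u)
    case 0
    have "u = v"
      using rigid_multiple[OF rigid deg0 e0 e0v 0(1-3)] 0(4) by (intro poly_mapping_eqI) simp
    then show ?case by (simp add: conn.refl)
  next
    case (Suc n)
    define w where "w = u - u0"
    \<comment> \<open>The move applies because \<open>u0\<close> divides \<open>u\<close>: where
      \<open>u0\<close> is positive, \<open>v0\<close> vanishes, and \<open>u\<close> exceeds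
      \<open>v\<close> by a positive multiple of \<open>u0\<close>.\<close>
    have "lookup u0 e \<le> lookup u e" for e
    proof (cases "lookup u0 e = 0")
      case False
      then have "lookup v0 e = 0" using disj by (metis disjoint_iff in_keys_iff)
      then have "int (lookup u e) - int (lookup v e) = int (Suc n) * int (lookup u0 e)"
        using rigid_multiple[OF rigid deg0 e0 e0v Suc.prems(1-3), of e] Suc.prems(4) by simp
      moreover have "int (Suc n) * int (lookup u0 e) \<ge> 1 * int (lookup u0 e)"
        by (intro mult_right_mono) auto
      ultimately show ?thesis by linarith
    qed simp
    then have u: "u = w + u0" by (intro poly_mapping_eqI) (simp add: w_def lookup_add lookup_minus)
    have "conn {(u0, v0)} (w + v0) v"
    proof (rule Suc.IH)
      show "keys (w + v0) \<subseteq> keys u0 \<union> keys v0" using Suc.prems(1) by (auto simp: u keys_add_nat)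
      show "vdeg (w + v0) = vdeg v" using Suc.prems(3) deg0 by (simp add: u vdeg_add)
      show "lookup (w + v0) e0 = lookup v e0 + n" using Suc.prems(4) e0 e0v by (simp add: u lookup_add)
    qed (use Suc.prems in auto)
    moreover have "conn {(u0, v0)} u (w + v0)" unfolding u by (rule conn_move) simp
    ultimately show ?case using conn_trans by blast
  qed
  show ?thesis
  proof (cases "lookup v e0 \<le> lookup u e0")
    case True
    then show ?thesis using main[OF k deg, of "lookup u e0 - lookup v e0"] by simp
  next
    case False
    then show ?thesis
      using main[OF k(2,1) deg[symmetric], of "lookup v e0 - lookup u e0"] conn_sym by force
  qed
qed

text \<open>Each inner vertex has exactly two edges in \<open>D\<close>, and the equation there
  makes their values opposite. For \<open>x = y\<close> with a single inner vertex the two edges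
  would coincide, hence the condition on \<open>length p\<close>.\<close>

lemma alternating_on_segment:
  assumes D: "D \<subseteq> E" "\<forall>e. e \<notin> D \<longrightarrow> z e = 0" and z: "\<forall>x. vsum z x = 0"
    and ys: "distinct (x # p)" "distinct (p @ [y])" "x \<noteq> y \<or> length p \<noteq> 1"
    and at: "\<forall>w\<in>set p. {e\<in>D. w \<in> e} = {e\<in>path_edges (x # p @ [y]). w \<in> e}"
    and i: "Suc i < length (x # p @ [y])"
  shows "z {(x # p @ [y]) ! i, (x # p @ [y]) ! Suc i} = (-1) ^ i * z {(x # p @ [y]) ! 0, (x # p @ [y]) ! 1}"
  using i
proof (induction i)
  case (Suc i)
  let ?ys = "x # p @ [y]"
  define w where "w = ?ys ! Suc i"
  have wp: "w = p ! i" "i < length p" using Suc.prems by (auto simp: w_def nth_append)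
  have w: "w \<in> set p" using wp by simp
  have split: "?ys = (x # take i p) @ w # (drop (Suc i) p @ [y])"
    using id_take_nth_drop[OF wp(2)] wp(1) by simp
  have dp: "distinct p" using ys(1) by simp
  have nl: "w \<notin> set (x # take i p)" "w \<notin> set (drop (Suc i) p @ [y])"
    using ys(1,2) w dp id_take_nth_drop[OF wp(2)] wp(1)
    by (metis distinct.simps(2) distinct_append disjoint_iff list.set_intros(1) set_ConsD in_set_takeD
        not_distinct_conv_prefix)
      (use ys(1,2) w dp id_take_nth_drop[OF wp(2)] wp(1) in
        \<open>metis distinct.simps(2) distinct_append disjoint_iff list.set_intros(1) Un_iff set_append set_ConsD\<close>)
  have last: "last (x # take i p) = ?ys ! i"
    using wp(2) by (cases i) (auto simp: nth_append take_Suc_conv_app_nth)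
  have hd: "hd (drop (Suc i) p @ [y]) = ?ys ! Suc (Suc i)"
    using wp(2) by (cases "Suc i < length p") (auto simp: nth_append hd_append hd_drop_conv_nth)
  have "{e\<in>path_edges ?ys. w \<in> e} =
      {{last (x # take i p), w}, {w, hd (drop (Suc i) p @ [y])}}"
    by (subst split) (rule path_edges_at[OF nl], simp_all)
  then have "{e\<in>D. w \<in> e} = {{?ys ! i, w}, {w, ?ys ! Suc (Suc i)}}"
    unfolding bspec[OF at w] last hd .
  moreover have "?ys ! i \<noteq> ?ys ! Suc (Suc i)"
  proof (cases "Suc (Suc i) < length (x # p)")
    case True
    then have "?ys ! i = (x # p) ! i" "?ys ! Suc (Suc i) = (x # p) ! Suc (Suc i)"
      by (auto simp: nth_append nth_Cons')
    then show ?thesis using nth_eq_iff_index_eq[OF ys(1), of i "Suc (Suc i)"] True by simp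
  next
    case False
    then have len: "length p = Suc i" using wp(2) by simp
    show ?thesis
    proof (cases i)
      case 0
      then show ?thesis using len ys(3) by (simp add: nth_append)
    next
      case (Suc j)
      then have "?ys ! i = (p @ [y]) ! j" "?ys ! Suc (Suc i) = (p @ [y]) ! Suc i" by auto
      then show ?thesis using nth_eq_iff_index_eq[OF ys(2), of j "Suc i"] len Suc by simp
    qed
  qed
  ultimately have two: "{e\<in>D. w \<in> e} = {{?ys ! i, w}, {w, ?ys ! Suc (Suc i)}}"
    "{?ys ! i, w} \<noteq> {w, ?ys ! Suc (Suc i)}"
    by (auto simp: doubleton_eq_iff)
  have "vsum z w = (\<Sum>e\<in>{e\<in>D. w \<in> e}. z e)"
    by (rule vsum_restrict[OF D(1)]) (use D in auto)
  also have "\<dots> = z {?ys ! i, w} + z {w, ?ys ! Suc (Suc i)}"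
    unfolding two(1) using two(2) by simp
  finally have "z {w, ?ys ! Suc (Suc i)} = - z {?ys ! i, w}" using spec[OF z, of w] by simp
  then show ?case using Suc.IH Suc.prems unfolding w_def by simp
qed simp

lemma zero_on_segment:
  assumes "D \<subseteq> E" "\<forall>e. e \<notin> D \<longrightarrow> z e = 0" "\<forall>x. vsum z x = 0"
    and "distinct (x # p)" "distinct (p @ [y])" "x \<noteq> y \<or> length p \<noteq> 1"
    and "\<forall>w\<in>set p. {e\<in>D. w \<in> e} = {e\<in>path_edges (x # p @ [y]). w \<in> e}"
    and "z {x, hd (p @ [y])} = 0" and "e \<in> path_edges (x # p @ [y])"
  shows "z e = 0"
proof -
  obtain i where i: "Suc i < length (x # p @ [y])" "e = {(x # p @ [y]) ! i, (x # p @ [y]) ! Suc i}"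
    using assms(9) unfolding path_edges_def by blast
  have "(x # p @ [y]) ! 1 = hd (p @ [y])" by (simp add: hd_conv_nth)
  then show ?thesis
    using alternating_on_segment[OF assms(1-7) i(1)] assms(8) i(2) by simp
qed

lemma even_cycle_rigid:
  assumes c: "distinct (x # p)" "odd (length p)" "length p \<noteq> 1" "path_edges (x # p @ [x]) \<subseteq> E"
  shows "rigid (path_edges (x # p @ [x])) {x, hd p}"
  unfolding rigid_def
proof (intro conjI allI impI)
  fix z :: "'v set \<Rightarrow> int" and e
  assume z: "\<forall>e. e \<notin> path_edges (x # p @ [x]) \<longrightarrow> z e = 0" "\<forall>x. vsum z x = 0" "z {x, hd p} = 0"
  have "p \<noteq> []" using c by auto
  then have hd: "z {x, hd (p @ [x])} = 0" using z by simp
  show "z e = 0"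
  proof (cases "e \<in> path_edges (x # p @ [x])")
    case True
    show ?thesis
      by (rule zero_on_segment[OF c(4) z(1,2) c(1) _ _ _ hd True]) (use c in auto)
  qed (use z in simp)
qed (rule c)

text \<open>A closed walk of length two runs along one edge and back, so its two monomials coincide;
  a longer one without repeated vertices passes no edge twice.\<close>

lemma even_cycle_sfsf:
  assumes c: "distinct xs" "closed_walk E xs" "length xs \<noteq> 2"
  shows "(monomial (pairs xs) - monomial (pairs (rotate1 xs)) :: ('v set, 'k::field) mpoly) \<in> sfsf_circuits edge_vec E"
proof -
  obtain x p where xs: "xs = x # p" using c by (cases xs) (auto simp: closed_walk_def)
  have p: "distinct (x # p)" "odd (length p)" "length p \<noteq> 1" and pE: "path_edges (x # p @ [x]) \<subseteq> E"
    using c by (auto simp: xs closed_walk_def)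
  define u v where "u = pairs xs" and "v = pairs (rotate1 xs)"
  have u: "u = pairs (x # p @ [x])" using p(2) pairs_snoc[of "x # p" x] by (simp add: u_def xs)
  have v: "v = pairs (tl (x # p @ [x]))" by (simp add: v_def xs)
  have D: "keys u \<union> keys v = path_edges (x # p @ [x])"
    using path_edges_eq_keys[of "x # p @ [x]"] u v by simp
  have one: "lookup u e + lookup v e \<le> 1" for e
    using lookup_pairs_add[of "x # p @ [x]" e] distinct_edge_list_loop[OF p(1,3)]
    unfolding u v by (simp add: count_list_distinct)
  have "keys u \<inter> keys v = {}"
  proof -
    have "\<not> (e \<in> keys u \<and> e \<in> keys v)" for e using one[of e] by (auto simp: in_keys_iff)
    then show ?thesis by blast
  qed
  moreover have "lookup u {x, hd p} = 1"
  proof -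
    have "p \<noteq> []" using p by auto
    then have "lookup u {x, hd p} \<ge> 1" by (cases p) (auto simp: u lookup_add lookup_single)
    then show ?thesis using one[of "{x, hd p}"] by simp
  qed
  moreover have "vdeg u = vdeg v" using closed_walk_pairs[OF c(2)] by (simp add: u_def v_def)
  ultimately have "(monomial u - monomial v :: ('v set, 'k) mpoly) \<in> circuits edge_vec E"
    using rigid_circuit[of u v "{x, hd p}"] even_cycle_rigid[OF p pE] D by simp
  moreover have "squarefree_exponent u" "squarefree_exponent v"
    using one unfolding squarefree_exponent_def by (meson le_add1 le_add2 le_trans)+
  ultimately show ?thesis unfolding sfsf_circuits_def u_def v_def by blast
qed

end

text \<open>The cycles are \<open>hd P # p1\<close> and \<open>last P # p2\<close>.  If \<open>P\<close> is a single vertex, they share it; this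
  is the squarefree case.\<close>

locale joined_cycles = fin_graph E for E :: "'v set set" +
  fixes p1 P p2 :: "'v list"
  assumes p1: "even (length p1)" "p1 \<noteq> []" "distinct p1"
    and p2: "even (length p2)" "p2 \<noteq> []" "distinct p2"
    and P: "P \<noteq> []" "distinct P"
    and disjoint: "set p1 \<inter> set P = {}" "set p2 \<inter> set P = {}" "set p1 \<inter> set p2 = {}"
    and edges: "path_edges (hd P # p1 @ [hd P]) \<subseteq> E" "path_edges P \<subseteq> E"
      "path_edges (last P # p2 @ [last P]) \<subseteq> E"
begin

text \<open>Around the first cycle, out along \<open>P\<close>, around the second cycle and back
  along \<open>P\<close>; if \<open>P\<close> is a single vertex, this is a figure eight.\<close>

definition walk where "walk = (hd P # p1) @ P @ p2 @ rev (tl P)"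

abbreviation "D1 \<equiv> path_edges (hd P # p1 @ [hd P])"
abbreviation "D2 \<equiv> path_edges (last P # p2 @ [last P])"

lemma P_split: "P = hd P # tl P" "P = butlast P @ [last P]"
  using P by simp_all

lemma path_edges_walk: "path_edges (walk @ [hd walk]) = D1 \<union> path_edges P \<union> D2"
proof -
  have "walk @ [hd walk] = (hd P # p1) @ P @ p2 @ rev P"
    unfolding walk_def using P_split(1) by (metis append.assoc append_Cons list.sel(1) rev.simps(2))
  also have "\<dots> = (hd P # p1) @ hd P # (tl P @ p2 @ rev P)"
    using P_split(1) by (metis append_Cons)
  finally have "path_edges (walk @ [hd walk]) = D1 \<union> path_edges (P @ p2 @ rev P)"
    using path_edges_append[of "hd P # p1" "hd P" "tl P @ p2 @ rev P"] P_split(1)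
    by (metis append_Cons)
  also have "P @ p2 @ rev P = butlast P @ last P # (p2 @ last P # rev (butlast P))"
    using P_split(2) by (metis append.assoc append_Cons append_Nil rev_append rev_singleton_conv)
  also have "path_edges \<dots> = path_edges P \<union> path_edges ((last P # p2) @ last P # rev (butlast P))"
    using path_edges_append[of "butlast P" "last P"] P_split(2) by simp
  also have "path_edges ((last P # p2) @ last P # rev (butlast P)) = D2 \<union> path_edges (rev P)"
    using path_edges_append[of "last P # p2" "last P" "rev (butlast P)"] P_split(2)
    by (metis append_Cons rev_append rev_singleton_conv append_Nil)
  finally show ?thesis by auto
qed

lemma closed: "closed_walk E walk"
  unfolding closed_walk_def using path_edges_walk edges p1 p2 P by (auto simp: walk_def)

text \<open>Cycle edges fall alternately into the two monomials. Both passages of an edge of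
  \<open>P\<close> fall into the same monomial, so it comes squared. The parity of \<open>P\<close>
  only decides which half of the second cycle joins which monomial.\<close>

lemma pairs_walk:
  "pairs walk = pairs (hd P # p1 @ [hd P]) + (pairs (tl P) + pairs (tl P)) +
    (if even (length P) then pairs (last P # p2 @ [last P]) else pairs p2)"
  "pairs (rotate1 walk) = pairs p1 + (pairs P + pairs P) +
    (if even (length P) then pairs p2 else pairs (last P # p2 @ [last P]))"
proof -
  have "walk = (hd P # p1 @ [hd P]) @ (tl P @ p2 @ rev (tl P))"
    unfolding walk_def using P_split(1) by (metis append.assoc append_Cons append_Nil)
  then have "pairs walk = pairs (hd P # p1 @ [hd P]) + pairs (tl P @ p2 @ rev (tl P))"
    using pairs_append[of "hd P # p1 @ [hd P]" "tl P @ p2 @ rev (tl P)"] p1(1) by simp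
  moreover have "tl P \<noteq> [] \<Longrightarrow> last (tl P) = last P" by (simp add: last_tl)
  moreover have "even (length (tl P)) \<longleftrightarrow> odd (length P)" "odd (length (tl P)) \<Longrightarrow> tl P \<noteq> []"
    using P(1) by (cases P; auto)+
  ultimately show "pairs walk = pairs (hd P # p1 @ [hd P]) + (pairs (tl P) + pairs (tl P)) +
    (if even (length P) then pairs (last P # p2 @ [last P]) else pairs p2)"
    using pairs_out_back[OF p2(1), of "tl P"] by (auto simp: add_ac)
  have "rotate1 walk = p1 @ P @ p2 @ rev P"
    unfolding walk_def using P_split(1) by (metis append.assoc append_Cons rotate1.simps(2) rev.simps(2))
  then have "pairs (rotate1 walk) = pairs p1 + pairs (P @ p2 @ rev P)"
    using p1(1) by (simp add: pairs_append)
  then show "pairs (rotate1 walk) = pairs p1 + (pairs P + pairs P) +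
    (if even (length P) then pairs p2 else pairs (last P # p2 @ [last P]))"
    using pairs_out_back[OF p2(1), of P] by (auto simp: add_ac)
qed

lemma edges_disjoint: "D1 \<inter> path_edges P = {}" "D2 \<inter> path_edges P = {}" "D1 \<inter> D2 = {}"
proof -
  have ends: "hd P \<in> set P" "last P \<in> set P" using P by auto
  have D2: "set (last P # p2 @ [last P]) \<inter> set p1 = {}" using disjoint ends by auto
  show "D1 \<inter> path_edges P = {}"
    using path_edges_loop_meets[OF p1(2)] disjoint(1) path_edges_subset_set[of _ P] by blast
  show "D2 \<inter> path_edges P = {}"
    using path_edges_loop_meets[OF p2(2)] disjoint(2) path_edges_subset_set[of _ P] by blast
  show "D1 \<inter> D2 = {}"
    using path_edges_loop_meets[OF p1(2)] D2 path_edges_subset_set[of _ "last P # p2 @ [last P]"] by blast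
qed

lemma loops: "distinct (hd P # p1)" "distinct (last P # p2)" "length p1 \<noteq> 1" "length p2 \<noteq> 1"
  using p1 p2 P disjoint by auto

lemma lookups:
  "lookup (pairs (hd P # p1 @ [hd P])) e + lookup (pairs p1) e = (if e \<in> D1 then 1 else 0)"
  "lookup (pairs P) e + lookup (pairs (tl P)) e = (if e \<in> path_edges P then 1 else 0)"
  "lookup (pairs (last P # p2 @ [last P])) e + lookup (pairs p2) e = (if e \<in> D2 then 1 else 0)"
  using lookup_pairs_add[of "hd P # p1 @ [hd P]" e] lookup_pairs_add[of P e]
    lookup_pairs_add[of "last P # p2 @ [last P]" e]
    distinct_edge_list_loop[OF loops(1,3)] distinct_edge_list_loop[OF loops(2,4)]
    distinct_edge_list_path[OF P(2)] p1(1) p2(1)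
  by (simp_all add: count_list_distinct set_edge_list)

lemma lookup_walk:
  "e \<in> D1 \<union> D2 \<Longrightarrow> lookup (pairs walk) e + lookup (pairs (rotate1 walk)) e = 1"
  "e \<in> path_edges P \<Longrightarrow> lookup (pairs walk) e = 0 \<and> lookup (pairs (rotate1 walk)) e = 2 \<or>
    lookup (pairs walk) e = 2 \<and> lookup (pairs (rotate1 walk)) e = 0"
  "e \<notin> D1 \<union> path_edges P \<union> D2 \<Longrightarrow> lookup (pairs walk) e + lookup (pairs (rotate1 walk)) e = 0"
proof -
  show "e \<in> path_edges P \<Longrightarrow> lookup (pairs walk) e = 0 \<and> lookup (pairs (rotate1 walk)) e = 2 \<or>
    lookup (pairs walk) e = 2 \<and> lookup (pairs (rotate1 walk)) e = 0"
  proof -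
    assume e: "e \<in> path_edges P"
    then have e': "e \<notin> D1" "e \<notin> D2" using edges_disjoint by auto
    have "lookup (pairs P) e = 0 \<and> lookup (pairs (tl P)) e = 1 \<or>
        lookup (pairs P) e = 1 \<and> lookup (pairs (tl P)) e = 0"
      using lookups(2)[of e] e by simp linarith
    then show ?thesis
      unfolding pairs_walk using lookups(1,3)[of e] e' by (auto simp: lookup_add)
  qed
qed (unfold pairs_walk, use lookups[of e] edges_disjoint in \<open>auto simp: lookup_add split: if_splits\<close>)

lemma keys_walk: "keys (pairs walk) \<union> keys (pairs (rotate1 walk)) = D1 \<union> path_edges P \<union> D2"
proof (rule Set.set_eqI)
  fix e
  show "e \<in> keys (pairs walk) \<union> keys (pairs (rotate1 walk)) \<longleftrightarrow> e \<in> D1 \<union> path_edges P \<union> D2"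
    using lookup_walk[of e] by (cases "e \<in> D1 \<union> D2"; cases "e \<in> path_edges P") (auto simp: in_keys_iff)
qed

lemma keys_walk_disjoint: "keys (pairs walk) \<inter> keys (pairs (rotate1 walk)) = {}"
proof -
  have "lookup (pairs walk) e = 0 \<or> lookup (pairs (rotate1 walk)) e = 0" for e
    using lookup_walk[of e] by (cases "e \<in> D1 \<union> D2"; cases "e \<in> path_edges P") auto
  then show ?thesis by (auto simp: in_keys_iff)
qed

lemma lookup_first_edge: "lookup (pairs walk) {hd P, hd p1} = 1"
proof -
  obtain b q where bq: "p1 = b # q" using p1(2) by (cases p1) auto
  have "lookup (pairs walk) {hd P, hd p1} \<ge> 1"
    unfolding pairs_walk by (simp add: bq lookup_add)
  moreover have "{hd P, hd p1} \<in> D1" by (simp add: bq)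
  ultimately show ?thesis using lookup_walk(1)[of "{hd P, hd p1}"] by simp
qed

text \<open>From the edge \<open>{hd P, hd p1}\<close> the zero spreads around the first cycle and
  then along the path. The second cycle is odd, so its first and last edges carry the same value,
  and the equation at \<open>last P\<close> says that twice this value is zero.\<close>

lemma walk_rigid: "rigid (D1 \<union> path_edges P \<union> D2) {hd P, hd p1}"
  unfolding rigid_def
proof (intro conjI allI impI)
  let ?D = "D1 \<union> path_edges P \<union> D2"
  show DE: "?D \<subseteq> E" using edges by blast
  fix z :: "'v set \<Rightarrow> int" and e
  assume off: "\<forall>e. e \<notin> ?D \<longrightarrow> z e = 0" and z: "\<forall>x. vsum z x = 0" and z0: "z {hd P, hd p1} = 0"
  have ends: "hd P \<in> set P" "last P \<in> set P" using P by auto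
  have sub: "\<And>e. e \<in> D1 \<Longrightarrow> e \<subseteq> insert (hd P) (set p1)" "\<And>e. e \<in> D2 \<Longrightarrow> e \<subseteq> insert (last P) (set p2)"
    "\<And>e. e \<in> path_edges P \<Longrightarrow> e \<subseteq> set P"
    using path_edges_subset_set by fastforce+
  have D1: "z e = 0" if "e \<in> D1" for e
  proof (rule zero_on_segment[OF DE off z loops(1) _ _ _ _ that])
    show "\<forall>w\<in>set p1. {e \<in> ?D. w \<in> e} = {e \<in> D1. w \<in> e}"
      using sub disjoint ends by blast
  qed (use loops p1 z0 in auto)
  have DP: "z e = 0" if eP: "e \<in> path_edges P" for e
  proof -
    obtain a q where q: "P = a # q" "q \<noteq> []" using eP P(1) by (cases P rule: edge_list.cases) auto
    define m b where "m = butlast q" and "b = last q"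
    have P': "P = a # m @ [b]" using q by (simp add: m_def b_def)
    have dist: "distinct (a # m)" "distinct (m @ [b])" "a \<noteq> b" using P(2) unfolding P' by auto
    have hl: "hd P = a" "last P = b" by (simp_all add: P')
    have PE: "path_edges P = insert {a, hd q} (path_edges q)" using path_edges_Cons[OF q(2)] q(1) by simp
    \<comment> \<open>All other edges at the first vertex of the path belong to the first cycle,
      where \<open>z\<close> is already known to vanish.\<close>
    have "vsum z a = (\<Sum>e\<in>{{a, hd q}}. z e)"
    proof (rule vsum_restrict[OF DE])
      fix e assume e: "e \<notin> {{a, hd q}}" "e \<in> ?D" "a \<in> e"
      have "a \<notin> set q" using P(2) q by simp
      then have "e \<notin> path_edges P" using e path_edges_subset_set[of e q] unfolding PE by auto
      moreover have "a \<in> set P" using q by simp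
      then have "e \<notin> D2" using e(3) sub(2)[of e] disjoint(2) dist(3) hl by auto
      ultimately show "z e = 0" using e(2) D1 by auto
    qed (use off PE edges(2) in auto)
    then have first: "z {a, hd (m @ [b])} = 0"
      using spec[OF z, of a] q P' by simp
    have "\<forall>w\<in>set m. {e \<in> ?D. w \<in> e} = {e \<in> path_edges (a # m @ [b]). w \<in> e}"
    proof
      fix w assume w: "w \<in> set m"
      have "w \<in> set P" "w \<noteq> hd P" "w \<noteq> last P" using w dist hl by (auto simp: P')
      then have "w \<notin> e" if "e \<in> D1 \<or> e \<in> D2" for e
        using that sub(1,2)[of e] disjoint by blast
      then show "{e \<in> ?D. w \<in> e} = {e \<in> path_edges (a # m @ [b]). w \<in> e}"
        unfolding P'[symmetric] by blast
    qed
    then show ?thesis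
      using zero_on_segment[OF DE off z dist(1,2) _ _ first] dist(3) eP unfolding P' by blast
  qed
  have seg2: "\<forall>w\<in>set p2. {e \<in> ?D. w \<in> e} = {e \<in> D2. w \<in> e}"
    using sub disjoint ends by blast
  have first: "z {last P, hd p2} = 0"
  proof -
    let ?ys = "last P # p2 @ [last P]"
    have "z {?ys ! length p2, ?ys ! Suc (length p2)} = (- 1) ^ length p2 * z {?ys ! 0, ?ys ! 1}"
      by (rule alternating_on_segment[OF DE off z loops(2) _ _ seg2]) (use loops in auto)
    moreover have "?ys ! length p2 = last p2" "?ys ! 1 = hd p2"
      using p2(2) by (auto simp: nth_append last_conv_nth hd_conv_nth nth_Cons')
    ultimately have eq: "z {last p2, last P} = z {last P, hd p2}" using p2(1) by (simp add: nth_append)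
    have D2: "D2 = insert {last P, hd p2} (insert {last p2, last P} (path_edges p2))"
      by (rule path_edges_loop[OF p2(2)])
    have "hd p2 \<noteq> last p2"
      using loops(2,4) p2(2) by (cases p2) (auto simp: last_in_set)
    then have ne: "{last P, hd p2} \<noteq> {last p2, last P}" using loops(2) p2(2) by (auto simp: doubleton_eq_iff)
    have "vsum z (last P) = (\<Sum>e\<in>{{last P, hd p2}, {last p2, last P}}. z e)"
    proof (rule vsum_restrict[OF DE])
      fix e assume "e \<notin> {{last P, hd p2}, {last p2, last P}}" "e \<in> ?D" "last P \<in> e"
      then show "z e = 0" using D1 DP D2 path_edges_subset_set[of e p2] loops(2) by auto
    qed (use off D2 edges(3) in auto)
    then have "2 * z {last P, hd p2} = 0" using spec[OF z, of "last P"] ne eq by simp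
    then show ?thesis by simp
  qed
  have D2: "z e = 0" if "e \<in> D2" for e
    by (rule zero_on_segment[OF DE off z loops(2) _ _ seg2 _ that]) (use loops p2 first in auto)
  show "z e = 0" using D1 DP D2 off by blast
qed

lemma walk_circuit:
  "(monomial (pairs walk) - monomial (pairs (rotate1 walk)) :: ('v set, 'k::field) mpoly) \<in> circuits edge_vec E"
  using rigid_circuit[of "pairs walk" "pairs (rotate1 walk)"] walk_rigid closed_walk_pairs[OF closed]
    keys_walk keys_walk_disjoint lookup_first_edge by simp

lemma walk_sfsf:
  assumes "length P = 1"
  shows "(monomial (pairs walk) - monomial (pairs (rotate1 walk)) :: ('v set, 'k::field) mpoly) \<in> sfsf_circuits edge_vec E"
proof -
  obtain a where "P = [a]" using assms by (auto simp: length_Suc_conv)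
  then have "path_edges P = {}" by simp
  then have "lookup (pairs walk) e + lookup (pairs (rotate1 walk)) e \<le> 1" for e
    using lookup_walk(1,3)[of e] by (cases "e \<in> D1 \<union> D2") auto
  then have "squarefree_exponent (pairs walk)" "squarefree_exponent (pairs (rotate1 walk))"
    unfolding squarefree_exponent_def by (meson le_add1 le_add2 le_trans)+
  then show ?thesis using walk_circuit unfolding sfsf_circuits_def by blast
qed

text \<open>An edge of the path has exponent two, and a binomial determines its two monomials up to
  order.\<close>

lemma walk_not_sfsf:
  assumes "length P \<ge> 2"
  shows "(monomial (pairs walk) - monomial (pairs (rotate1 walk)) :: ('v set, 'k::field) mpoly) \<notin> sfsf_circuits edge_vec E"
proof
  let ?f = "monomial (pairs walk) - monomial (pairs (rotate1 walk)) :: ('v set, 'k) mpoly"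
  assume "?f \<in> sfsf_circuits edge_vec E"
  then obtain u v where uv: "?f = monomial u - monomial v" "squarefree_exponent u" "squarefree_exponent v"
    unfolding sfsf_circuits_def by blast
  have ne: "pairs walk \<noteq> pairs (rotate1 walk)"
    using keys_walk_disjoint lookup_first_edge by (metis Int_absorb in_keys_iff empty_iff one_neq_zero)
  have "u \<noteq> v" using uv(1) monomial_diff_ne_zero[OF ne, where 'k = 'k] by auto
  then have eq: "{pairs walk, pairs (rotate1 walk)} = {u, v}"
    using uv(1) keys_binomial[OF ne, where 'k = 'k] keys_binomial[of u v, where 'k = 'k] by metis
  obtain a b q where "P = a # b # q" using assms by (cases P rule: edge_list.cases) auto
  then have "{a, b} \<in> path_edges P" by simp
  then have "lookup (pairs walk) {a, b} = 2 \<or> lookup (pairs (rotate1 walk)) {a, b} = 2"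
    using lookup_walk(2) by blast
  moreover have "lookup (pairs walk) {a, b} \<le> 1" "lookup (pairs (rotate1 walk)) {a, b} \<le> 1"
    using uv(2,3) eq unfolding squarefree_exponent_def by (auto simp: doubleton_eq_iff)
  ultimately show False by auto
qed

end

section \<open>Minimal systems of binomial generators\<close>

context fin_graph
begin

lemma binomial_generators_iff:
  fixes F :: "('v set, 'k::field) mpoly set"
  shows "binomial_generators edge_vec E F \<longleftrightarrow>
    F \<subseteq> toric_ideal edge_vec E \<and> (\<forall>f\<in>F. is_binomial f) \<and>
    (\<forall>u v. keys u \<subseteq> E \<longrightarrow> keys v \<subseteq> E \<longrightarrow> vdeg u = vdeg v \<longrightarrow> conn (moves F) u v)"
proof (cases "F \<subseteq> toric_ideal edge_vec E \<and> (\<forall>f\<in>F. is_binomial f)")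
  case True
  then have F: "F \<subseteq> toric_ideal edge_vec E" "\<forall>f\<in>F. is_binomial f" by auto
  have "(\<forall>u v. keys u \<subseteq> E \<longrightarrow> keys v \<subseteq> E \<longrightarrow> texp edge_vec u = texp edge_vec v \<longrightarrow> conn (moves F) u v) \<longleftrightarrow>
     (\<forall>u v. keys u \<subseteq> E \<longrightarrow> keys v \<subseteq> E \<longrightarrow> vdeg u = vdeg v \<longrightarrow> conn (moves F) u v)"
    using texp_eq_iff by metis
  then show ?thesis
    using F toric_ideal_eq_genideal_iff[OF F] unfolding binomial_generators_def by simp
next
  case False
  then show ?thesis unfolding binomial_generators_def by blast
qed

lemma moves_degree:
  assumes "F \<subseteq> (toric_ideal edge_vec E :: ('v set, 'k::field) mpoly set)" "(p, q) \<in> moves F \<union> (moves F)\<inverse>"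
  shows "keys p \<subseteq> E" "keys q \<subseteq> E" "vdeg p = vdeg q" "p \<noteq> q"
  using moves_toric[OF assms] texp_eq_iff[of p q] by auto

lemma conn_degree:
  assumes "F \<subseteq> (toric_ideal edge_vec E :: ('v set, 'k::field) mpoly set)" "conn (moves F) u v"
  shows "vdeg u = vdeg v"
  using assms(2)
proof (induction rule: conn.induct)
  case (step u w p q)
  then show ?case using moves_degree[OF assms(1) step.hyps(2)] by (simp add: vdeg_add)
qed simp

lemma finite_bounded_monomials: "finite {m. keys m \<subseteq> E \<and> size m \<le> n}"
proof (rule inj_on_finite)
  show "inj_on (\<lambda>m. restrict (lookup m) E) {m. keys m \<subseteq> E \<and> size m \<le> n}"
  proof (rule inj_onI, rule poly_mapping_eqI)
    fix u v e
    assume "u \<in> {m. keys m \<subseteq> E \<and> size m \<le> n}" "v \<in> {m. keys m \<subseteq> E \<and> size m \<le> n}"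
      and eq: "restrict (lookup u) E = restrict (lookup v) E"
    then have k: "keys u \<subseteq> E" "keys v \<subseteq> E" by auto
    show "lookup u e = lookup v e"
    proof (cases "e \<in> E")
      case True
      then show ?thesis using fun_cong[OF eq, of e] by simp
    next
      case False
      then have "e \<notin> keys u" "e \<notin> keys v" using k by auto
      then show ?thesis by (simp add: in_keys_iff)
    qed
  qed
  show "(\<lambda>m. restrict (lookup m) E) ` {m. keys m \<subseteq> E \<and> size m \<le> n} \<subseteq> (\<Pi>\<^sub>E e\<in>E. {..n})"
  proof (rule image_subsetI)
    fix m assume "m \<in> {m. keys m \<subseteq> E \<and> size m \<le> n}"
    then have "lookup m e \<le> n" if "e \<in> E" for e using lookup_le_size[OF that, of m] by simp
    then show "restrict (lookup m) E \<in> (\<Pi>\<^sub>E e\<in>E. {..n})" by simp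
  qed
  show "finite (\<Pi>\<^sub>E e\<in>E. {..n})" using fin by (intro finite_PiE) auto
qed

text \<open>Zorn's lemma applies because a binomial of given degree involves only the finitely many
  generators of at most that degree.\<close>

lemma ex_minimal_generators:
  fixes F0 :: "('v set, 'k::field) mpoly set"
  assumes F0: "binomial_generators edge_vec E F0"
  obtains F where "F \<subseteq> F0" "binomial_generators edge_vec E F"
    "\<forall>F'. F' \<subset> F \<longrightarrow> \<not> binomial_generators edge_vec E F'"
proof -
  let ?bg = "binomial_generators edge_vec E :: ('v set, 'k) mpoly set \<Rightarrow> bool"
  \<comment> \<open>Zorn's lemma is applied to the sets of removable generators; removing a maximal
    one leaves a minimal system.\<close>
  define A where "A = {G. G \<subseteq> F0 \<and> ?bg (F0 - G)}"
  have I: "F0 \<subseteq> toric_ideal edge_vec E" and bin: "\<forall>f\<in>F0. is_binomial f"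
    using F0 unfolding binomial_generators_iff by auto
  have "\<exists>M\<in>A. \<forall>X\<in>A. M \<subseteq> X \<longrightarrow> X = M"
  proof (rule subset_Zorn_nonempty)
    have "{} \<in> A" using F0 by (simp add: A_def)
    then show "A \<noteq> {}" by blast
  next
    fix C assume C: "C \<noteq> {}" "subset.chain A C"
    have CA: "C \<subseteq> A" using C(2) by (simp add: subset.chain_def)
    have "conn (moves (F0 - \<Union>C)) u v" if uv: "keys u \<subseteq> E" "keys v \<subseteq> E" "vdeg u = vdeg v" for u v
    proof -
      define Q where "Q = {m. keys m \<subseteq> E \<and> size m \<le> size u}"
      define D :: "('v set, 'k) mpoly set" where "D = (\<lambda>(p, q). monomial p - monomial q) ` (Q \<times> Q)"
      have "finite D" unfolding D_def Q_def using finite_bounded_monomials by blast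
      then have "finite (\<Union>C \<inter> D)" by simp
      then obtain G where G: "G \<in> C" "\<Union>C \<inter> D \<subseteq> G"
        using finite_subset_Union_chain[OF _ _ C] by blast
      have sub: "F0 - G \<subseteq> toric_ideal edge_vec E" using I by blast
      have "conn (moves (F0 - G)) u v"
        using G(1) CA uv unfolding A_def binomial_generators_iff by blast
      then show ?thesis
      proof (rule conn_subst)
        fix w p q
        assume pq: "(p, q) \<in> moves (F0 - G)" "conn (moves (F0 - G)) u (w + p)" "conn (moves (F0 - G)) u (w + q)"
        have "size u = size (w + p)" "size u = size (w + q)"
          using conn_degree[OF sub pq(2)] conn_degree[OF sub pq(3)] by (auto intro: vdeg_eq_imp_size_eq)
        then have "p \<in> Q" "q \<in> Q" using moves_degree[OF sub, of p q] pq(1) by (auto simp: Q_def size_add)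
        then have "monomial p - monomial q \<in> D" by (auto simp: D_def)
        then have "(p, q) \<in> moves (F0 - \<Union>C)" using pq(1) G(2) unfolding moves_def by blast
        then show "conn (moves (F0 - \<Union>C)) p q" using conn_move[of p q _ 0] by simp
      qed
    qed
    then have "?bg (F0 - \<Union>C)" unfolding binomial_generators_iff using I bin by blast
    then show "\<Union>C \<in> A" using CA by (auto simp: A_def)
  qed
  then obtain M where M: "M \<in> A" "\<And>X. X \<in> A \<Longrightarrow> M \<subseteq> X \<Longrightarrow> X = M" by blast
  show ?thesis
  proof (rule that[of "F0 - M"])
    show "\<forall>F'. F' \<subset> F0 - M \<longrightarrow> \<not> ?bg F'"
    proof (intro allI impI notI)
      fix F' assume F': "F' \<subset> F0 - M" "?bg F'"
      have "F0 - (F0 - F') = F'" using F' by blast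
      then have "F0 - F' \<in> A" using F'(2) by (simp add: A_def)
      then have "F0 - F' = M" using M(2)[of "F0 - F'"] F'(1) M(1) by (auto simp: A_def)
      then show False using F'(1) by blast
    qed
  qed (use M in \<open>auto simp: A_def\<close>)
qed

text \<open>Indispensability yields only \<open>f\<close> or \<open>- f\<close>. Therefore
  \<open>- f\<close> is left out of the set of all binomials beforehand, unless it equals
  \<open>f\<close> as in characteristic two, and a minimal system is chosen inside the rest.\<close>

lemma indispensable_not_redundant:
  fixes f :: "('v set, 'k::field) mpoly"
  assumes f: "f \<in> toric_ideal edge_vec E" "is_binomial f" and ind: "indispensable edge_vec E f"
  shows "\<not> redundant edge_vec E f"
proof -
  obtain a b where ab: "a \<noteq> b" "f = monomial a - monomial b" using f(2) unfolding is_binomial_def by blast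
  define F0 where "F0 = {g \<in> toric_ideal edge_vec E. is_binomial g \<and> (g = - f \<longrightarrow> g = f)}"
  have "conn (moves F0) u v" if uv: "keys u \<subseteq> E" "keys v \<subseteq> E" "vdeg u = vdeg v" for u v
  proof (cases "u = v")
    case False
    let ?g = "monomial u - monomial v :: ('v set, 'k) mpoly"
    have g: "?g \<in> toric_ideal edge_vec E" "- ?g \<in> toric_ideal edge_vec E"
      using binomial_in_toric_iff[OF False, where 'k = 'k] binomial_in_toric_iff[of v u, where 'k = 'k] False uv by auto
    have bin: "is_binomial ?g" "is_binomial (- ?g)"
      unfolding is_binomial_def using False minus_diff_eq[of "monomial u" "monomial v"] by metis+
    have "?g \<in> F0 \<or> - ?g \<in> F0"
    proof (cases "?g = - f")
      case True
      then have "- ?g = f" by simp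
      then show ?thesis using f by (simp add: F0_def)
    qed (use g bin in \<open>simp add: F0_def\<close>)
    then have "(u, v) \<in> moves F0 \<union> (moves F0)\<inverse>" using False by (auto simp: moves_def)
    then show ?thesis using conn_move[of u v _ 0] by simp
  qed (simp add: conn.refl)
  then have "binomial_generators edge_vec E F0" unfolding binomial_generators_iff by (auto simp: F0_def)
  then obtain F where F: "F \<subseteq> F0" "binomial_generators edge_vec E F"
    "\<forall>F'. F' \<subset> F \<longrightarrow> \<not> binomial_generators edge_vec E F'"
    using ex_minimal_generators by blast
  have "f \<in> F \<or> - f \<in> F" using ind F(2) unfolding indispensable_def by blast
  moreover have "- f = f" if "- f \<in> F" using that F(1) unfolding F0_def by blast
  ultimately have "f \<in> F" by metis
  then show ?thesis unfolding redundant_def using F by blast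
qed

section \<open>Fundamental binomials\<close>

lemma t_vars_eq:
  assumes "u \<noteq> v" "keys u \<subseteq> E" "keys v \<subseteq> E" "vdeg u = vdeg v"
  shows "t_vars edge_vec (monomial u - monomial v :: ('v set, 'k::field) mpoly) = {x. vdeg u x > 0}"
  using assms
  by (auto simp: t_vars_def keys_binomial toric_map_single_eq lookup_texp_edge_vec)

lemma edge_in_t_polys:
  assumes "e \<in> E"
  shows "(monomial (edge_vec e) :: ('v, 'k::field) laurent) \<in> t_polys T \<longleftrightarrow> e \<subseteq> T"
proof -
  have ev: "lookup (edge_vec e) x = (if x \<in> e then 1 else 0)" for x
  proof -
    have "finite e" using card2[OF assms] by (metis card.infinite zero_neq_numeral)
    then show ?thesis by (simp add: edge_vec_def lookup_sum lookup_single when_def)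
  qed
  have "keys (edge_vec e) = e" by (rule Set.set_eqI) (simp add: in_keys_iff ev)
  then show ?thesis by (simp add: t_polys_def ev)
qed

lemma sub_columns_eq:
  assumes "u \<noteq> v" "keys u \<subseteq> E" "keys v \<subseteq> E" "vdeg u = vdeg v"
  shows "sub_columns edge_vec E (monomial u - monomial v :: ('v set, 'k::field) mpoly) =
    {e\<in>E. \<forall>x\<in>e. vdeg u x > 0}"
  unfolding sub_columns_def t_vars_eq[OF assms]
proof (rule Collect_cong)
  show "e \<in> E \<and> (monomial (edge_vec e) :: ('v, 'k) laurent) \<in> t_polys {x. 0 < vdeg u x} \<longleftrightarrow>
      e \<in> E \<and> (\<forall>x\<in>e. 0 < vdeg u x)" for e
    using edge_in_t_polys[of e "{x. 0 < vdeg u x}", where 'k = 'k] by blast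
qed

text \<open>The last move that reaches \<open>u\<close> in a chain from \<open>v\<close> has degrees
  bounded by those of \<open>u\<close>, so it lives in the subring attached to \<open>f\<close>.
  There it is a consequence of \<open>f\<close> alone and has no larger degree than
  \<open>f\<close>, which leaves only \<open>f\<close> up to sign.\<close>

lemma fundamental_indispensable:
  fixes f :: "('v set, 'k::field) mpoly"
  assumes f: "f \<in> toric_ideal edge_vec E" "is_binomial f" and fund: "fundamental edge_vec E f"
  shows "indispensable edge_vec E f"
  unfolding indispensable_def
proof (intro allI impI)
  fix F :: "('v set, 'k) mpoly set"
  assume bg: "binomial_generators edge_vec E F"
  obtain u v where uv: "u \<noteq> v" "f = monomial u - monomial v" using f(2) unfolding is_binomial_def by blast
  have k: "keys u \<subseteq> E" "keys v \<subseteq> E" "vdeg u = vdeg v"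
    using f(1) binomial_in_toric_iff[OF uv(1), where 'k = 'k] unfolding uv(2) by auto
  define J where "J = {e\<in>E. \<forall>x\<in>e. vdeg u x > 0}"
  have small: "keys m \<subseteq> J" if "keys m \<subseteq> E" "\<And>x. vdeg m x \<le> vdeg u x" for m
  proof
    fix e assume e: "e \<in> keys m"
    then have eE: "e \<in> E" using \<open>keys m \<subseteq> E\<close> by blast
    have "vdeg m x > 0" if "x \<in> e" for x
      using lookup_le_vdeg[OF eE that, of m] e by (simp add: in_keys_iff)
    then show "e \<in> J" using eE less_le_trans[OF _ that(2)] by (simp add: J_def)
  qed
  have uJ: "keys u \<subseteq> J" "keys v \<subseteq> J" using small k by auto
  have JE: "J \<subseteq> E" by (auto simp: J_def)
  have fJ: "f \<in> carrier (poly_ring J)"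
    unfolding uv(2) using binomial_in_poly_ring[OF uv(1), where 'k = 'k] uJ by blast
  have idl: "toric_ideal edge_vec J = Idl\<^bsub>poly_ring J\<^esub> {f}"
    using fund sub_columns_eq[OF uv(1) k, where 'k = 'k] unfolding fundamental_def uv(2) J_def by simp
  have moves_f: "(p', q') \<in> moves {f} \<union> (moves {f})\<inverse> \<Longrightarrow> p' \<in> {u, v} \<and> q' \<in> {u, v}" for p' q'
    using keys_binomial[OF uv(1), where 'k = 'k] keys_binomial[of p' q', where 'k = 'k]
      keys_binomial[of q' p', where 'k = 'k] unfolding moves_def uv(2) by auto
  have "F \<subseteq> toric_ideal edge_vec E" using bg unfolding binomial_generators_def by blast
  note deg = moves_degree[OF this]
  have gen: "conn (moves F) u v" if "keys u \<subseteq> E" "keys v \<subseteq> E" "vdeg u = vdeg v" for u v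
    using bg that unfolding binomial_generators_iff by blast
  have "conn (moves F) v u" by (rule gen[OF k(2,1) k(3)[symmetric]])
  then obtain w p q where pq: "u = w + q" "(p, q) \<in> moves F \<union> (moves F)\<inverse>"
      "p \<noteq> q" "conn (moves F) v (w + p)"
    by (rule conn_last_step[OF _ uv(1)[symmetric]])
  have d: "keys p \<subseteq> E" "keys q \<subseteq> E" "vdeg p = vdeg q" "p \<noteq> q" using deg[OF pq(2)] by auto
  have "vdeg q x \<le> vdeg u x" for x by (simp add: pq(1) vdeg_add)
  then have pqJ: "keys p \<subseteq> J" "keys q \<subseteq> J" using small d by auto
  have "(monomial p - monomial q :: ('v set, 'k) mpoly) \<in> toric_ideal edge_vec J"
    using binomial_in_toric_ideal_iff[OF d(4), where 'k = 'k] pqJ texp_eq_iff d by blast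
  then have "conn (moves {f}) p q"
    unfolding idl using binomial_in_genideal_iff[of "{f}" J p q] fJ f(2) pqJ by simp
  have sizes: "size v = size u" "size p = size q" "size q \<le> size u"
    using vdeg_eq_imp_size_eq[OF k(3)] vdeg_eq_imp_size_eq[OF d(3)] size_add[of w q] pq(1)
    by simp_all
  \<comment> \<open>A move by \<open>f\<close> that arrives at \<open>b\<close> uses up the whole
    degree of \<open>b\<close>, so its multiplier \<open>w'\<close> is trivial.\<close>
  have in_uv: "b \<in> {u, v}" if c: "conn (moves {f}) a b" "a \<noteq> b" "size b \<le> size u" "keys b \<subseteq> E" for a b
  proof -
    obtain w' p' q' where *: "b = w' + q'" "(p', q') \<in> moves {f} \<union> (moves {f})\<inverse>"
      "p' \<noteq> q'" "conn (moves {f}) a (w' + p')"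
      by (rule conn_last_step[OF c(1,2)])
    then have q': "q' \<in> {u, v}" using moves_f by blast
    then have "size w' = 0" using c(3) sizes by (auto simp: *(1) size_add)
    moreover have "keys w' \<subseteq> E" using c(4) by (simp add: *(1) keys_add_nat)
    ultimately have "w' = 0" using size_eq_0 by blast
    then show ?thesis using q' *(1) by simp
  qed
  have q: "q \<in> {u, v}" using in_uv[OF \<open>conn (moves {f}) p q\<close>] d sizes by simp
  have p: "p \<in> {u, v}" using in_uv[OF conn_sym[OF \<open>conn (moves {f}) p q\<close>]] d sizes by simp
  show "f \<in> F \<or> - f \<in> F"
    using p q d(4) pq(2) unfolding moves_def uv(2) by auto
qed

end

section \<open>Walks without splitting\<close>

text \<open>This is used for the closed trails on the support of a circuit and for the walks whose two
  monomials are not connected by moves of smaller degree.\<close>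

locale walk_class =
  fixes W :: "'v list \<Rightarrow> bool"
  assumes rotate: "W (xs @ ys) \<Longrightarrow> W (ys @ xs)"
    and reverse: "W (a # p @ a # q) \<Longrightarrow> even (length p) \<Longrightarrow> W (a # rev p @ a # q)"
    and even_length: "W xs \<Longrightarrow> even (length xs)"
    and even_part: "W (a # p @ a # q) \<Longrightarrow> even (length p)"
begin

lemma even_part': "W (a # p @ a # q) \<Longrightarrow> even (length q)"
  using even_part even_length by fastforce

text \<open>The parity conditions at \<open>a\<close>, at \<open>z\<close>, and at \<open>z\<close>
  after reversing the part between the visits to \<open>a\<close> say that each sum of two of
  \<open>length s1\<close>, \<open>length s2\<close>, \<open>length t1\<close> is odd. But these
  three sums add up to an even number.\<close>

lemma no_crossing: "\<not> W (a # s1 @ z # s2 @ a # t1 @ z # t2)"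
proof
  assume W: "W (a # s1 @ z # s2 @ a # t1 @ z # t2)"
  have 1: "even (length (s1 @ z # s2))" using even_part[of a "s1 @ z # s2" "t1 @ z # t2"] W by simp
  have 2: "even (length (s2 @ a # t1))"
    using even_part[of z "s2 @ a # t1" "t2 @ a # s1"] rotate[of "a # s1"] W by fastforce
  have "W (a # (rev s2 @ z # rev s1) @ a # (t1 @ z # t2))"
    using reverse[of a "s1 @ z # s2" "t1 @ z # t2"] W 1 by simp
  then have 3: "even (length (rev s1 @ a # t1))"
    using even_part[of z "rev s1 @ a # t1" "t2 @ a # rev s2"] rotate[of "a # rev s2"] by fastforce
  show False using 1 2 3 by auto
qed

end

lemma edge_list_rev: "edge_list (rev xs) = rev (edge_list xs)"
proof (induction xs rule: edge_list.induct)
  case (1 a b xs)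
  then show ?case using edge_list_append[of "rev xs" b "[a]"] by (simp add: insert_commute)
qed auto

lemma distinct_if_count_list_le_1: "(\<And>y. count_list ys y \<le> 1) \<Longrightarrow> distinct ys"
proof (induction ys)
  case (Cons x ys)
  have "count_list ys y \<le> 1" for y using Cons.prems[of y] by (auto split: if_splits)
  moreover have "x \<notin> set ys" using Cons.prems[of x] by (simp add: count_list_0_iff)
  ultimately show ?case using Cons.IH by simp
qed simp

lemma count_list_ge_2_split:
  assumes "count_list ys j \<ge> 2"
  obtains a b c where "ys = a @ j # b @ j # c"
proof -
  have "j \<in> set ys" using assms count_list_0_iff[of ys j] by fastforce
  then obtain a r where r: "ys = a @ j # r" "j \<notin> set a" by (metis split_list_first)
  then have "count_list r j \<ge> 1" using assms by (simp add: count_list_0_iff)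
  then have "j \<in> set r" using count_list_0_iff[of r j] by fastforce
  then show ?thesis using that r(1) by (metis split_list)
qed

section \<open>Squarefree circuits\<close>

text \<open>For \<open>D\<close> the support of a circuit, the assumption is the minimality of this
  support, freed from the polynomial ring.\<close>

locale circuit_support = fin_graph E for E :: "'v set set" +
  fixes D :: "'v set set"
  assumes minimal: "u \<noteq> v \<Longrightarrow> keys u \<subseteq> E \<Longrightarrow> keys v \<subseteq> E \<Longrightarrow> vdeg u = vdeg v \<Longrightarrow> \<not> keys u \<union> keys v \<subset> D"
begin

definition trail where
  "trail xs \<longleftrightarrow> closed_walk E xs \<and> distinct (edge_list (xs @ [hd xs])) \<and> path_edges (xs @ [hd xs]) = D"

text \<open>An edge passed once has odd total exponent, so the two monomials of the walk differ and
  minimality applies to them.\<close>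

lemma no_smaller_walk:
  assumes ys: "closed_walk E ys" and once: "count_list (edge_list (ys @ [hd ys])) e = 1"
  shows "\<not> path_edges (ys @ [hd ys]) \<subset> D"
proof -
  obtain a p where a: "ys = a # p" using ys by (cases ys) (auto simp: closed_walk_def)
  have ev: "even (length ys)" using ys by (simp add: closed_walk_def)
  have 1: "pairs (ys @ [hd ys]) = pairs ys" using ev by simp
  have 2: "tl (ys @ [hd ys]) = rotate1 ys" by (simp add: a)
  have "lookup (pairs ys) e + lookup (pairs (rotate1 ys)) e = 1"
    using lookup_pairs_add[of "ys @ [hd ys]" e] once 1 2 by simp
  then have "pairs ys \<noteq> pairs (rotate1 ys)" by (metis add_self_div_2 div_eq_0_iff less_2_cases_iff odd_add odd_one)
  then show ?thesis
    using minimal[of "pairs ys" "pairs (rotate1 ys)"] closed_walk_pairs[OF ys]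
      path_edges_eq_keys[of "ys @ [hd ys]"] 1 2 by simp
qed

lemma edge_list_closed: "edge_list (a # s @ b # t @ [a]) = edge_list (a # s @ [b]) @ edge_list (b # t @ [a])"
  using edge_list_append[of "a # s" b "t @ [a]"] by simp

sublocale walk_class trail
proof
  show "trail (ys @ xs)" if t: "trail (xs @ ys)" for xs ys
  proof (cases "xs = [] \<or> ys = []")
    case False
    then obtain a s b r where *: "xs = a # s" "ys = b # r" by (metis list.exhaust)
    have "mset (edge_list ((ys @ xs) @ [hd (ys @ xs)])) = mset (edge_list ((xs @ ys) @ [hd (xs @ ys)]))"
      using edge_list_closed[of a s b r] edge_list_closed[of b r a s] by (simp add: *)
    then have eq: "distinct (edge_list ((ys @ xs) @ [hd (ys @ xs)])) = distinct (edge_list ((xs @ ys) @ [hd (xs @ ys)]))"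
      "path_edges ((ys @ xs) @ [hd (ys @ xs)]) = path_edges ((xs @ ys) @ [hd (xs @ ys)])"
      unfolding set_edge_list[symmetric] by (metis mset_eq_imp_distinct_iff, metis set_mset_mset)
    have len: "length (ys @ xs) = length (xs @ ys)" "ys @ xs \<noteq> []" "xs @ ys \<noteq> []" using False by auto
    show ?thesis using t unfolding trail_def closed_walk_def eq len(1) using len(2,3) by blast
  qed (use t in auto)
  show "trail (a # rev p @ a # q)" if t: "trail (a # p @ a # q)" "even (length p)" for a p q
  proof -
    have "edge_list (a # rev p @ [a]) = rev (edge_list (a # p @ [a]))"
      using edge_list_rev[of "a # p @ [a]"] by simp
    then have "mset (edge_list ((a # rev p @ a # q) @ [a])) = mset (edge_list ((a # p @ a # q) @ [a]))"
      using edge_list_closed[of a "rev p" a q] edge_list_closed[of a p a q] by simp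
    then have eq: "distinct (edge_list ((a # rev p @ a # q) @ [a])) = distinct (edge_list ((a # p @ a # q) @ [a]))"
      "path_edges ((a # rev p @ a # q) @ [a]) = path_edges ((a # p @ a # q) @ [a])"
      unfolding set_edge_list[symmetric] by (metis mset_eq_imp_distinct_iff, metis set_mset_mset)
    have len: "length (a # rev p @ a # q) = length (a # p @ a # q)" by simp
    show ?thesis using t(1) list.distinct(1)[of a] unfolding trail_def closed_walk_def list.sel eq len by blast
  qed
  show "even (length xs)" if "trail xs" for xs using that by (simp add: trail_def closed_walk_def)
  show "even (length p)" if t: "trail (a # p @ a # q)" for a p q
  proof (rule ccontr)
    assume odd: "odd (length p)"
    have dist: "distinct (edge_list (a # p @ [a]) @ edge_list (a # q @ [a]))"
      and D: "D = path_edges (a # p @ [a]) \<union> path_edges (a # q @ [a])"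
      using t edge_list_closed[of a p a q] path_edges_append[of "a # p" a "q @ [a]"]
      unfolding trail_def by auto
    have E: "D \<subseteq> E" using t unfolding trail_def closed_walk_def by blast
    \<comment> \<open>With \<open>p\<close> of odd length this part is an even closed walk of its
      own, and it misses the edges of the rest.\<close>
    have cw: "closed_walk E (a # p)" using odd E D by (simp add: closed_walk_def)
    obtain b r where b: "p @ [a] = b # r" by (cases "p @ [a]") auto
    obtain c s where c: "q @ [a] = c # s" by (cases "q @ [a]") auto
    have "{a, b} \<in> set (edge_list (a # p @ [a]))" by (simp add: b)
    then have "count_list (edge_list ((a # p) @ [hd (a # p)])) {a, b} = 1"
      using dist count_list_distinct[of "edge_list (a # p @ [a])" "{a, b}"] by simp
    moreover have "{a, c} \<in> path_edges (a # q @ [a])" by (simp add: c)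
    then have "path_edges ((a # p) @ [hd (a # p)]) \<subset> D"
      using dist unfolding D by (auto simp: set_edge_list)
    ultimately show False using no_smaller_walk[OF cw] by blast
  qed
qed

text \<open>Loops at \<open>a\<close> and at \<open>z\<close> are connected by two stretches
  \<open>q1\<close> and \<open>q2\<close>. Using \<open>q1\<close> in both directions avoids the
  edges of \<open>q2\<close>, and as both loops are odd, the new closed walk is even.\<close>

lemma trail_at_most_one_repeat: "\<not> trail (a # s @ a # q1 @ z # r @ z # q2)"
proof
  assume t: "trail (a # s @ a # q1 @ z # r @ z # q2)"
  define L1 L2 L3 L4 where "L1 = edge_list (a # s @ [a])" and "L2 = edge_list (a # q1 @ [z])"
    and "L3 = edge_list (z # r @ [z])" and "L4 = edge_list (z # q2 @ [a])"
  have "edge_list (a # s @ a # q1 @ z # r @ z # q2 @ [a]) = L1 @ L2 @ L3 @ L4"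
    using edge_list_append[of "a # s" a "q1 @ z # r @ z # q2 @ [a]"]
      edge_list_append[of "a # q1" z "r @ z # q2 @ [a]"] edge_list_append[of "z # r" z "q2 @ [a]"]
    by (simp add: L1_def L2_def L3_def L4_def)
  then have dist: "distinct (L1 @ L2 @ L3 @ L4)" and D: "D = set (L1 @ L2 @ L3 @ L4)" and DE: "D \<subseteq> E"
    using t by (auto simp: trail_def closed_walk_def simp flip: set_edge_list)
  have s: "even (length s)" using even_part t by blast
  have "trail (z # r @ z # (q2 @ a # s @ a # q1))"
    using rotate[of "a # s @ a # q1" "z # r @ z # q2"] t by simp
  then have r: "even (length r)" by (rule even_part)
  define ys where "ys = a # s @ a # q1 @ z # r @ z # rev q1"
  have "edge_list (ys @ [hd ys]) = L1 @ L2 @ L3 @ rev L2"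
    using edge_list_append[of "a # s" a "q1 @ z # r @ z # rev q1 @ [a]"]
      edge_list_append[of "a # q1" z "r @ z # rev q1 @ [a]"] edge_list_append[of "z # r" z "rev q1 @ [a]"]
      edge_list_rev[of "a # q1 @ [z]"]
    by (simp add: L1_def L2_def L3_def ys_def)
  note ys = this
  have pe: "path_edges (ys @ [hd ys]) = set L1 \<union> set L2 \<union> set L3"
    unfolding set_edge_list[symmetric] ys by auto
  have cw: "closed_walk E ys" unfolding closed_walk_def pe
    using s r DE D by (auto simp: ys_def)
  obtain b t where b: "s @ [a] = b # t" by (cases "s @ [a]") auto
  obtain c t' where c: "q2 @ [a] = c # t'" by (cases "q2 @ [a]") auto
  have "{a, b} \<in> set L1" by (simp add: L1_def b)
  then have "count_list (edge_list (ys @ [hd ys])) {a, b} = 1"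
    unfolding ys using dist count_list_distinct[of L1 "{a, b}"] count_list_0_iff[of L2 "{a, b}"]
      count_list_0_iff[of L3 "{a, b}"] count_list_0_iff[of "rev L2" "{a, b}"] by auto
  moreover have "{z, c} \<in> set L4" by (simp add: L4_def c)
  then have "path_edges (ys @ [hd ys]) \<subset> D" unfolding pe D using dist by auto
  ultimately show False using no_smaller_walk[OF cw] by blast
qed

text \<open>Two visits to \<open>j\<close> either lie on the same side of the visits to
  \<open>i\<close>, which gives two loops side by side, or on different sides, which gives a
  crossing; both are excluded.\<close>

lemma trail_repeat_unique:
  assumes t: "trail xs" and "count_list xs i \<ge> 2" "count_list xs j \<ge> 2"
  shows "i = j"
proof (rule ccontr)
  assume ij: "i \<noteq> j"
  obtain l s r where xs: "xs = l @ i # s @ i # r" using assms(2) by (rule count_list_ge_2_split)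
  define t where "t = r @ l"
  have T: "trail (i # s @ i # t)" using rotate[of l "i # s @ i # r"] assms(1) by (simp add: xs t_def)
  have c: "count_list s j + count_list t j \<ge> 2" using assms(3) ij by (simp add: xs t_def)
  consider "count_list s j \<ge> 2" | "count_list t j \<ge> 2" | "count_list s j \<ge> 1" "count_list t j \<ge> 1"
    using c by linarith
  then show False
  proof cases
    case 1
    then obtain a b c where "s = a @ j # b @ j # c" by (rule count_list_ge_2_split)
    moreover have "trail (i # t @ i # s)" using rotate[of "i # s" "i # t"] T by simp
    ultimately show False using trail_at_most_one_repeat by simp
  next
    case 2
    then obtain a b c where "t = a @ j # b @ j # c" by (rule count_list_ge_2_split)
    then show False using trail_at_most_one_repeat T by simp
  next
    case 3
    then have "j \<in> set s" "j \<in> set t"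
      using count_list_0_iff[of s j] count_list_0_iff[of t j] by fastforce+
    then obtain a b c d where "s = a @ j # b" "t = c @ j # d" by (metis split_list)
    then show False using no_crossing T by simp
  qed
qed

end

context fin_graph
begin

lemma remove_common_edge:
  assumes "lookup u e > 0"
  obtains u' where "u = Poly_Mapping.single e 1 + (u' :: 'v set \<Rightarrow>\<^sub>0 nat)"
proof -
  have "u = Poly_Mapping.single e 1 + (u - Poly_Mapping.single e 1)"
    by (rule poly_mapping_eqI) (use assms in \<open>auto simp: lookup_add lookup_minus lookup_single when_def\<close>)
  then show ?thesis using that by blast
qed

text \<open>A squarefree circuit is one alternating trail through all of its edges, so
  \<open>vdeg p\<close> counts visits. An exponent two in \<open>m\<close> would make both ends of
  \<open>e\<close> repeated vertices of this trail.\<close>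

lemma sfsf_circuit_degree:
  fixes p q :: "'v set \<Rightarrow>\<^sub>0 nat"
  assumes g: "(monomial p - monomial q :: ('v set, 'k::field) mpoly) \<in> sfsf_circuits edge_vec E"
    and pq: "p \<noteq> q" and m: "vdeg m = vdeg p" and e: "e \<in> E"
  shows "lookup m e \<le> 1"
proof (rule ccontr)
  assume "\<not> lookup m e \<le> 1"
  then have two: "lookup m e \<ge> 2" by simp
  let ?g = "monomial p - monomial q :: ('v set, 'k) mpoly"
  have gc: "?g \<in> circuits edge_vec E" using g unfolding sfsf_circuits_def by blast
  have gt: "?g \<in> toric_ideal edge_vec E" using gc unfolding circuits_def by blast
  have k: "keys p \<subseteq> E" "keys q \<subseteq> E" "vdeg p = vdeg q"
    using gt unfolding binomial_in_toric_iff[OF pq] by auto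
  obtain u v where uv: "?g = monomial u - monomial v" "squarefree_exponent u" "squarefree_exponent v"
    using g unfolding sfsf_circuits_def by blast
  have "u \<noteq> v" using uv(1) monomial_diff_ne_zero[OF pq, where 'k = 'k] by auto
  then have "{p, q} = {u, v}"
    using uv(1) keys_binomial[OF pq, where 'k = 'k] keys_binomial[of u v, where 'k = 'k] by metis
  then have sf: "lookup p e \<le> 1" "lookup q e \<le> 1" for e
    using uv(2,3) unfolding squarefree_exponent_def by (auto simp: doubleton_eq_iff)
  interpret circuit_support E "keys p \<union> keys q"
  proof
    fix u v :: "'v set \<Rightarrow>\<^sub>0 nat"
    assume *: "u \<noteq> v" "keys u \<subseteq> E" "keys v \<subseteq> E" "vdeg u = vdeg v"
    then have "(monomial u - monomial v :: ('v set, 'k) mpoly) \<in> toric_ideal edge_vec E"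
      "is_binomial (monomial u - monomial v :: ('v set, 'k) mpoly)"
      unfolding is_binomial_def using binomial_in_toric_iff[OF *(1), where 'k = 'k] by blast+
    then have "\<not> poly_supp (monomial u - monomial v :: ('v set, 'k) mpoly) \<subset> poly_supp ?g"
      using gc unfolding circuits_def by blast
    then show "\<not> keys u \<union> keys v \<subset> keys p \<union> keys q"
      unfolding poly_supp_binomial[OF pq] poly_supp_binomial[OF *(1)] .
  qed
  \<comment> \<open>A common edge could be cancelled, and by squarefreeness it would then disappear
    from the support.\<close>
  have disj: "keys p \<inter> keys q = {}"
  proof (rule ccontr)
    assume "keys p \<inter> keys q \<noteq> {}"
    then obtain e where e: "e \<in> keys p" "e \<in> keys q" by blast
    obtain p' where p': "p = Poly_Mapping.single e 1 + p'"
      using remove_common_edge[of p e] e by (auto simp: in_keys_iff)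
    obtain q' where q': "q = Poly_Mapping.single e 1 + q'"
      using remove_common_edge[of q e] e by (auto simp: in_keys_iff)
    have "lookup p' e = 0" "lookup q' e = 0"
      using sf[of e] by (auto simp: p' q' lookup_add)
    then have "keys p' \<union> keys q' \<subset> keys p \<union> keys q" by (auto simp: p' q' keys_add_nat in_keys_iff)
    moreover have "p' \<noteq> q'" using pq by (auto simp: p' q')
    moreover have "vdeg p' = vdeg q'" using k(3) by (simp add: p' q' vdeg_add fun_eq_iff)
    moreover have "keys p' \<subseteq> E" "keys q' \<subseteq> E" using k by (auto simp: p' q' keys_add_nat)
    ultimately show False using minimal by blast
  qed
  have "p \<noteq> 0"
  proof
    assume "p = 0"
    then have "size q = 0" using vdeg_eq_imp_size_eq[OF k(3)] by simp
    then show False using size_eq_0 k(2) pq \<open>p = 0\<close> by metis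
  qed
  then obtain xs p' q' where xs: "closed_walk E xs" "p = pairs xs + p'" "q = pairs (rotate1 xs) + q'"
    using ex_closed_walk[OF k] by blast
  note cw = closed_walk_pairs[OF xs(1)]
  have ne: "pairs xs \<noteq> pairs (rotate1 xs)"
  proof
    assume eq: "pairs xs = pairs (rotate1 xs)"
    have "keys (pairs xs) \<subseteq> keys p" "keys (pairs (rotate1 xs)) \<subseteq> keys q"
      unfolding xs(2,3) keys_add_nat by blast+
    then have "keys (pairs xs) = {}" using disj unfolding eq by blast
    then have "size (pairs xs) = 0" by (simp add: size_def in_keys_iff)
    then show False using cw(5) xs(1) by (auto simp: closed_walk_def div_eq_0_iff)
  qed
  \<comment> \<open>An edge of \<open>p\<close> missed by the walk would leave a binomial of
    strictly smaller support.\<close>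
  have "keys p' = {}"
  proof (rule ccontr)
    assume "keys p' \<noteq> {}"
    then obtain e where e: "e \<in> keys p'" by blast
    then have "lookup (pairs xs) e = 0" using sf(1)[of e] by (simp add: xs(2) lookup_add in_keys_iff)
    moreover have "e \<notin> keys q" using disj e by (auto simp: xs(2) keys_add_nat)
    ultimately have "keys (pairs xs) \<union> keys (pairs (rotate1 xs)) \<subset> keys p \<union> keys q"
      using e by (auto simp: xs(2,3) keys_add_nat in_keys_iff)
    then show False using minimal[OF ne cw(1,2)] cw(3,4) by simp
  qed
  then have p: "p = pairs xs" using xs(2) by simp
  have "size q' = 0"
    using vdeg_eq_imp_size_eq[OF k(3)] vdeg_eq_imp_size_eq[of "pairs xs" "pairs (rotate1 xs)"] cw(3,4)
    unfolding xs(3) size_add p by simp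
  then have q: "q = pairs (rotate1 xs)" using size_eq_0[of q'] k(2) by (simp add: xs(3) keys_add_nat)
  obtain a s where a: "xs = a # s" using xs(1) by (cases xs) (auto simp: closed_walk_def)
  have ps: "pairs (xs @ [hd xs]) = p" "pairs (tl (xs @ [hd xs])) = q"
    using pairs_snoc[of xs "hd xs"] xs(1) p q by (simp_all add: closed_walk_def a)
  have "count_list (edge_list (xs @ [hd xs])) e \<le> 1" for e
  proof -
    have "lookup p e = 0 \<or> lookup q e = 0" using disj by (metis disjoint_iff in_keys_iff)
    then show ?thesis using lookup_pairs_add[of "xs @ [hd xs]" e] sf[of e] unfolding ps by auto
  qed
  then have "distinct (edge_list (xs @ [hd xs]))" by (rule distinct_if_count_list_le_1)
  then have t: "trail xs"
    unfolding trail_def using xs(1) path_edges_eq_keys[of "xs @ [hd xs]"] ps by simp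
  obtain i j where ij: "e = {i, j}" "i \<noteq> j" using card2[OF e] by (auto simp: card_2_iff)
  have "count_list xs i \<ge> 2" "count_list xs j \<ge> 2"
    using lookup_le_vdeg[OF e, of i m] lookup_le_vdeg[OF e, of j m] two cw(3) m ij by (simp_all add: p)
  then show False using trail_repeat_unique[OF t] ij(2) by blast
qed

text \<open>A minimal system containing \<open>f\<close> would still generate without it: squarefree
  circuits connect the two monomials of \<open>f\<close>, their moves must have smaller degree than
  \<open>f\<close>, and \<open>f\<close> takes no part in such degrees.\<close>

lemma non_sfsf_redundant:
  fixes f :: "('v set, 'k::field) mpoly"
  assumes gen: "toric_ideal edge_vec E = Idl\<^bsub>poly_ring E\<^esub> (sfsf_circuits edge_vec E :: ('v set, 'k) mpoly set)"
    and f: "f \<in> circuits edge_vec E - sfsf_circuits edge_vec E"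
  shows "redundant edge_vec E f"
  unfolding redundant_def
proof
  let ?S = "sfsf_circuits edge_vec E :: ('v set, 'k) mpoly set"
  assume "\<exists>F. binomial_generators edge_vec E F \<and> (\<forall>F'. F' \<subset> F \<longrightarrow> \<not> binomial_generators edge_vec E F') \<and> f \<in> F"
  then obtain F where F: "binomial_generators edge_vec E F" "\<forall>F'. F' \<subset> F \<longrightarrow> \<not> binomial_generators edge_vec E F'" "f \<in> F"
    by blast
  have I: "F \<subseteq> toric_ideal edge_vec E" and bin: "\<forall>f\<in>F. is_binomial f"
    using F(1) unfolding binomial_generators_iff by auto
  have SI: "?S \<subseteq> toric_ideal edge_vec E" and Sbin: "\<forall>f\<in>?S. is_binomial f"
    unfolding sfsf_circuits_def circuits_def by auto
  have "binomial_generators edge_vec E ?S" unfolding binomial_generators_def using SI Sbin gen by blast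
  then have Sconn: "conn (moves ?S) u v" if "keys u \<subseteq> E" "keys v \<subseteq> E" "vdeg u = vdeg v" for u v
    using that unfolding binomial_generators_iff by blast
  obtain a b where ab: "a \<noteq> b" "f = monomial a - monomial b"
    using bin F(3) unfolding is_binomial_def by blast
  have kab: "keys a \<subseteq> E" "keys b \<subseteq> E" "vdeg a = vdeg b"
    using I F(3) binomial_in_toric_iff[OF ab(1), where 'k = 'k] unfolding ab(2) by auto
  have "\<not> (squarefree_exponent a \<and> squarefree_exponent b)"
    using f unfolding sfsf_circuits_def ab(2) by blast
  then obtain e m where m: "m \<in> {a, b}" "lookup m e \<ge> 2" unfolding squarefree_exponent_def
    by (metis Suc_1 insertI1 insertI2 not_less_eq_eq One_nat_def)
  have mE: "e \<in> E" "vdeg m = vdeg a" using m kab by (auto simp: in_keys_iff subset_iff)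
  let ?G = "F - {f}"
  have GI: "?G \<subseteq> toric_ideal edge_vec E" using I by blast
  text \<open>Below the degree of \<open>f\<close>, the generator \<open>f\<close> is of no use.\<close>
  have small: "conn (moves ?G) u v" if uv: "keys u \<subseteq> E" "keys v \<subseteq> E" "vdeg u = vdeg v" "size u < size a" for u v
  proof -
    have "conn (moves F) u v" using F(1) uv unfolding binomial_generators_iff by blast
    then show ?thesis
    proof (rule conn_subst)
      fix w p q
      assume pq: "(p, q) \<in> moves F" "conn (moves F) u (w + p)" "conn (moves F) u (w + q)"
      have "size u = size w + size p"
        using vdeg_eq_imp_size_eq[OF conn_degree[OF I pq(2)]] by (simp add: size_add)
      then have sp: "size p < size a" using uv(4) by simp
      have "monomial p - monomial q \<noteq> f"
      proof
        assume "monomial p - monomial q = f"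
        then have "p \<in> {a, b}"
          using keys_binomial[OF ab(1), where 'k = 'k] keys_binomial[of p q, where 'k = 'k] pq(1)
          unfolding ab(2) by (auto simp: moves_def)
        then show False using sp vdeg_eq_imp_size_eq[OF kab(3)] by auto
      qed
      then have "(p, q) \<in> moves ?G" using pq(1) by (auto simp: moves_def)
      then show "conn (moves ?G) p q" using conn_move[of p q _ 0] by simp
    qed
  qed
  have "conn (moves ?G) a b"
  proof (rule conn_subst[OF Sconn[OF kab]])
    fix w p q
    assume pq: "(p, q) \<in> moves ?S" "conn (moves ?S) a (w + p)"
    have d: "keys p \<subseteq> E" "keys q \<subseteq> E" "vdeg p = vdeg q" "p \<noteq> q" using moves_degree[OF SI, of p q] pq(1) by auto
    have deg: "vdeg a = vdeg (w + p)" by (rule conn_degree[OF SI pq(2)])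
    have size: "size a = size w + size p" using vdeg_eq_imp_size_eq[OF deg] by (simp add: size_add)
    show "conn (moves ?G) p q"
    \<comment> \<open>A move without a multiplier would have exactly the vertex degrees of
      \<open>f\<close>, which no squarefree circuit has.\<close>
    proof (cases "size w = 0")
      case True
      have "vdeg w x = 0" for x
      proof -
        have "\<forall>e\<in>E. lookup w e = 0" using True fin by (simp add: size_def)
        then show ?thesis by (simp add: vdeg_def)
      qed
      then have "vdeg m = vdeg p" using deg mE(2) by (simp add: vdeg_add fun_eq_iff)
      moreover have "(monomial p - monomial q :: ('v set, 'k) mpoly) \<in> ?S" using pq(1) by (simp add: moves_def)
      ultimately have "lookup m e \<le> 1" using sfsf_circuit_degree[OF _ d(4) _ mE(1)] by blast
      then show ?thesis using m(2) by simp
    qed (use size small d in auto)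
  qed
  then have ab_conn: "conn (moves ?G) p q" if "(p, q) = (a, b) \<or> (p, q) = (b, a)" for p q
    using that conn_sym by blast
  have "binomial_generators edge_vec E ?G"
    unfolding binomial_generators_iff
  proof (intro conjI allI impI GI)
    fix u v assume "keys u \<subseteq> E" "keys v \<subseteq> E" "vdeg u = vdeg v"
    then have "conn (moves F) u v" using F(1) unfolding binomial_generators_iff by blast
    then show "conn (moves ?G) u v"
    proof (rule conn_subst)
      fix w p q
      assume pq: "(p, q) \<in> moves F"
      show "conn (moves ?G) p q"
      proof (cases "monomial p - monomial q = f")
        case True
        then have "{p, q} = {a, b}"
          using keys_binomial[OF ab(1), where 'k = 'k] keys_binomial[of p q, where 'k = 'k] pq
          unfolding ab(2) by (auto simp: moves_def)
        then show ?thesis using ab_conn by (auto simp: doubleton_eq_iff)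
      next
        case False
        then have "(p, q) \<in> moves ?G" using pq by (auto simp: moves_def)
        then show ?thesis using conn_move[of p q _ 0] by simp
      qed
    qed
  qed (use bin in auto)
  then show False using F(2,3) by blast
qed

end

section \<open>Induced odd cycles with a tail\<close>

lemma relpow_comp: "(a, b) \<in> R ^^ m \<Longrightarrow> (b, c) \<in> R ^^ n \<Longrightarrow> (a, c) \<in> R ^^ (m + n)"
  by (auto simp: relpow_add)

lemma relpow_sym: "sym R \<Longrightarrow> (a, b) \<in> R ^^ n \<Longrightarrow> (b, a) \<in> R ^^ n"
proof (induction n arbitrary: a)
  case (Suc n)
  obtain c where "(a, c) \<in> R" "(c, b) \<in> R ^^ n" using relpow_Suc_D2[OF Suc.prems(2)] by blast
  then have "(b, c) \<in> R ^^ n" "(c, a) \<in> R" using Suc by (auto dest: symD)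
  then show ?case by (rule relpow_Suc_I)
qed simp

lemma relpow_segment:
  assumes "\<forall>i<n. (f i, f (Suc i)) \<in> R" "i \<le> j" "j \<le> n"
  shows "(f i, f j) \<in> R ^^ (j - i)"
proof -
  have "\<exists>g. g 0 = f i \<and> g (j - i) = f j \<and> (\<forall>k<j - i. (g k, g (Suc k)) \<in> R)"
    by (rule exI[of _ "\<lambda>k. f (i + k)"]) (use assms in auto)
  then show ?thesis by (simp add: relpow_fun_conv)
qed

lemma map_upt_eq: "map f [0..<Suc n] = f 0 # map f [1..<Suc n]"
  using upt_conv_Cons[of 0 "Suc n"] by (simp del: upt_Suc)

lemma path_edges_map_upt: "path_edges (map f [0..<Suc n]) = {{f i, f (Suc i)} | i. i < n}"
proof -
  have "(map f [0..<Suc n]) ! i = f i" if "i < Suc n" for i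
    using that by (simp only: nth_map nth_upt length_upt) simp
  then show ?thesis
    unfolding path_edges_def setcompr_eq_image by (intro image_cong) (auto simp del: upt_Suc)
qed

context fin_graph
begin

definition adj :: "'v set \<Rightarrow> ('v \<times> 'v) set" where
  "adj T = {(a, b). a \<in> T \<and> b \<in> T \<and> {a, b} \<in> E}"

lemma sym_adj: "sym (adj T)"
  by (auto simp: adj_def sym_def insert_commute)

lemma adj_relpow_closed: "(a, b) \<in> adj T ^^ n \<Longrightarrow> a \<in> T \<Longrightarrow> b \<in> T"
  by (cases n) (auto simp: adj_def)

lemma walk_relpow:
  "path_edges ys \<subseteq> E \<Longrightarrow> set ys \<subseteq> T \<Longrightarrow> ys \<noteq> [] \<Longrightarrow> (hd ys, last ys) \<in> adj T ^^ (length ys - 1)"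
proof (induction ys rule: edge_list.induct)
  case (1 a b xs)
  then have "(a, b) \<in> adj T" "(b, last (b # xs)) \<in> adj T ^^ length xs" by (auto simp: adj_def)
  then show ?case using relpow_Suc_I2[of a b "adj T" _ "length xs"] by simp
qed auto

text \<open>A shortest walk from \<open>a\<close> to \<open>b\<close> is an induced path.\<close>

lemma ex_induced_path:
  assumes "(a, b) \<in> adj T ^^ n" "a \<in> T"
  obtains Q where "Q \<noteq> []" "hd Q = a" "last Q = b" "distinct Q" "set Q \<subseteq> T" "path_edges Q \<subseteq> E"
    "\<forall>e\<in>E. e \<subseteq> set Q \<longrightarrow> e \<in> path_edges Q"
proof -
  let ?R = "adj T"
  define l where "l = (LEAST n. (a, b) \<in> ?R ^^ n)"
  have "(a, b) \<in> ?R ^^ l" unfolding l_def using assms(1) by (rule LeastI)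
  have min: "l \<le> k" if "(a, b) \<in> ?R ^^ k" for k unfolding l_def using that by (rule Least_le)
  obtain f where f: "f 0 = a" "f l = b" "\<forall>i<l. (f i, f (Suc i)) \<in> ?R"
    using \<open>(a, b) \<in> ?R ^^ l\<close> by (auto simp: relpow_fun_conv)
  note seg = relpow_segment[OF f(3)]
  \<comment> \<open>Repeated vertices (\<open>d = 0\<close>) and chords (\<open>d = 1\<close>) are
    treated together, as shortcuts of length \<open>d\<close>.\<close>
  have short: "d = 1 \<and> j = Suc i" if "i < j" "j \<le> l" "d \<le> 1" "(f i, f j) \<in> ?R ^^ d" for i j d
  proof -
    have "(a, b) \<in> ?R ^^ (i + d + (l - j))"
      using relpow_comp[OF relpow_comp[OF _ that(4)] seg[OF that(2)]] seg[of 0 i] f(1,2) that by simp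
    then show ?thesis using min that by fastforce
  qed
  define Q where "Q = map f [0..<Suc l]"
  have fT: "f i \<in> T" if "i \<le> l" for i
    using adj_relpow_closed[OF seg[of 0 i]] that f(1) assms(2) by simp
  show ?thesis
  proof (rule that[of Q])
    show "hd Q = a" "Q \<noteq> []" "last Q = b" using f(1,2) by (simp_all add: Q_def hd_map del: upt_Suc) simp
    have "f i \<noteq> f j" if "i < j" "j \<le> l" for i j using short[OF that, of 0] by auto
    then have "inj_on f {0..<Suc l}" by (intro linorder_inj_onI) auto
    then show "distinct Q" by (simp add: Q_def distinct_map del: upt_Suc)
    show "set Q \<subseteq> T" using fT by (auto simp: Q_def simp del: upt_Suc)
    show "path_edges Q \<subseteq> E" unfolding Q_def path_edges_map_upt using f(3) by (auto simp: adj_def)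
    show "\<forall>e\<in>E. e \<subseteq> set Q \<longrightarrow> e \<in> path_edges Q"
    proof (intro ballI impI)
      fix e assume e: "e \<in> E" "e \<subseteq> set Q"
      then obtain s t where st: "e = {s, t}" "s \<noteq> t" using card2 by (metis card_2_iff)
      then obtain i j where ij: "s = f i" "t = f j" "i \<le> l" "j \<le> l"
        using e(2) by (auto simp: Q_def simp del: upt_Suc)
      have step: "{f i, f j} \<in> path_edges Q" if "i < j" "j \<le> l" "{f i, f j} \<in> E" for i j
      proof -
        have "(f i, f j) \<in> ?R ^^ 1" using that fT by (simp add: adj_def)
        then have "j = Suc i" using short[OF that(1,2), of 1] by simp
        then show ?thesis unfolding Q_def path_edges_map_upt using that by auto
      qed
      consider "i < j" | "j < i" using ij st(2) by (metis linorder_neqE_nat)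
      then show "e \<in> path_edges Q" using step[of i j] step[of j i] ij e(1) st(1)
        by cases (auto simp: insert_commute)
    qed
  qed
qed

text \<open>Take a shortest odd closed walk at \<open>y\<close>, say of length \<open>L\<close>, and among these one that begins
  and ends with the longest possible common tail; let \<open>h\<close> be the length of the tail.  Every
  repetition or chord would yield a shorter odd closed walk or a longer tail.\<close>

lemma ex_induced_lollipop:
  assumes "(y, y) \<in> adj T ^^ n" "odd n"
  obtains P p where "P \<noteq> []" "hd P = y" "distinct P" "p \<noteq> []" "even (length p)" "distinct p"
    "set p \<inter> set P = {}" "set P \<subseteq> T" "set p \<subseteq> T" "path_edges P \<subseteq> E"
    "path_edges (last P # p @ [last P]) \<subseteq> E"
    "\<forall>e\<in>E. e \<subseteq> set P \<union> set p \<longrightarrow> e \<in> path_edges P \<union> path_edges (last P # p @ [last P])"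
proof -
  let ?R = "adj T"
  define L where "L = (LEAST n. odd n \<and> (y, y) \<in> ?R ^^ n)"
  have L: "odd L" "(y, y) \<in> ?R ^^ L"
    using LeastI[of "\<lambda>n. odd n \<and> (y, y) \<in> ?R ^^ n" n] assms unfolding L_def by auto
  have minL: "L \<le> k" if "(y, y) \<in> ?R ^^ k" "odd k" for k
    unfolding L_def using that by (intro Least_le) simp
  have yT: "y \<in> T"
  proof -
    obtain k where "L = Suc k" using L(1) by (cases L) auto
    then obtain z where "(y, z) \<in> ?R" using relpow_Suc_D2[of y y k ?R] L(2) by auto
    then show ?thesis by (simp add: adj_def)
  qed
  \<comment> \<open>The tail is walked twice, so the loop at its end has \<open>L - 2 * h\<close>
    steps; \<open>2 * h < L\<close> makes this a genuine difference, and it is odd with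
    \<open>L\<close>.\<close>
  define tail where "tail = (\<lambda>h. 2 * h < L \<and> (\<exists>x. (y, x) \<in> ?R ^^ h \<and> (x, x) \<in> ?R ^^ (L - 2 * h)))"
  define h where "h = (GREATEST h. tail h)"
  have "tail 0" using L by (auto simp: tail_def intro: exI[of _ y] elim: oddE)
  moreover have bound: "\<And>k. tail k \<Longrightarrow> k \<le> L" by (auto simp: tail_def)
  ultimately have "tail h" unfolding h_def by (rule GreatestI_nat)
  then obtain x where h: "2 * h < L" and yx: "(y, x) \<in> ?R ^^ h" and xx: "(x, x) \<in> ?R ^^ (L - 2 * h)"
    by (auto simp: tail_def)
  have maxh: "k \<le> h" if "2 * k < L" "(y, z) \<in> ?R ^^ k" "(z, z) \<in> ?R ^^ (L - 2 * k)" for k z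
    unfolding h_def using that by (intro Greatest_le_nat[OF _ bound]) (auto simp: tail_def)
  define l where "l = L - 2 * h"
  have l: "L = 2 * h + l" "odd l" using h L(1) by (auto simp: l_def)
  obtain f where f: "f 0 = y" "f h = x" "\<forall>i<h. (f i, f (Suc i)) \<in> ?R"
    using yx by (auto simp: relpow_fun_conv)
  obtain c where c: "c 0 = x" "c l = x" "\<forall>i<l. (c i, c (Suc i)) \<in> ?R"
    using xx unfolding l_def[symmetric] by (auto simp: relpow_fun_conv)
  note fseg = relpow_segment[OF f(3)] and cseg = relpow_segment[OF c(3)] and rsym = relpow_sym[OF sym_adj]
  \<comment> \<open>Going to \<open>a\<close>, around and back is an odd closed walk at
    \<open>y\<close>. If it has the shortest length \<open>L\<close>, then its tail competes with
    \<open>h\<close>.\<close>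
  have loop: "L \<le> 2 * s + t \<and> (2 * s + t = L \<longrightarrow> s \<le> h)"
    if "(y, a) \<in> ?R ^^ s" "(a, a) \<in> ?R ^^ t" "odd t" for a s t
  proof (intro conjI impI)
    have "(y, y) \<in> ?R ^^ (s + t + s)" using relpow_comp[OF relpow_comp[OF that(1,2)] rsym[OF that(1)]] .
    then show "L \<le> 2 * s + t" using minL that(3) by fastforce
    assume eq: "2 * s + t = L"
    then have "t = L - 2 * s" "2 * s < L" using that(3) by (auto elim: oddE)
    then show "s \<le> h" using maxh that by blast
  qed
  have yc: "(y, c i) \<in> ?R ^^ (h + i)" "(y, c i) \<in> ?R ^^ (h + (l - i))" if "i \<le> l" for i
  proof -
    have "(x, c i) \<in> ?R ^^ i" "(x, c i) \<in> ?R ^^ (l - i)"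
      using cseg[of 0 i] rsym[OF cseg[of i l]] that c(1,2) by simp_all
    then show "(y, c i) \<in> ?R ^^ (h + i)" "(y, c i) \<in> ?R ^^ (h + (l - i))"
      using relpow_comp[OF yx] by blast+
  qed
  \<comment> \<open>If the shortcut has the parity of the arc that it replaces, it would shorten the
    closed walk at \<open>y\<close>. Otherwise arc and shortcut form an odd closed walk, which is
    tested twice: with the tail prolonged along the cycle to \<open>c i\<close>, and prolonged the
    other way round to \<open>c j\<close>.\<close>
  have cyc: "d = 1 \<and> (j = Suc i \<or> i = 0 \<and> j = l - 1)"
    if ij: "i < j" "j < l" and d: "d \<le> 1" "(c i, c j) \<in> ?R ^^ d" for i j d
  proof (cases "even (j - i + d)")
    case True
    have "(y, y) \<in> ?R ^^ (h + i + d + (h + (l - j)))"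
      using relpow_comp[OF relpow_comp[OF yc(1) d(2)] rsym[OF yc(2)]] ij by simp
    moreover have "odd (h + i + d + (h + (l - j)))" using True l(2) ij by auto
    ultimately have "L \<le> h + i + d + (h + (l - j))" by (rule minL)
    then show ?thesis using l(1) ij d(1) by presburger
  next
    case False
    have "(c i, c i) \<in> ?R ^^ (j - i + d)" using relpow_comp[OF cseg[of i j] rsym[OF d(2)]] ij by simp
    then have 1: "L \<le> 2 * (h + i) + (j - i + d)" "2 * (h + i) + (j - i + d) = L \<Longrightarrow> i = 0"
      using loop[OF yc(1)[of i], of "j - i + d"] False ij by auto
    have "(c j, c j) \<in> ?R ^^ (d + (j - i))" using relpow_comp[OF rsym[OF d(2)] cseg[of i j]] ij by simp
    then have 2: "L \<le> 2 * (h + (l - j)) + (d + (j - i))" "2 * (h + (l - j)) + (d + (j - i)) = L \<Longrightarrow> l - j = 0"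
      using loop[OF yc(2)[of j], of "d + (j - i)"] False ij by (auto simp: add.commute)
    obtain k where k: "j = i + k" using ij(1) less_imp_add_positive by blast
    obtain k' where k': "l = j + k'" "k' > 0" using ij(2) less_imp_add_positive by blast
    have a: "l \<le> i + j + d" using 1(1) l(1) k by simp
    \<comment> \<open>Equality would yield a tail of length \<open>h + k'\<close>, longer than the
      maximal one.\<close>
    have "2 * (h + k') + (d + k) \<noteq> L" using 2(2) k k' by auto
    then have b: "i + j < l + d" using 2(1) l(1) k k' by simp
    have "i + j + d = l" using a b False l(2) d(1) ij by presburger
    then show ?thesis using 1(2) l(1) ij d(1) by (cases "d = 0") auto
  qed
  have xl: "(x, x) \<in> ?R ^^ l" using xx by (simp add: l_def)
  have pth: "d = 1 \<and> j = Suc i" if ij: "i < j" "j \<le> h" and d: "d \<le> 1" "(f i, f j) \<in> ?R ^^ d" for i j d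
  proof -
    have "(y, x) \<in> ?R ^^ (i + d + (h - j))"
      using relpow_comp[OF relpow_comp[OF _ d(2)] fseg[OF ij(2)]] fseg[of 0 i] f(1,2) ij by simp
    then have "L \<le> 2 * (i + d + (h - j)) + l" using conjunct1[OF loop[OF _ xl l(2)]] by blast
    then show ?thesis using l(1) ij d(1) by presburger
  qed
  \<comment> \<open>A branch from the tail that reaches the cycle early: since \<open>l\<close> is
    odd, the two ways back to \<open>x\<close> around the cycle differ in parity, and the odd one
    closes up a walk shorter than \<open>L\<close>.\<close>
  have cross: False if i: "i < h" and j: "0 < j" "j < l" and d: "d \<le> 1" "(f i, c j) \<in> ?R ^^ d" for i j d
  proof -
    have yj: "(y, c j) \<in> ?R ^^ (i + d)" using relpow_comp[OF _ d(2)] fseg[of 0 i] f(1) i by simp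
    have "(y, y) \<in> ?R ^^ (i + d + (h + j))" "(y, y) \<in> ?R ^^ (i + d + (h + (l - j)))"
      using relpow_comp[OF yj rsym[OF yc(1)]] relpow_comp[OF yj rsym[OF yc(2)]] j by auto
    moreover have "odd (i + d + (h + j)) \<or> odd (i + d + (h + (l - j)))" using l(2) j by auto
    ultimately have "L \<le> i + d + (h + j) \<or> L \<le> i + d + (h + (l - j))" using minL by blast
    moreover have "l - j < l" using j by simp
    ultimately show False using l(1) i j d(1) by linarith
  qed
  have l3: "l \<ge> 3"
  proof -
    have "l \<noteq> 1"
    proof
      assume "l = 1"
      then have "{x, x} \<in> E" using xx by (simp add: l_def adj_def)
      then show False using edge_ne by blast
    qed
    then show ?thesis using l(2) by (cases l; cases "l - 1"; cases "l - 2") auto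
  qed
  have fT: "f i \<in> T" if "i \<le> h" for i
    using adj_relpow_closed[OF fseg[of 0 i]] that f(1) yT by simp
  have cT: "c i \<in> T" if "i \<le> l" for i
    using adj_relpow_closed[OF yc(1)] that yT by simp
  define P where "P = map f [0..<Suc h]"
  define p where "p = map c [1..<l]"
  have lastP: "last P = x" using f(2) by (simp add: P_def)
  have walk_c: "last P # p @ [last P] = map c [0..<Suc l]"
  proof -
    have "map c [0..<Suc l] = c 0 # map c [1..<l] @ [c l]"
      using l3 map_upt_eq(1)[of c l] by simp
    then show ?thesis unfolding lastP p_def c(1,2) by simp
  qed
  have setP: "set P = f ` {..h}" and setp: "set p = c ` {1..<l}"
    by (auto simp: P_def p_def simp del: upt_Suc)
  have f_edge: "{f i, f j} \<in> path_edges P" if "i < j" "j \<le> h" "{f i, f j} \<in> E" for i j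
  proof -
    have "(f i, f j) \<in> ?R ^^ 1" using that fT by (simp add: adj_def)
    then have "j = Suc i" using pth[OF that(1,2), of 1] by simp
    then show ?thesis unfolding P_def path_edges_map_upt using that by auto
  qed
  have c_edge: "{c i, c j} \<in> path_edges (map c [0..<Suc l])" if "i < j" "j < l" "{c i, c j} \<in> E" for i j
  proof -
    have "(c i, c j) \<in> ?R ^^ 1" using that cT by (simp add: adj_def)
    then have "j = Suc i \<or> i = 0 \<and> j = l - 1" using cyc[OF that(1,2), of 1] by auto
    then consider "j = Suc i" | "i = 0" "j = l - 1" by blast
    then show ?thesis
    proof cases
      case 1
      then show ?thesis unfolding path_edges_map_upt using that by auto
    next
      case 2
      then have "{c i, c j} = {c (l - 1), c (Suc (l - 1))}" using c l3 by auto
      moreover have "l - 1 < l" using l3 by simp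
      ultimately show ?thesis unfolding path_edges_map_upt by blast
    qed
  qed
  show ?thesis
  proof (rule that[of P p])
    show "P \<noteq> []" by (simp add: P_def)
    show "hd P = y" using f(1) map_upt_eq(1)[of f h] by (simp add: P_def)
    have "f i \<noteq> f j" if "i < j" "j \<le> h" for i j using pth[OF that, of 0] by auto
    then have "inj_on f {0..<Suc h}" by (intro linorder_inj_onI) auto
    then show "distinct P" by (simp add: P_def distinct_map del: upt_Suc)
    show "p \<noteq> []" "even (length p)" using l3 l(2) by (auto simp: p_def)
    have "c i \<noteq> c j" if "i < j" "j < l" for i j using cyc[OF that, of 0] by auto
    then have "inj_on c {1..<l}" by (intro linorder_inj_onI) auto
    then show "distinct p" by (simp add: p_def distinct_map)
    show "set p \<inter> set P = {}"
    proof -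
      have "f i \<noteq> c j" if "i \<le> h" "1 \<le> j" "j < l" for i j
      proof (cases "i = h")
        case True
        then show ?thesis using cyc[of 0 j 0] that c(1) f(2) by auto
      next
        case False
        then show ?thesis using cross[of i j 0] that by auto
      qed
      then show ?thesis unfolding setP setp by force
    qed
    show "set P \<subseteq> T" "set p \<subseteq> T" using fT cT unfolding setP setp by auto
    show "path_edges P \<subseteq> E" unfolding P_def path_edges_map_upt using f(3) by (auto simp: adj_def)
    show "path_edges (last P # p @ [last P]) \<subseteq> E"
      unfolding walk_c path_edges_map_upt using c(3) by (auto simp: adj_def)
    show "\<forall>e\<in>E. e \<subseteq> set P \<union> set p \<longrightarrow> e \<in> path_edges P \<union> path_edges (last P # p @ [last P])"
    proof (intro ballI impI)
      fix e assume e: "e \<in> E" "e \<subseteq> set P \<union> set p"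
      then obtain s t where st: "e = {s, t}" "s \<noteq> t" using card2 by (metis card_2_iff)
      have PP: "e \<in> path_edges P" if sP: "s \<in> set P" "t \<in> set P"
      proof -
        obtain i j where ij: "s = f i" "t = f j" "i \<le> h" "j \<le> h" using sP unfolding setP by auto
        consider "i < j" | "j < i" using ij st(2) by (metis linorder_neqE_nat)
        then show ?thesis using f_edge[of i j] f_edge[of j i] ij e(1) st(1)
          by cases (auto simp: insert_commute)
      qed
      have cc: "e \<in> path_edges (map c [0..<Suc l])" if sc: "s \<in> c ` {..<l}" "t \<in> c ` {..<l}"
      proof -
        obtain i j where ij: "s = c i" "t = c j" "i < l" "j < l" using sc by auto
        consider "i < j" | "j < i" using ij st(2) by (metis linorder_neqE_nat)
        then show ?thesis using c_edge[of i j] c_edge[of j i] ij e(1) st(1)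
          by cases (auto simp: insert_commute)
      qed
      have Pc: "a = x" if ab: "a \<in> set P" "b \<in> set p" "{a, b} \<in> E" for a b
      proof -
        obtain i j where ij: "a = f i" "b = c j" "i \<le> h" "1 \<le> j" "j < l" using ab unfolding setP setp by auto
        have "(f i, c j) \<in> ?R ^^ 1" using ab(3) ij fT cT by (simp add: adj_def)
        then have "False" if "i < h" using cross[of i j 1] that ij by simp
        then have "i = h" using ij(3) le_neq_implies_less by blast
        then show ?thesis using ij f(2) by simp
      qed
      have x: "x \<in> c ` {..<l}" using c(1) l3 by (intro image_eqI[of _ _ 0]) auto
      have sub: "set p \<subseteq> c ` {..<l}" unfolding setp by auto
      consider "s \<in> set P" "t \<in> set P" | "s \<in> set P" "t \<in> set p" | "s \<in> set p" "t \<in> set P" | "s \<in> set p" "t \<in> set p"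
        using e(2) st(1) by auto
      then show "e \<in> path_edges P \<union> path_edges (last P # p @ [last P])"
      proof cases
        case 1
        then show ?thesis using PP by blast
      next
        case 4
        then show ?thesis using cc sub unfolding walk_c by blast
      next
        case 2
        then have "s = x" using Pc e(1) st(1) by blast
        then show ?thesis using cc x sub 2 unfolding walk_c by blast
      next
        case 3
        then have "t = x" using Pc[of t s] e(1) st(1) by (simp add: insert_commute)
        then show ?thesis using cc x sub 3 unfolding walk_c by blast
      qed
    qed
  qed
qed

end

lemma not_distinct_decomp_first:
  assumes "\<not> distinct xs"
  obtains l a p r where "xs = l @ a # p @ a # r" "distinct (a # p)"
proof -
  obtain ys a r where 1: "a \<in> set ys" "distinct ys" "xs = ys @ a # r"
    using assms not_distinct_conv_prefix[of xs] by blast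
  obtain l p where "ys = l @ a # p" using split_list[OF 1(1)] by blast
  then show ?thesis using that[of l a p r] 1 by simp
qed

section \<open>Indispensable walks\<close>

text \<open>\<open>chordless\<close> concerns positions at odd distance along the walk; that
  \<open>p\<close> and \<open>q\<close> are nonempty exempts consecutive vertices, which are
  adjacent anyway.\<close>

locale chordless_walks = fin_graph E + walk_class W for E :: "'v set set" and W :: "'v list \<Rightarrow> bool" +
  assumes closed: "W xs \<Longrightarrow> closed_walk E xs"
    and chordless: "W (a # p @ b # q) \<Longrightarrow> even (length p) \<Longrightarrow> p \<noteq> [] \<Longrightarrow> q \<noteq> [] \<Longrightarrow> {a, b} \<notin> E"
begin

text \<open>Reversing \<open>p\<close> changes the parity of all distances between \<open>p\<close> and \<open>q\<close>, so that \<open>chordless\<close>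
  excludes all edges between them.\<close>

lemma gate:
  assumes W: "W (a # p @ a # q)" and dist: "distinct (a # p)"
  shows "even (length p)" "p \<noteq> []" "a \<notin> set q" "set p \<inter> set q = {}"
    "\<forall>b\<in>set p. \<forall>c\<in>set q. {b, c} \<notin> E"
proof -
  show ev: "even (length p)" using even_part[OF W] .
  have evq: "even (length q)" using even_part'[OF W] .
  show "p \<noteq> []"
  proof
    assume "p = []"
    then have "{a, a} \<in> E" using closed[OF W] by (auto simp: closed_walk_def)
    then show False using edge_ne by blast
  qed
  show "a \<notin> set q"
  proof
    assume "a \<in> set q"
    then obtain q1 q2 where q: "q = q1 @ a # q2" by (metis split_list)
    have "even (length (p @ a # q1))" using even_part[of a "p @ a # q1" q2] W q by simp
    moreover have "even (length q1)"
      using even_part[of a q1 "q2 @ a # p"] rotate[of "a # p" "a # q"] W q by simp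
    ultimately show False using ev by simp
  qed
  have rev: "W (a # rev p @ a # q)" using reverse[OF W ev] .
  show "set p \<inter> set q = {}"
  proof (rule ccontr)
    assume "set p \<inter> set q \<noteq> {}"
    then obtain b where "b \<in> set p" "b \<in> set q" by blast
    then obtain p1 p2 q1 q2 where "p = p1 @ b # p2" "q = q1 @ b # q2" by (metis split_list)
    then show False using no_crossing W by simp
  qed
  show "\<forall>b\<in>set p. \<forall>c\<in>set q. {b, c} \<notin> E"
  proof (intro ballI notI)
    fix b c assume bc: "b \<in> set p" "c \<in> set q" "{b, c} \<in> E"
    obtain p1 p2 where p: "p = p1 @ b # p2" using bc(1) by (metis split_list)
    obtain q1 q2 where q: "q = q1 @ c # q2" using bc(2) by (metis split_list)
    have 1: "W (b # (p2 @ a # q1) @ c # (q2 @ a # p1))"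
      using rotate[of "a # p1" "b # p2 @ a # q"] W by (simp add: p q)
    have 2: "W (b # (rev p1 @ a # q1) @ c # (q2 @ a # rev p2))"
      using rotate[of "a # rev p2" "b # rev p1 @ a # q"] rev by (simp add: p q)
    have "odd (length (p2 @ a # q1))" "odd (length (rev p1 @ a # q1))"
      using chordless[OF 1] chordless[OF 2] bc(3) by auto
    then show False using ev by (simp add: p)
  qed
qed

text \<open>Cut off a loop without repetitions at \<open>a\<close>. If the rest repeats no vertex
  either, two cycles share \<open>a\<close>. Otherwise a second loop is cut off at \<open>z\<close>.
  By \<open>gate\<close>, each loop is attached to the rest of the walk only at \<open>a\<close> or
  \<open>z\<close>, so pieces chosen to be induced within the two loops and within the stretch
  between them fit together to an induced subgraph.\<close>

lemma joined_cycles_or_bowtie: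
  assumes "W xs" "\<not> distinct xs"
  shows "(\<exists>a p q. W (a # p @ a # q) \<and> distinct (a # p @ q)) \<or>
    (\<exists>p1 P p2. joined_cycles E p1 P p2 \<and> length P \<ge> 2 \<and>
      (\<forall>e\<in>E. e \<subseteq> set p1 \<union> set P \<union> set p2 \<longrightarrow>
        e \<in> path_edges (hd P # p1 @ [hd P]) \<union> path_edges P \<union> path_edges (last P # p2 @ [last P])))"
proof -
  obtain l a p r where xs: "xs = l @ a # p @ a # r" and ap: "distinct (a # p)"
    using not_distinct_decomp_first[OF assms(2)] .
  define q where "q = r @ l"
  have W1: "W (a # p @ a # q)" using rotate[of l "a # p @ a # r"] assms(1) by (simp add: xs q_def)
  note g1 = gate[OF W1 ap]
  show ?thesis
  proof (cases "distinct q")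
    case True
    then have "distinct (a # p @ q)" using ap g1(3,4) by auto
    then show ?thesis using W1 by blast
  next
    case False
    obtain q1 z s q2 where q: "q = q1 @ z # s @ z # q2" and zs: "distinct (z # s)"
      using not_distinct_decomp_first[OF False] .
    have W2: "W (z # s @ z # (q2 @ a # p @ a # q1))"
      using rotate[of "a # p @ a # q1" "z # s @ z # q2"] W1 by (simp add: q)
    note g2 = gate[OF W2 zs]
    have pe1: "path_edges (a # p @ [a]) \<subseteq> E" and peQ: "path_edges (a # q1 @ [z]) \<subseteq> E"
      and pe2: "path_edges (z # s @ [z]) \<subseteq> E"
      using closed[OF W1] path_edges_append[of "a # p" a "q1 @ z # s @ z # q2 @ [a]"]
        path_edges_append[of "a # q1" z "s @ z # q2 @ [a]"] path_edges_append[of "z # s" z "q2 @ [a]"]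
      unfolding q by (auto simp: closed_walk_def)
    have "(a, a) \<in> adj (set (a # p)) ^^ (length p + 1)"
      using walk_relpow[OF pe1, of "set (a # p)"] by simp
    then obtain P1 c1 where
      1: "P1 \<noteq> []" "hd P1 = a" "distinct P1" "c1 \<noteq> []" "even (length c1)" "distinct c1"
        "set c1 \<inter> set P1 = {}" "set P1 \<subseteq> set (a # p)" "set c1 \<subseteq> set (a # p)" "path_edges P1 \<subseteq> E"
        "path_edges (last P1 # c1 @ [last P1]) \<subseteq> E"
        "\<forall>e\<in>E. e \<subseteq> set P1 \<union> set c1 \<longrightarrow> e \<in> path_edges P1 \<union> path_edges (last P1 # c1 @ [last P1])"
      by (rule ex_induced_lollipop) (use g1(1) in simp)
    have "(z, z) \<in> adj (set (z # s)) ^^ (length s + 1)"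
      using walk_relpow[OF pe2, of "set (z # s)"] by simp
    then obtain P2 c2 where
      2: "P2 \<noteq> []" "hd P2 = z" "distinct P2" "c2 \<noteq> []" "even (length c2)" "distinct c2"
        "set c2 \<inter> set P2 = {}" "set P2 \<subseteq> set (z # s)" "set c2 \<subseteq> set (z # s)" "path_edges P2 \<subseteq> E"
        "path_edges (last P2 # c2 @ [last P2]) \<subseteq> E"
        "\<forall>e\<in>E. e \<subseteq> set P2 \<union> set c2 \<longrightarrow> e \<in> path_edges P2 \<union> path_edges (last P2 # c2 @ [last P2])"
      by (rule ex_induced_lollipop) (use g2(1) in simp)
    have "(a, z) \<in> adj (set (a # q1 @ [z])) ^^ (length q1 + 1)"
      using walk_relpow[OF peQ, of "set (a # q1 @ [z])"] by simp
    then obtain Q where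
      Q: "Q \<noteq> []" "hd Q = a" "last Q = z" "distinct Q" "set Q \<subseteq> set (a # q1 @ [z])" "path_edges Q \<subseteq> E"
        "\<forall>e\<in>E. e \<subseteq> set Q \<longrightarrow> e \<in> path_edges Q"
      by (rule ex_induced_path) simp
    have az: "a \<noteq> z" using g1(3) by (auto simp: q)
    obtain P1' where P1: "P1 = a # P1'" using 1(1,2) by (cases P1) auto
    obtain P2' where P2: "P2 = z # P2'" using 2(1,2) by (cases P2) auto
    obtain Q' where Q': "Q = a # Q'" using Q(1,2) by (cases Q) auto
    have Qz: "Q = butlast Q @ [z]" using Q(1,3) by (metis append_butlast_last_id)
    have Q'ne: "Q' \<noteq> []" using Q' Q(3) az by auto
    \<comment> \<open>The tails of both odd cycles prolong the connecting path; \<open>a\<close> and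
      \<open>z\<close> are listed only once.\<close>
    define P where "P = rev P1 @ Q' @ P2'"
    have P_eq: "P = rev P1' @ Q @ P2'" by (simp add: P_def P1 Q')
    have hdP: "hd P = last P1" using 1(1) by (simp add: P_def hd_append hd_rev)
    have lastP: "last P = last P2"
      using Q'ne Q(3) by (auto simp: P_def P2 Q')
    have lenP: "length P \<ge> 2" using 1(1) Q'ne by (cases P1; cases Q') (auto simp: P_def)
    have pathP: "path_edges P = path_edges P1 \<union> path_edges Q \<union> path_edges P2"
    proof -
      have "path_edges P = path_edges (rev P1' @ [a]) \<union> path_edges (Q @ P2')"
        using path_edges_append[of "rev P1'" a "Q' @ P2'"] by (simp add: P_eq Q')
      also have "rev P1' @ [a] = rev P1" by (simp add: P1)
      also have "path_edges (Q @ P2') = path_edges Q \<union> path_edges P2"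
        using path_edges_append[of "butlast Q" z P2'] Qz by (metis P2 append.assoc append_Cons append_Nil)
      finally show ?thesis by auto
    qed
    have P1s: "set P1' \<subseteq> set p" "set c1 \<subseteq> set p"
      using 1(3,7,8,9) unfolding P1 by auto
    have P2s: "set P2' \<subseteq> set s" "set c2 \<subseteq> set s"
      using 2(3,7,8,9) unfolding P2 by auto
    have Qs: "set Q' \<subseteq> insert z (set q1)" using Q(4,5) unfolding Q' by auto
    have qs: "set q = set q1 \<union> insert z (set s) \<union> set q2" by (auto simp: q)
    have s_disj: "set s \<inter> (set q1 \<union> insert a (set p)) = {}" "z \<notin> set s" "z \<notin> set q1"
      using g2(3,4) zs by auto
    have p_disj: "set p \<inter> insert a (set q1 \<union> insert z (set s)) = {}"
      using g1(4) ap unfolding qs by auto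
    have a_notin: "a \<notin> set q1" "a \<notin> set s" using g1(3) unfolding qs by auto
    have apart: "set P1' \<inter> set Q' = {}" "set P1' \<inter> set P2' = {}" "set Q' \<inter> set P2' = {}" "a \<notin> set P2'"
      "set c1 \<inter> set Q' = {}" "set c1 \<inter> set P2' = {}" "a \<notin> set c1"
      "set c2 \<inter> set Q' = {}" "set c2 \<inter> set P1' = {}" "a \<notin> set c2"
      using P1s P2s Qs s_disj p_disj a_notin by blast+
    have distP: "distinct P"
      using 1(3) 2(3) Q(4) apart unfolding P_def P1 P2 Q' by auto
    have sets: "set P = set P1' \<union> insert a (set Q') \<union> set P2'"
      by (auto simp: P_eq Q')
    have "joined_cycles E c1 P c2"
    proof
      show "set c1 \<inter> set P = {}" using 1(7) apart unfolding sets P1 by auto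
      show "set c2 \<inter> set P = {}" using 2(7) apart unfolding sets P2 by auto
      show "set c1 \<inter> set c2 = {}" using P1s P2s p_disj by auto
      show "P \<noteq> []" using lenP by auto
    qed (use 1 2 Q hdP lastP pathP distP in auto)
    moreover have "e \<in> path_edges (hd P # c1 @ [hd P]) \<union> path_edges P \<union> path_edges (last P # c2 @ [last P])"
      if e: "e \<in> E" "e \<subseteq> set c1 \<union> set P \<union> set c2" for e
    proof -
      have A: "set P1 \<union> set c1 \<subseteq> insert a (set p)" "set P2 \<union> set c2 \<subseteq> insert z (set s)"
        using P1s P2s unfolding P1 P2 by auto
      have all: "e \<subseteq> (set P1 \<union> set c1) \<union> set Q \<union> (set P2 \<union> set c2)"
        using e(2) unfolding sets P1 P2 Q' by auto
      obtain v w where vw: "e = {v, w}" using card2[OF e(1)] by (meson card_2_iff)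
      have g1': "{b, c} \<notin> E" if "b \<in> set p" "c \<in> set q1 \<union> insert z (set s)" for b c
        using g1(5) that unfolding qs by blast
      have g2': "{b, c} \<notin> E" if "b \<in> set s" "c \<in> insert a (set q1) \<union> set p" for b c
        using g2(5) that by auto
      \<comment> \<open>A neighbour of a vertex inside the first loop can only be \<open>a\<close>,
        which belongs to \<open>P1\<close>, or lie in the loop again.\<close>
      have left: "w \<in> set P1 \<union> set c1" if "v \<in> set p" "{v, w} \<in> E" "{v, w} \<subseteq> (set P1 \<union> set c1) \<union> set Q \<union> (set P2 \<union> set c2)" for v w
      proof (rule ccontr)
        assume "w \<notin> set P1 \<union> set c1"
        then have "w \<in> set q1 \<union> insert z (set s)" using that(3) A(2) Qs unfolding P1 Q' by auto
        then show False using g1' that(1,2) by blast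
      qed
      have right: "w \<in> set P2 \<union> set c2" if "v \<in> set s" "{v, w} \<in> E" "{v, w} \<subseteq> (set P1 \<union> set c1) \<union> set Q \<union> (set P2 \<union> set c2)" for v w
      proof (rule ccontr)
        assume "w \<notin> set P2 \<union> set c2"
        then have "w \<in> insert a (set q1) \<union> set p" using that(3) A(1) Qs unfolding P2 Q' by auto
        then show False using g2' that(1,2) by blast
      qed
      have E': "{v, w} \<in> E" "{w, v} \<in> E" using e(1) vw by (auto simp: insert_commute)
      have sub: "{v, w} \<subseteq> (set P1 \<union> set c1) \<union> set Q \<union> (set P2 \<union> set c2)"
        "{w, v} \<subseteq> (set P1 \<union> set c1) \<union> set Q \<union> (set P2 \<union> set c2)" using all vw by auto
      have in1: "x \<in> set Q \<or> x \<in> set p \<and> x \<in> set P1 \<union> set c1 \<or> x \<in> set s \<and> x \<in> set P2 \<union> set c2"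
        if "x \<in> (set P1 \<union> set c1) \<union> set Q \<union> (set P2 \<union> set c2)" for x
        using that A Q(1-3) hd_in_set[OF Q(1)] last_in_set[OF Q(1)] by auto
      have v: "v \<in> set Q \<or> v \<in> set p \<and> v \<in> set P1 \<union> set c1 \<or> v \<in> set s \<and> v \<in> set P2 \<union> set c2"
        and w: "w \<in> set Q \<or> w \<in> set p \<and> w \<in> set P1 \<union> set c1 \<or> w \<in> set s \<and> w \<in> set P2 \<union> set c2"
        using in1 sub(1) by simp_all
      have notQ: "x \<notin> set Q" if "x \<in> set p \<or> x \<in> set s" for x
        using that Q(5) p_disj s_disj a_notin by auto
      have l1: "v \<in> set p \<longrightarrow> w \<in> set P1 \<union> set c1" and l2: "w \<in> set p \<longrightarrow> v \<in> set P1 \<union> set c1"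
        and r1: "v \<in> set s \<longrightarrow> w \<in> set P2 \<union> set c2" and r2: "w \<in> set s \<longrightarrow> v \<in> set P2 \<union> set c2"
        using left[OF _ E'(1) sub(1)] left[OF _ E'(2) sub(2)]
          right[OF _ E'(1) sub(1)] right[OF _ E'(2) sub(2)] by blast+
      show ?thesis
      proof (cases "v \<in> set Q \<and> w \<in> set Q")
        case True
        then have "e \<subseteq> set Q" using vw by simp
        then show ?thesis using bspec[OF Q(7) e(1)] pathP by blast
      next
        case False
        then have "v \<in> set p \<or> w \<in> set p \<or> v \<in> set s \<or> w \<in> set s" using v w by blast
        then have "{v, w} \<subseteq> set P1 \<union> set c1 \<or> {v, w} \<subseteq> set P2 \<union> set c2"
        proof (elim disjE)
          assume "v \<in> set p"
          then have "w \<in> set P1 \<union> set c1" "v \<in> set P1 \<union> set c1"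
            using l1 v notQ[of v] p_disj by blast+
          then show ?thesis by blast
        next
          assume "w \<in> set p"
          then have "v \<in> set P1 \<union> set c1" "w \<in> set P1 \<union> set c1"
            using l2 w notQ[of w] p_disj by blast+
          then show ?thesis by blast
        next
          assume "v \<in> set s"
          then have "w \<in> set P2 \<union> set c2" "v \<in> set P2 \<union> set c2"
            using r1 v notQ[of v] p_disj by blast+
          then show ?thesis by blast
        next
          assume "w \<in> set s"
          then have "v \<in> set P2 \<union> set c2" "w \<in> set P2 \<union> set c2"
            using r2 w notQ[of w] p_disj by blast+
          then show ?thesis by blast
        qed
        then show ?thesis
          using bspec[OF 1(12) e(1)] bspec[OF 2(12) e(1)] vw pathP hdP lastP by auto
      qed
    qed
    ultimately show ?thesis using lenP by blast
  qed
qed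

end

section \<open>Generation by squarefree circuits\<close>

context fin_graph
begin

lemma closed_walk_rotate1:
  assumes "closed_walk E xs"
  shows "closed_walk E (rotate1 xs)" "pairs (rotate1 (rotate1 xs)) = pairs xs"
proof -
  obtain a b t where xs: "xs = a # b # t" using assms
    by (cases xs rule: edge_list.cases) (auto simp: closed_walk_def)
  have ev: "even (length t)" and pe: "path_edges (a # b # t @ [a]) \<subseteq> E"
    using assms by (auto simp: closed_walk_def xs)
  have "path_edges (b # t @ [a, b]) = path_edges (b # t @ [a]) \<union> {{a, b}}"
    using path_edges_append[of "b # t" a "[b]"] by simp
  then show "closed_walk E (rotate1 xs)" using pe ev by (auto simp: closed_walk_def xs)
  show "pairs (rotate1 (rotate1 xs)) = pairs xs"
    using ev by (simp add: xs pairs_append add.commute)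
qed

lemma conn_common:
  assumes IH: "\<And>u v. size u < n \<Longrightarrow> keys u \<subseteq> E \<Longrightarrow> keys v \<subseteq> E \<Longrightarrow> vdeg u = vdeg v \<Longrightarrow> conn M u v"
    and "size u < n" "keys u \<subseteq> E" "keys v \<subseteq> E" "vdeg u = vdeg v"
  shows "conn M (w + u) (w + v)"
  using conn_add_left[OF IH[OF assms(2-5)]] .

text \<open>An even closed part of the walk, or a chord at odd distance, gives a third monomial of the
  same degree that has a factor in common with each of the two monomials of the walk.\<close>

lemma chordless_walks_of_degree:
  assumes IH: "\<And>u v. size u < n \<Longrightarrow> keys u \<subseteq> E \<Longrightarrow> keys v \<subseteq> E \<Longrightarrow> vdeg u = vdeg v \<Longrightarrow> conn M u v"
  shows "chordless_walks E (\<lambda>xs. closed_walk E xs \<and> length xs = 2 * n \<and> \<not> conn M (pairs xs) (pairs (rotate1 xs)))"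
    (is "chordless_walks E ?W")
proof unfold_locales
  \<comment> \<open>One rotation exchanges the two monomials of the walk.\<close>
  have rot1: "?W (rotate1 xs)" if "?W xs" for xs
    using that closed_walk_rotate1[of xs] conn_sym[of M "pairs (rotate1 xs)" "pairs xs"] by auto
  show "?W (ys @ xs)" if "?W (xs @ ys)" for xs ys
  proof -
    have "?W (rotate k (xs @ ys))" for k
    proof (induction k)
      case (Suc k)
      then show ?case using rot1[OF Suc.IH] by (simp add: rotate_Suc)
    qed (use that in simp)
    then show ?thesis using rotate_append[of xs ys] by metis
  qed
  show "?W (a # rev p @ a # q)" if W: "?W (a # p @ a # q)" and ev: "even (length p)" for a p q
  proof -
    have cl: "path_edges (a # p @ a # q @ [a]) = path_edges (a # rev p @ a # q @ [a])"
      using path_edges_append[of "a # p" a "q @ [a]"] path_edges_append[of "a # rev p" a "q @ [a]"]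
        path_edges_rev[of "a # p @ [a]"] by simp
    \<comment> \<open>The part has even length with as well as without its end points
      \<open>a\<close>, so reversing it permutes the pairs within each of the two monomials.\<close>
    have "pairs (a # rev p @ [a]) = pairs (a # p @ [a])"
      using pairs_rev[of "a # p @ [a]"] ev by simp
    then have 1: "pairs (a # rev p @ a # q) = pairs (a # p @ a # q)"
      using pairs_append[of "a # rev p @ [a]" q] pairs_append[of "a # p @ [a]" q] ev by simp
    have "pairs (rev p @ a # q @ [a]) = pairs (p @ a # q @ [a])"
      using ev by (simp add: pairs_append pairs_rev)
    then have 2: "pairs (rotate1 (a # rev p @ a # q)) = pairs (rotate1 (a # p @ a # q))" by simp
    show ?thesis using W cl unfolding 1 2 by (simp add: closed_walk_def)
  qed
  show "even (length xs)" if "?W xs" for xs using that by auto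
  show "closed_walk E xs" if "?W xs" for xs using that by auto
  show "even (length p)" if W: "?W (a # p @ a # q)" for a p q
  proof (rule ccontr)
    assume odd: "odd (length p)"
    have oddq: "odd (length q)" using W odd by (auto simp: closed_walk_def)
    have len: "length p + length q + 2 = 2 * n" using W by auto
    have "path_edges (a # p @ a # q @ [a]) \<subseteq> E" using W by (simp add: closed_walk_def)
    then have cp: "closed_walk E (a # p)" and cq: "closed_walk E (a # q)"
      using path_edges_append[of "a # p" a "q @ [a]"] odd oddq by (auto simp: closed_walk_def)
    have "pairs (a # p @ a # q) = pairs (a # p) + pairs (a # q)"
      using pairs_append[of "a # p" "a # q"] odd by simp
    moreover have "pairs (rotate1 (a # p @ a # q)) = pairs (rotate1 (a # p)) + pairs (rotate1 (a # q))"
      using pairs_append[of "p @ [a]" "q @ [a]"] odd by simp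
    moreover have "conn M (pairs (a # p)) (pairs (rotate1 (a # p)))"
      by (rule IH) (use closed_walk_pairs[OF cp] len odd in \<open>auto elim!: oddE\<close>)
    moreover have "conn M (pairs (a # q)) (pairs (rotate1 (a # q)))"
      by (rule IH) (use closed_walk_pairs[OF cq] len oddq in \<open>auto elim!: oddE\<close>)
    ultimately show False using W conn_add by metis
  qed
  show "{a, b} \<notin> E" if W: "?W (a # p @ b # q)" and ev: "even (length p)" and ne: "p \<noteq> []" "q \<noteq> []" for a b p q
  proof
    assume ab: "{a, b} \<in> E"
    have evq: "even (length q)" using W ev by (auto simp: closed_walk_def)
    have len: "length p + length q + 2 = 2 * n" using W by auto
    have pe: "path_edges (a # p @ b # q @ [a]) \<subseteq> E" using W by (simp add: closed_walk_def)
    have peab: "path_edges (a # p @ [b]) \<subseteq> E" and peba: "path_edges (b # q @ [a]) \<subseteq> E"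
      using pe path_edges_append[of "a # p" b "q @ [a]"] by auto
    have pp: "path_edges p \<subseteq> E" "path_edges q \<subseteq> E"
      using peab peba path_edges_loop[OF ne(1), of a b] path_edges_loop[OF ne(2), of b a] by auto
    let ?s = "Poly_Mapping.single {a, b} (1 :: nat)"
    have u: "pairs (a # p @ b # q) = pairs q + pairs (a # p @ [b])"
      using pairs_append[of "a # p @ [b]" q] ev by (simp add: add.commute)
    have v: "pairs (rotate1 (a # p @ b # q)) = pairs p + pairs (b # q @ [a])"
      using pairs_append[of p "b # q @ [a]"] ev by simp
    obtain i j where ij: "length p = 2 * i" "length q = 2 * j" using ev evq by (auto elim!: evenE)
    have "length p \<noteq> 0" "length q \<noteq> 0" using ne by simp_all
    then have pos: "i > 0" "j > 0" unfolding ij by simp_all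
    have kp: "keys (?s + pairs p) \<subseteq> E" "keys (?s + pairs q) \<subseteq> E"
      using ab keys_pairs_subset[OF pp(1)] keys_pairs_subset[OF pp(2)] by (auto simp: keys_add_nat)
    have cu: "conn M (pairs q + pairs (a # p @ [b])) (pairs q + (?s + pairs p))"
    proof (rule conn_common[OF IH])
      show "vdeg (pairs (a # p @ [b])) = vdeg (?s + pairs p)"
        using vdeg_pairs[OF peab] vdeg_pairs[OF pp(1)] vdeg_single[OF ab] ev edge_ne[OF ab]
        by (auto simp: fun_eq_iff vdeg_add)
      show "size (pairs (a # p @ [b])) < n" using size_pairs[OF peab] len ij pos by simp
    qed (use keys_pairs_subset[OF peab] kp in auto)
    have cv: "conn M (pairs p + pairs (b # q @ [a])) (pairs p + (?s + pairs q))"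
    proof (rule conn_common[OF IH])
      show "vdeg (pairs (b # q @ [a])) = vdeg (?s + pairs q)"
        using vdeg_pairs[OF peba] vdeg_pairs[OF pp(2)] vdeg_single[OF ab] evq edge_ne[OF ab]
        by (auto simp: fun_eq_iff vdeg_add)
      show "size (pairs (b # q @ [a])) < n" using size_pairs[OF peba] len ij pos by simp
    qed (use keys_pairs_subset[OF peba] kp in auto)
    have swap: "pairs p + (?s + pairs q) = pairs q + (?s + pairs p)" by (simp add: add_ac)
    have "conn M (pairs (a # p @ b # q)) (pairs (rotate1 (a # p @ b # q)))"
      unfolding u v by (rule conn_trans[OF conn_sym[OF cv[unfolded swap]] cu])
    then show False using W by blast
  qed
qed

lemma joined_cycles_induces:
  assumes "joined_cycles E p1 P p2" "length P \<ge> 2" "\<Union>E \<subseteq> V"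
    and ind: "\<forall>e\<in>E. e \<subseteq> set p1 \<union> set P \<union> set p2 \<longrightarrow>
        e \<in> path_edges (hd P # p1 @ [hd P]) \<union> path_edges P \<union> path_edges (last P # p2 @ [last P])"
  shows "\<exists>W\<subseteq>V. induces_joined_odd_cycles V E W"
proof -
  interpret joined_cycles E p1 P p2 by (rule assms(1))
  let ?c1 = "hd P # p1" and ?c2 = "last P # p2"
  have ends: "hd P \<in> set P" "last P \<in> set P" using P by auto
  have ne: "hd P \<noteq> last P"
    using P assms(2) by (cases P) (auto dest: last_in_set)
  have c: "cycle_edges ?c1 = D1" "cycle_edges ?c2 = D2" by (simp_all add: cycle_edges_eq)
  \<comment> \<open>The locale knows only edges, so vertices are placed in \<open>V\<close> by way
    of an edge that contains them.\<close>
  have cov: "x \<in> V" if "x \<in> set ys" "path_edges ys \<subseteq> E" "length ys \<ge> 2" for x ys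
  proof -
    obtain i where i: "i < length ys" "x = ys ! i" using \<open>x \<in> set ys\<close> by (metis in_set_conv_nth)
    obtain k where k: "Suc k < length ys" "i = k \<or> i = Suc k"
      using i(1) \<open>length ys \<ge> 2\<close> by (cases i) (auto intro: that[of "0"] that[of "i - 1"])
    have "{ys ! k, ys ! Suc k} \<in> path_edges ys" using k(1) unfolding path_edges_def by blast
    then show ?thesis using i(2) k(2) \<open>path_edges ys \<subseteq> E\<close> assms(3) by blast
  qed
  have V: "set ?c1 \<subseteq> V" "set ?c2 \<subseteq> V" "set P \<subseteq> V"
    using cov[of _ "hd P # p1 @ [hd P]"] cov[of _ "last P # p2 @ [last P]"] cov[of _ P] edges assms(2) by auto
  have "length p1 \<noteq> 0" "length p2 \<noteq> 0" using p1(2) p2(2) by simp_all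
  then have len: "length p1 \<ge> 2" "length p2 \<ge> 2" using loops(3,4) by linarith+
  define W where "W = set ?c1 \<union> set ?c2 \<union> set P"
  have "induces_joined_odd_cycles V E W"
    unfolding induces_joined_odd_cycles_def
  proof (intro exI conjI)
    show "is_cycle V E ?c1" "is_cycle V E ?c2"
      unfolding is_cycle_def c using len loops V edges by auto
    show "odd (length ?c1)" "odd (length ?c2)" using p1 p2 by auto
    show "set ?c1 \<inter> set ?c2 = {}" "set P \<inter> set ?c1 = {hd P}" "set P \<inter> set ?c2 = {last P}"
      using disjoint ends ne by auto
    show "is_path V E P" unfolding is_path_def using P V edges by auto
    show "2 \<le> length P" by (rule assms(2))
    show "W = set ?c1 \<union> set ?c2 \<union> set P" by (rule W_def)
    have WP: "W = set p1 \<union> set P \<union> set p2" unfolding W_def using ends by auto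
    show "induced_edges E W = cycle_edges ?c1 \<union> cycle_edges ?c2 \<union> path_edges P"
    proof
      show "induced_edges E W \<subseteq> cycle_edges ?c1 \<union> cycle_edges ?c2 \<union> path_edges P"
        using ind unfolding induced_edges_def WP c by blast
      have "e \<subseteq> W" if "e \<in> D1 \<union> D2 \<union> path_edges P" for e
        using that path_edges_subset_set[of e "hd P # p1 @ [hd P]"]
          path_edges_subset_set[of e "last P # p2 @ [last P]"] path_edges_subset_set[of e P]
        unfolding W_def by auto
      then show "cycle_edges ?c1 \<union> cycle_edges ?c2 \<union> path_edges P \<subseteq> induced_edges E W"
        using edges unfolding induced_edges_def c by blast
    qed
  qed
  moreover have "W \<subseteq> V" using V unfolding W_def by auto
  ultimately show ?thesis by blast
qed

text \<open>A closed walk split off from \<open>u\<close> and \<open>v\<close> leaves only problems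
  of smaller degree, unless it exhausts \<open>u\<close>. Only then does the structure of walks
  enter, and what remains is an even cycle or two odd cycles with a common vertex, both squarefree
  circuits.\<close>

lemma sfsf_circuits_connect:
  assumes V: "\<Union>E \<subseteq> V" and no: "\<not> (\<exists>W\<subseteq>V. induces_joined_odd_cycles V E W)"
    and uv: "keys u \<subseteq> E" "keys v \<subseteq> E" "vdeg u = vdeg v"
  shows "conn (moves (sfsf_circuits edge_vec E :: ('v set, 'k::field) mpoly set)) u v"
  using uv
proof (induction "size u" arbitrary: u v rule: less_induct)
  case less
  let ?M = "moves (sfsf_circuits edge_vec E :: ('v set, 'k) mpoly set)"
  define n where "n = size u"
  have IH: "conn ?M u' v'" if "size u' < n" "keys u' \<subseteq> E" "keys v' \<subseteq> E" "vdeg u' = vdeg v'" for u' v'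
    using less.hyps that unfolding n_def by blast
  interpret chordless_walks E
    "\<lambda>xs. closed_walk E xs \<and> length xs = 2 * n \<and> \<not> conn ?M (pairs xs) (pairs (rotate1 xs))"
    using chordless_walks_of_degree[of n ?M, OF IH] by blast
  have from_circuit: "conn ?M a b"
    if "(monomial a - monomial b :: ('v set, 'k) mpoly) \<in> sfsf_circuits edge_vec E" for a b
  proof (cases "a = b")
    case False
    then have "(a, b) \<in> ?M" using that by (simp add: moves_def)
    then show ?thesis using conn_move[of a b ?M 0] by simp
  qed (simp add: conn.refl)
  have walk_conn: "conn ?M (pairs xs) (pairs (rotate1 xs))" if xs: "closed_walk E xs" "length xs = 2 * n" for xs
  proof (rule ccontr)
    assume nc: "\<not> conn ?M (pairs xs) (pairs (rotate1 xs))"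
    have "\<not> distinct xs"
    proof
      assume dist: "distinct xs"
      show False
      proof (cases "length xs = 2")
        case True
        then obtain a b where "xs = [a, b]" by (auto simp: length_Suc_conv numeral_2_eq_2)
        then have "pairs (rotate1 xs) = pairs xs" by (simp add: insert_commute)
        then show False using nc by (simp add: conn.refl)
      next
        case False
        then show False using nc from_circuit even_cycle_sfsf[OF dist xs(1)] by blast
      qed
    qed
    moreover have "\<not> (\<exists>p1 P p2. joined_cycles E p1 P p2 \<and> length P \<ge> 2 \<and>
      (\<forall>e\<in>E. e \<subseteq> set p1 \<union> set P \<union> set p2 \<longrightarrow>
        e \<in> path_edges (hd P # p1 @ [hd P]) \<union> path_edges P \<union> path_edges (last P # p2 @ [last P])))"
      using no joined_cycles_induces[OF _ _ V] by blast
    ultimately obtain a p q where W: "closed_walk E (a # p @ a # q)" "length (a # p @ a # q) = 2 * n"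
        "\<not> conn ?M (pairs (a # p @ a # q)) (pairs (rotate1 (a # p @ a # q)))" and dist: "distinct (a # p @ q)"
      using joined_cycles_or_bowtie[of xs] xs nc by blast
    have g: "even (length p)" "p \<noteq> []" using gate[of a p q] W dist by auto
    have gq: "even (length q)" "q \<noteq> []"
      using even_part'[of a p q] gate(2)[of a q p] rotate[of "a # p" "a # q"] W dist by auto
    have pe: "path_edges (a # p @ a # q @ [a]) \<subseteq> E" using W(1) by (simp add: closed_walk_def)
    interpret joined_cycles E p "[a]" q
    proof
      show "path_edges (hd [a] # p @ [hd [a]]) \<subseteq> E" "path_edges (last [a] # q @ [last [a]]) \<subseteq> E"
        using pe path_edges_append[of "a # p" a "q @ [a]"] by auto
    qed (use g gq dist in auto)
    have "walk = a # p @ a # q" by (simp add: walk_def)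
    then show False using walk_sfsf[where 'k = 'k] from_circuit[of "pairs walk" "pairs (rotate1 walk)"] W(3) by simp
  qed
  show ?case
  proof (cases "u = 0")
    case True
    then have "size v = 0" using vdeg_eq_imp_size_eq[OF less.prems(3)] by simp
    then have "v = 0" using size_eq_0 less.prems(2) by blast
    then show ?thesis using True by (simp add: conn.refl)
  next
    case False
    obtain xs u' v' where xs: "closed_walk E xs" "u = pairs xs + u'" "v = pairs (rotate1 xs) + v'"
      using ex_closed_walk[OF less.prems False] .
    note cw = closed_walk_pairs[OF xs(1)]
    have len: "even (length xs)" "length xs \<ge> 1" using xs(1) by (auto simp: closed_walk_def Suc_le_eq)
    then have pos: "length xs div 2 > 0" by (auto elim!: evenE)
    have k': "keys u' \<subseteq> E" "keys v' \<subseteq> E" using less.prems by (auto simp: xs(2,3) keys_add_nat)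
    have deg: "vdeg u' = vdeg v'" using less.prems(3) cw(3,4) by (simp add: xs(2,3) vdeg_add fun_eq_iff)
    have n: "n = length xs div 2 + size u'" by (simp add: n_def xs(2) size_add cw(5))
    have "conn ?M u' v'" by (rule IH) (use n pos k' deg in auto)
    moreover have "conn ?M (pairs xs) (pairs (rotate1 xs))"
    proof (cases "size u' = 0")
      case True
      then show ?thesis using walk_conn[OF xs(1)] n len(1) by auto
    next
      case False
      then show ?thesis by (intro IH) (use cw n in auto)
    qed
    ultimately show ?thesis unfolding xs(2,3) by (rule conn_add[rotated])
  qed
qed

section \<open>Joined odd cycles are fundamental\<close>

lemma path_edges_rotate:
  "path_edges ((l @ x # r) @ [hd (l @ x # r)]) = path_edges (x # (r @ l) @ [x])"
proof (cases l)
  case (Cons b l')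
  have "path_edges ((l @ x # r) @ [hd (l @ x # r)]) = path_edges (b # l' @ [x]) \<union> path_edges (x # r @ [b])"
    using path_edges_append[of "b # l'" x "r @ [b]"] by (simp add: Cons)
  moreover have "path_edges (x # (r @ l) @ [x]) = path_edges (x # r @ [b]) \<union> path_edges (b # l' @ [x])"
    using path_edges_append[of "x # r" b "l' @ [x]"] by (simp add: Cons)
  ultimately show ?thesis by auto
qed simp

lemma cycle_from:
  assumes "is_cycle V E c" "x \<in> set c"
  obtains p where "set c = insert x (set p)" "distinct (x # p)" "length c = Suc (length p)"
    "cycle_edges c = path_edges (x # p @ [x])"
proof -
  obtain l r where c: "c = l @ x # r" using split_list[OF assms(2)] by blast
  have "cycle_edges c = path_edges (x # (r @ l) @ [x])"
    using path_edges_rotate[of l x r] cycle_edges_eq[of c] c by simp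
  then show ?thesis using that[of "r @ l"] assms(1) by (auto simp: c is_cycle_def)
qed

text \<open>\<open>walk\<close> visits exactly the vertices in \<open>W\<close>, so the columns
  selected for its binomial are the edges of the induced subgraph. On these edges
  \<open>rigid_conn\<close> connects every fibre by the single move.\<close>

lemma induced_fundamental_circuit:
  assumes "induces_joined_odd_cycles V E W"
  shows "\<exists>f \<in> (circuits edge_vec E :: ('v set, 'k::field) mpoly set) - sfsf_circuits edge_vec E.
    fundamental edge_vec E f"
proof -
  obtain c1 c2 P where
    c1: "is_cycle V E c1" "odd (length c1)" and c2: "is_cycle V E c2" "odd (length c2)" and
    c12: "set c1 \<inter> set c2 = {}" and path: "is_path V E P" "2 \<le> length P" and
    Pc: "set P \<inter> set c1 = {hd P}" "set P \<inter> set c2 = {last P}" and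
    W: "W = set c1 \<union> set c2 \<union> set P" and
    ind: "induced_edges E W = cycle_edges c1 \<union> cycle_edges c2 \<union> path_edges P"
    using assms unfolding induces_joined_odd_cycles_def by blast
  obtain p1 where cyc1: "set c1 = insert (hd P) (set p1)" "distinct (hd P # p1)" "length c1 = Suc (length p1)"
    "cycle_edges c1 = path_edges (hd P # p1 @ [hd P])"
    using cycle_from[OF c1(1), of "hd P"] Pc(1) by blast
  obtain p2 where cyc2: "set c2 = insert (last P) (set p2)" "distinct (last P # p2)" "length c2 = Suc (length p2)"
    "cycle_edges c2 = path_edges (last P # p2 @ [last P])"
    using cycle_from[OF c2(1), of "last P"] Pc(2) by blast
  have hd_notin: "hd P \<notin> set p1" "last P \<notin> set p2" using cyc1(2) cyc2(2) by simp_all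
  have lens: "length p1 \<ge> 2" "length p2 \<ge> 2" using c1(1) c2(1) cyc1(3) cyc2(3) by (auto simp: is_cycle_def)
  interpret joined_cycles E p1 P p2
  proof
    show "even (length p1)" "even (length p2)" using c1(2) c2(2) cyc1(3) cyc2(3) by auto
    show "p1 \<noteq> []" "p2 \<noteq> []" using lens by auto
    show "distinct p1" "distinct p2" using cyc1(2) cyc2(2) by auto
    show "P \<noteq> []" "distinct P" "path_edges P \<subseteq> E" using path by (auto simp: is_path_def)
    show "path_edges (hd P # p1 @ [hd P]) \<subseteq> E" "path_edges (last P # p2 @ [last P]) \<subseteq> E"
      using c1(1) c2(1) cyc1(4) cyc2(4) by (auto simp: is_cycle_def)
    have "x = hd P" if "x \<in> set p1" "x \<in> set P" for x
      using that Pc(1) unfolding cyc1(1) by (metis IntI insertCI singletonD)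
    then show "set p1 \<inter> set P = {}" using hd_notin(1) by auto
    have "x = last P" if "x \<in> set p2" "x \<in> set P" for x
      using that Pc(2) unfolding cyc2(1) by (metis IntI insertCI singletonD)
    then show "set p2 \<inter> set P = {}" using hd_notin(2) by auto
    show "set p1 \<inter> set p2 = {}" using c12 cyc1(1) cyc2(1) by auto
  qed
  let ?u = "pairs walk" and ?v = "pairs (rotate1 walk)"
  let ?f = "monomial ?u - monomial ?v :: ('v set, 'k) mpoly"
  let ?D = "D1 \<union> path_edges P \<union> D2"
  note cw = closed_walk_pairs[OF closed]
  have ne: "?u \<noteq> ?v"
    using keys_walk_disjoint lookup_first_edge by (metis Int_absorb in_keys_iff empty_iff one_neq_zero)
  have deg: "vdeg ?u = vdeg ?v" using cw(3,4) by simp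
  have setw: "set walk = W"
  proof -
    have "set walk = insert (hd P) (set p1) \<union> set P \<union> set p2 \<union> set (tl P)" by (auto simp: walk_def)
    also have "\<dots> = W" unfolding W cyc1(1) cyc2(1) using P(1) list.set_sel(2)[of P] by auto
    finally show ?thesis .
  qed
  have pos: "vdeg ?u x > 0 \<longleftrightarrow> x \<in> W" for x
    using count_list_0_iff[of walk x] cw(3) setw by auto
  have "sub_columns edge_vec E ?f = {e\<in>E. \<forall>x\<in>e. vdeg ?u x > 0}"
    by (rule sub_columns_eq[OF ne cw(1,2) deg])
  also have "\<dots> = induced_edges E W" unfolding pos induced_edges_def by blast
  also have "\<dots> = ?D" unfolding ind cyc1(4) cyc2(4) by blast
  finally have sub: "sub_columns edge_vec E ?f = ?D" .
  have kD: "keys ?u \<subseteq> ?D" "keys ?v \<subseteq> ?D" using keys_walk by blast+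
  have DE: "?D \<subseteq> E" using edges by blast
  have "{?f} \<subseteq> toric_ideal edge_vec ?D"
    using binomial_in_toric_ideal_iff[OF ne, of edge_vec ?D, where 'k = 'k] kD texp_eq_iff[of ?u ?v] deg cw(1,2) by simp
  moreover have "\<forall>f\<in>{?f}. is_binomial f" unfolding is_binomial_def using ne by blast
  moreover have "\<forall>a b. keys a \<subseteq> ?D \<longrightarrow> keys b \<subseteq> ?D \<longrightarrow> texp edge_vec a = texp edge_vec b \<longrightarrow> conn (moves {?f}) a b"
  proof (intro allI impI)
    fix a b assume ab: "keys a \<subseteq> ?D" "keys b \<subseteq> ?D" "texp edge_vec a = texp edge_vec b"
    have "vdeg a = vdeg b" using ab DE texp_eq_iff[of a b] by blast
    then have "conn {(?u, ?v)} a b"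
      using rigid_conn[of ?u ?v "{hd P, hd p1}" a b] walk_rigid keys_walk keys_walk_disjoint
        lookup_first_edge deg ab(1,2) by simp
    then show "conn (moves {?f}) a b" by (rule conn_mono) (use ne in \<open>simp add: moves_def\<close>)
  qed
  ultimately have "toric_ideal edge_vec ?D = Idl\<^bsub>poly_ring ?D\<^esub> {?f}"
    using toric_ideal_eq_genideal_iff[of "{?f}" edge_vec ?D] by blast
  then have "fundamental edge_vec E ?f" unfolding fundamental_def sub .
  then show ?thesis using walk_circuit[where 'k = 'k] walk_not_sfsf[OF path(2), where 'k = 'k] by blast
qed

end

theorem theorem2p6:
  fixes V :: "'v set" and E :: "'v set set"
  assumes "finite V" and "simple_graph V E" and "connected_graph V E"
  defines "I \<equiv> (toric_ideal edge_vec E :: ('v set, 'k::field) mpoly set)"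
    and "C \<equiv> (circuits edge_vec E :: ('v set, 'k) mpoly set)"
    and "Csf \<equiv> (sfsf_circuits edge_vec E :: ('v set, 'k) mpoly set)"
  shows "(I = Idl\<^bsub>poly_ring E\<^esub> Csf \<longleftrightarrow> (\<forall>f \<in> C - Csf. redundant edge_vec E f)) \<and>
    ((\<forall>f \<in> C - Csf. redundant edge_vec E f) \<longleftrightarrow> (\<forall>f \<in> C - Csf. \<not> indispensable edge_vec E f)) \<and>
    ((\<forall>f \<in> C - Csf. \<not> indispensable edge_vec E f) \<longleftrightarrow> (\<forall>f \<in> C - Csf. \<not> fundamental edge_vec E f)) \<and>
    ((\<forall>f \<in> C - Csf. \<not> fundamental edge_vec E f) \<longleftrightarrow> \<not> (\<exists>W \<subseteq> V. induces_joined_odd_cycles V E W))"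
proof -
  have EV: "E \<subseteq> Pow V" "\<And>e. e \<in> E \<Longrightarrow> card e = 2" using assms(2) by (auto simp: simple_graph_def)
  interpret fin_graph E
    using EV finite_subset[of E "Pow V"] assms(1) by unfold_locales auto
  have C: "f \<in> I" "is_binomial f" if "f \<in> C" for f
    using that unfolding I_def C_def circuits_def by blast+
  have i_ii: "\<forall>f \<in> C - Csf. redundant edge_vec E f" if "I = Idl\<^bsub>poly_ring E\<^esub> Csf"
    using non_sfsf_redundant that unfolding I_def C_def Csf_def by blast
  have ii_iii: "\<forall>f \<in> C - Csf. \<not> indispensable edge_vec E f" if "\<forall>f \<in> C - Csf. redundant edge_vec E f"
    using that indispensable_not_redundant C unfolding I_def by blast
  have iii_iv: "\<forall>f \<in> C - Csf. \<not> fundamental edge_vec E f" if "\<forall>f \<in> C - Csf. \<not> indispensable edge_vec E f"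
    using that fundamental_indispensable C unfolding I_def by blast
  have iv_v: "\<not> (\<exists>W \<subseteq> V. induces_joined_odd_cycles V E W)" if "\<forall>f \<in> C - Csf. \<not> fundamental edge_vec E f"
    using that induced_fundamental_circuit[where 'k = 'k] unfolding C_def Csf_def by blast
  have v_i: "I = Idl\<^bsub>poly_ring E\<^esub> Csf" if no: "\<not> (\<exists>W \<subseteq> V. induces_joined_odd_cycles V E W)"
  proof -
    have "Csf \<subseteq> I" "\<forall>f\<in>Csf. is_binomial f"
      unfolding Csf_def I_def sfsf_circuits_def circuits_def by blast+
    moreover have "\<Union>E \<subseteq> V" using EV by blast
    then have "conn (moves Csf) u v" if "keys u \<subseteq> E" "keys v \<subseteq> E" "vdeg u = vdeg v" for u v
      unfolding Csf_def using sfsf_circuits_connect[OF _ no that] by blast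
    ultimately have "binomial_generators edge_vec E Csf"
      unfolding binomial_generators_iff I_def by blast
    then show ?thesis unfolding binomial_generators_def I_def by blast
  qed
  show ?thesis using i_ii ii_iii iii_iv iv_v v_i by argo
qed

end
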